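(* Let $E/\mathbb{Q}$ be given by $y^2+a_1xy+a_3y=x^3+a_2x^2+a_4x+a_6$ with $a_i\in\mathbb{Z}$, and let $\mathbf{P}=(P_1,\ldots,P_n)$ be linearly independent points of $E(\mathbb{Q})$ such that each $P_i$ reduces to a non-singular point modulo every prime $\ell$. Define $W:\mathbb{Z}^n\to\mathbb{Q}$ by $W(\mathbf{0})=0$ and $W(\mathbf{v})=(-1)^{\mathrm{Parity}[\Psi_{\mathbf{v}}(\mathbf{P};E)]}D_{\mathbf{v}\cdot\mathbf{P}}$ for $\mathbf{v}\ne\mathbf{0}$. Then $W$ is an elliptic net.
   Context: For $\mathbf{v}\in\mathbb{Z}^n\setminus\{\mathbf 0\}$ write $\mathbf{v}\cdot\mathbf{P}=v_1P_1+\cdots+v_nP_n=(A/D^2,B/D^3)$ with $A,B,D\in\mathbb{Z}$, $D>0$, in lowest terms, and set $D_{\mathbf{v}\cdot\mathbf{P}}=D$ (the elliptic denominator net). Net polynomials: with $\Lambda$ the period lattice of $E$ over $\mathbb{C}$, $\sigma(z;\Lambda)=z\prod_{0\ne\omega\in\Lambda}(1-z/\omega)e^{z/\omega+\frac12(z/\omega)^2}$, and $z_i\in\mathbb{C}$ corresponding to $P_i$ under $\mathbb{C}/\Lambda\cong E(\mathbb{C})$, $\Psi_{\mathbf{v}}(\mathbf{P};E)=(-1)^{\sum_i v_i^2-\sum_{i<j}v_iv_j-1}\sigma(\sum_i v_iz_i;\Lambda)\big/\big(\prod_i\sigma(z_i;\Lambda)^{2v_i^2-\sum_j v_iv_j}\prod_{i<j}\sigma(z_i+z_j;\Lambda)^{v_iv_j}\big)$,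 a nonzero real number for $\mathbf{v}\ne\mathbf0$. For nonzero real $x$, $\mathrm{Parity}[x]\in\mathbb{Z}/2\mathbb{Z}$ is defined by $x/|x|=(-1)^{\mathrm{Parity}[x]}$. An elliptic net is a map $W:\mathbb{Z}^n\to R$ with $W(\mathbf0)=0$ and $W(\mathbf{p}+\mathbf{q}+\mathbf{s})W(\mathbf{p}-\mathbf{q})W(\mathbf{r}+\mathbf{s})W(\mathbf{r})+W(\mathbf{q}+\mathbf{r}+\mathbf{s})W(\mathbf{q}-\mathbf{r})W(\mathbf{p}+\mathbf{s})W(\mathbf{p})+W(\mathbf{r}+\mathbf{p}+\mathbf{s})W(\mathbf{r}-\mathbf{p})W(\mathbf{q}+\mathbf{s})W(\mathbf{q})=0$ for all $\mathbf{p},\mathbf{q},\mathbf{r},\mathbf{s}\in\mathbb{Z}^n$. *)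

theory Defs
  imports "HOL-Analysis.Analysis"
begin

record wcurve =
  a1 :: int
  a2 :: int
  a3 :: int
  a4 :: int
  a6 :: int

definition b2 :: "wcurve \<Rightarrow> int" where "b2 E = a1 E ^ 2 + 4 * a2 E"
definition b4 :: "wcurve \<Rightarrow> int" where "b4 E = 2 * a4 E + a1 E * a3 E"
definition b6 :: "wcurve \<Rightarrow> int" where "b6 E = a3 E ^ 2 + 4 * a6 E"
definition b8 :: "wcurve \<Rightarrow> int" where
  "b8 E = a1 E ^ 2 * a6 E + 4 * a2 E * a6 E - a1 E * a3 E * a4 E + a2 E * a3 E ^ 2 - a4 E ^ 2"
definition c4 :: "wcurve \<Rightarrow> int" where "c4 E = b2 E ^ 2 - 24 * b4 E"
definition c6 :: "wcurve \<Rightarrow> int" where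
  "c6 E = - (b2 E ^ 3) + 36 * b2 E * b4 E - 216 * b6 E"
definition disc :: "wcurve \<Rightarrow> int" where
  "disc E = - (b2 E ^ 2) * b8 E - 8 * b4 E ^ 3 - 27 * b6 E ^ 2 + 9 * b2 E * b4 E * b6 E"

datatype ept = Inf | Pt rat rat

definition on_curve :: "wcurve \<Rightarrow> ept \<Rightarrow> bool" where
  "on_curve E P = (case P of Inf \<Rightarrow> True | Pt x y \<Rightarrow>
     y^2 + of_int (a1 E) * x * y + of_int (a3 E) * y
       = x^3 + of_int (a2 E) * x^2 + of_int (a4 E) * x + of_int (a6 E))"

text \<open>Group law (Silverman, III.2.3).\<close>
definition eneg :: "wcurve \<Rightarrow> ept \<Rightarrow> ept" where
  "eneg E P = (case P of Inf \<Rightarrow> Inf | Pt x y \<Rightarrow> Pt x (- y - of_int (a1 E) * x - of_int (a3 E)))"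

definition eadd :: "wcurve \<Rightarrow> ept \<Rightarrow> ept \<Rightarrow> ept" where
  "eadd E P Q = (case P of Inf \<Rightarrow> Q | Pt x1 y1 \<Rightarrow> (case Q of Inf \<Rightarrow> P | Pt x2 y2 \<Rightarrow>
     (if x1 = x2 \<and> y1 + y2 + of_int (a1 E) * x2 + of_int (a3 E) = 0 then Inf
      else
        let lam = (if x1 \<noteq> x2 then (y2 - y1) / (x2 - x1)
                   else (3 * x1^2 + 2 * of_int (a2 E) * x1 + of_int (a4 E) - of_int (a1 E) * y1)
                        / (2 * y1 + of_int (a1 E) * x1 + of_int (a3 E)));
            nu = (if x1 \<noteq> x2 then (y1 * x2 - y2 * x1) / (x2 - x1)
                  else (- (x1^3) + of_int (a4 E) * x1 + 2 * of_int (a6 E) - of_int (a3 E) * y1)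
                        / (2 * y1 + of_int (a1 E) * x1 + of_int (a3 E)));
            x3 = lam^2 + of_int (a1 E) * lam - of_int (a2 E) - x1 - x2;
            y3 = - (lam + of_int (a1 E)) * x3 - nu - of_int (a3 E)
        in Pt x3 y3)))"

fun nmul :: "wcurve \<Rightarrow> nat \<Rightarrow> ept \<Rightarrow> ept" where
  "nmul E 0 P = Inf"
| "nmul E (Suc k) P = eadd E (nmul E k P) P"

definition zmul :: "wcurve \<Rightarrow> int \<Rightarrow> ept \<Rightarrow> ept" where
  "zmul E k P = (if k \<ge> 0 then nmul E (nat k) P else eneg E (nmul E (nat (- k)) P))"

fun lincomb :: "wcurve \<Rightarrow> nat \<Rightarrow> (nat \<Rightarrow> int) \<Rightarrow> (nat \<Rightarrow> ept) \<Rightarrow> ept" where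
  "lincomb E 0 v P = Inf"
| "lincomb E (Suc k) v P = eadd E (lincomb E k v P) (zmul E (v k) (P k))"

definition Zn :: "nat \<Rightarrow> (nat \<Rightarrow> int) set" where
  "Zn n = {v. \<forall>i\<ge>n. v i = 0}"

definition lin_indep :: "wcurve \<Rightarrow> nat \<Rightarrow> (nat \<Rightarrow> ept) \<Rightarrow> bool" where
  "lin_indep E n P = (\<forall>v \<in> Zn n. lincomb E n v P = Inf \<longrightarrow> (\<forall>i<n. v i = 0))"

definition l_integral :: "int \<Rightarrow> rat \<Rightarrow> bool" where
  "l_integral l q = (\<not> l dvd snd (quotient_of q))"
definition l_zero :: "int \<Rightarrow> rat \<Rightarrow> bool" where
  "l_zero l q = (l dvd fst (quotient_of q))"

definition nonsing_red :: "wcurve \<Rightarrow> int \<Rightarrow> ept \<Rightarrow> bool" where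
  "nonsing_red E l P = (case P of Inf \<Rightarrow> True | Pt x y \<Rightarrow>
     \<not> l_integral l x \<or> \<not> l_integral l y \<or>
     \<not> (l_zero l (of_int (a1 E) * y - 3 * x^2 - 2 * of_int (a2 E) * x - of_int (a4 E))
        \<and> l_zero l (2 * y + of_int (a1 E) * x + of_int (a3 E))))"

definition edenom :: "ept \<Rightarrow> int" where
  "edenom Q = (case Q of Inf \<Rightarrow> 0 | Pt x y \<Rightarrow>
     (THE D::int. D > 0 \<and> (\<exists>A B::int. x = of_int A / of_int D ^ 2 \<and> y = of_int B / of_int D ^ 3
        \<and> coprime A D \<and> coprime B D)))"

definition lattice :: "complex \<Rightarrow> complex \<Rightarrow> complex set" where
  "lattice w1 w2 = {of_int m * w1 + of_int k * w2 | m k. True}"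

definition is_lattice_basis :: "complex \<Rightarrow> complex \<Rightarrow> bool" where
  "is_lattice_basis w1 w2 = (w1 \<noteq> 0 \<and> Im (w2 / w1) \<noteq> 0)"

definition g2 :: "complex set \<Rightarrow> complex" where
  "g2 L = 60 * infsum (\<lambda>w. 1 / w ^ 4) (L - {0})"
definition g3 :: "complex set \<Rightarrow> complex" where
  "g3 L = 140 * infsum (\<lambda>w. 1 / w ^ 6) (L - {0})"

definition wp :: "complex set \<Rightarrow> complex \<Rightarrow> complex" where
  "wp L z = 1 / z ^ 2 + infsum (\<lambda>w. 1 / (z - w) ^ 2 - 1 / w ^ 2) (L - {0})"

text \<open>Weierstrass sigma function; the (unconditionally convergent) product over the nonzero
  lattice points is the limit along finite subsets.\<close>
definition wsigma :: "complex set \<Rightarrow> complex \<Rightarrow> complex" where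
  "wsigma L z = Lim (finite_subsets_at_top (L - {0}))
     (\<lambda>F. z * (\<Prod>w\<in>F. (1 - z / w) * exp (z / w + (z / w) ^ 2 / 2)))"

text \<open>z corresponds to P under C/L = E(C): x = wp z - b2/12, 2y + a1 x + a3 = wp' z.\<close>
definition corresponds :: "wcurve \<Rightarrow> complex set \<Rightarrow> complex \<Rightarrow> ept \<Rightarrow> bool" where
  "corresponds E L z P = (case P of Inf \<Rightarrow> z \<in> L | Pt x y \<Rightarrow> z \<notin> L \<and>
     of_rat x = wp L z - of_int (b2 E) / 12 \<and>
     2 * of_rat y + of_int (a1 E) * of_rat x + of_int (a3 E) = deriv (wp L) z)"

text \<open>Net polynomial Psi_v(P;E) evaluated via the sigma function.\<close>
definition Psi :: "complex set \<Rightarrow> nat \<Rightarrow> (nat \<Rightarrow> complex) \<Rightarrow> (nat \<Rightarrow> int) \<Rightarrow> complex" where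
  "Psi L n z v =
     (-1) powi ((\<Sum>i<n. v i ^ 2) - (\<Sum>i<n. \<Sum>j<n. if i < j then v i * v j else 0) - 1)
     * wsigma L (\<Sum>i<n. of_int (v i) * z i)
     / ((\<Prod>i<n. wsigma L (z i) powi (2 * v i ^ 2 - (\<Sum>j<n. v i * v j)))
        * (\<Prod>i<n. \<Prod>j<n. if i < j then wsigma L (z i + z j) powi (v i * v j) else 1))"

definition Parity :: "real \<Rightarrow> nat" where
  "Parity x = (if x > 0 then 0 else 1)"

definition elliptic_net :: "nat \<Rightarrow> ((nat \<Rightarrow> int) \<Rightarrow> 'r::comm_ring_1) \<Rightarrow> bool" where
  "elliptic_net n W = (W (\<lambda>_. 0) = 0 \<and>
     (\<forall>p\<in>Zn n. \<forall>q\<in>Zn n. \<forall>r\<in>Zn n. \<forall>s\<in>Zn n.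
        W (\<lambda>i. p i + q i + s i) * W (\<lambda>i. p i - q i) * W (\<lambda>i. r i + s i) * W r
      + W (\<lambda>i. q i + r i + s i) * W (\<lambda>i. q i - r i) * W (\<lambda>i. p i + s i) * W p
      + W (\<lambda>i. r i + p i + s i) * W (\<lambda>i. r i - p i) * W (\<lambda>i. q i + s i) * W q = 0))"

definition denom_net :: "wcurve \<Rightarrow> complex set \<Rightarrow> nat \<Rightarrow> (nat \<Rightarrow> ept) \<Rightarrow> (nat \<Rightarrow> complex)
     \<Rightarrow> (nat \<Rightarrow> int) \<Rightarrow> rat" where
  "denom_net E L n P z v = (if v = (\<lambda>_. 0) then 0
     else (-1) ^ Parity (Re (Psi L n z v)) * of_int (edenom (lincomb E n v P)))"

end

theory Submission
  imports Defs "HOL-Complex_Analysis.Complex_Analysis" "HOL-Library.Function_Algebras"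
begin

text \<open>
  Write \<open>z\<^sub>v\<close> for \<open>\<Sum> v\<^sub>i z\<^sub>i\<close>. Up to the exponential of a quadratic form in \<open>v\<close>, the net polynomial
  \<open>\<Psi>\<^sub>v\<close> is \<open>\<sigma>(z\<^sub>v)\<close>, so the three-term relation of \<open>\<sigma>\<close> makes it an elliptic net. Good reduction of the
  points gives \<open>D\<^bsub>P+Q\<^esub> D\<^bsub>P-Q\<^esub> = D\<^sub>P\<^sup>2 D\<^sub>Q\<^sup>2 |x\<^sub>P - x\<^sub>Q|\<close>, which is the relation that
  \<open>\<sigma>(z + w) \<sigma>(z - w) = - \<sigma>(z)\<^sup>2 \<sigma>(w)\<^sup>2 (\<wp>(z) - \<wp>(w))\<close> imposes on \<open>|\<Psi>|\<close>. Hence the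
  logarithm of \<open>D\<^sub>v / |\<Psi>\<^sub>v|\<close> satisfies the parallelogram law, and multiplying an elliptic net by the
  exponential of such a function gives an elliptic net again.
\<close>

text \<open>The sign of the net is taken from the real part of \<open>\<Psi>\<close>, so a positive
  factor can be split off only once \<open>\<Psi>\<close> is known to be real. This is not read off
  from a symmetry of the lattice. It is propagated from the normalised values 1 at the unit vectors
  and at sums of two of them, using that the differences of \<open>\<wp>\<close> at the points, and
  the values of its derivative there, are rational. The denominator relation degenerates for P = Q
  and P = -Q, so the parallelogram law is first available away from these pairs, and the value at a
  double has to be recovered from higher multiples. Two facts about the group law carry the
  arithmetic. Nonsingular reduction must pass from the given points to all their combinations, which
  is shown directly from the chord and tangent formulas. And the sum of parameters must correspond
  to the sum of points; the addition theorem behind this is obtained by differentiating the product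
  formula for \<open>\<sigma>\<close> logarithmically, so that this one formula serves both the nets
  and the group law.\<close>

section \<open>Analytic tools: termwise differentiation, even functions, a double series\<close>

lemma infsum_has_field_derivative:
  fixes f f' :: "'a \<Rightarrow> complex \<Rightarrow> complex"
  assumes deriv: "\<And>w z. w \<in> T \<Longrightarrow> z \<in> ball z0 R \<Longrightarrow> (f w has_field_derivative f' w z) (at z)"
    and bound: "\<And>w z. w \<in> T \<Longrightarrow> z \<in> ball z0 R \<Longrightarrow> norm (f w z) \<le> M w"
    and summ: "M summable_on T"
    and z: "z \<in> ball z0 R"
  shows "(\<lambda>w. f w z) summable_on T" "(\<lambda>w. f' w z) summable_on T"
    and "((\<lambda>z. \<Sum>\<^sub>\<infinity>w\<in>T. f w z) has_field_derivative (\<Sum>\<^sub>\<infinity>w\<in>T. f' w z)) (at z)"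
proof -
  obtain r where r: "r > 0" "cball z r \<subseteq> ball z0 R"
    using z open_contains_cball[of "ball z0 R"] by blast
  have 1: "\<forall>\<^sub>F X in finite_subsets_at_top T. continuous_on (cball z r) (\<lambda>y. \<Sum>w\<in>X. f w y) \<and>
      (\<forall>y\<in>ball z r. ((\<lambda>y. \<Sum>w\<in>X. f w y) has_field_derivative (\<Sum>w\<in>X. f' w y)) (at y))"
    (is "\<forall>\<^sub>F X in _. ?P X")
  proof (rule eventually_finite_subsets_at_top_weakI)
    fix X assume X: "finite X" "X \<subseteq> T"
    have d: "((\<lambda>y. \<Sum>w\<in>X. f w y) has_field_derivative (\<Sum>w\<in>X. f' w y)) (at y)"
      if "y \<in> cball z r" for y
      using X that r by (intro DERIV_sum deriv) auto
    show "?P X"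
      using d by (auto intro!: continuous_at_imp_continuous_on DERIV_isCont)
  qed
  have 2: "uniform_limit (cball z r) (\<lambda>X y. \<Sum>w\<in>X. f w y) (\<lambda>y. \<Sum>\<^sub>\<infinity>w\<in>T. f w y) (finite_subsets_at_top T)"
    using r by (intro Weierstrass_m_test_general[OF bound summ]) auto
  \<comment> \<open>By Weierstrass's convergence theorem a uniform limit of holomorphic functions
    may be differentiated termwise. A summable majorant of the functions thus yields summability of
    their derivatives as well.\<close>
  obtain g' where g': "\<And>w. w \<in> ball z r \<Longrightarrow>
      ((\<lambda>y. \<Sum>\<^sub>\<infinity>w\<in>T. f w y) has_field_derivative (g' w)) (at w) \<and>
      ((\<lambda>X. \<Sum>v\<in>X. f' v w) \<longlongrightarrow> g' w) (finite_subsets_at_top T)"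
    using has_complex_derivative_uniform_limit[OF 1 2 _ r(1)] by auto
  have hs: "((\<lambda>w. f' w z) has_sum g' z) T"
    using g'[of z] r by (simp add: has_sum_def)
  then show "(\<lambda>w. f' w z) summable_on T"
    by (rule has_sum_imp_summable)
  show "((\<lambda>z. \<Sum>\<^sub>\<infinity>w\<in>T. f w z) has_field_derivative (\<Sum>\<^sub>\<infinity>w\<in>T. f' w z)) (at z)"
    using g'[of z] r infsumI[OF hs] by simp
  show "(\<lambda>w. f w z) summable_on T"
    using abs_summable_summable[OF Infinite_Sum.abs_summable_on_comparison_test'[OF summ bound]] z by auto
qed

text \<open>An even function has no linear Taylor coefficient, so a zero at the origin is at least
  double. It is applied where a double pole has to be seen to cancel: \<open>k\<close> supplies the
  finite limit at the origin that the Liouville argument asks for.\<close>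

lemma even_double_zero_factor:
  fixes G :: "complex \<Rightarrow> complex"
  assumes hol: "G holomorphic_on ball 0 r" and r: "r > 0"
    and ev: "\<And>z. z \<in> ball 0 r \<Longrightarrow> G (- z) = G z" and z0: "G 0 = 0"
  obtains k where "k holomorphic_on ball 0 r" "\<And>z. z \<in> ball 0 r \<Longrightarrow> G z = z\<^sup>2 * k z"
proof -
  define G1 where "G1 = (\<lambda>z. if z = 0 then deriv G 0 else (G z - G 0) / (z - 0))"
  have h1: "G1 holomorphic_on ball 0 r"
    unfolding G1_def by (rule pole_lemma_open[OF hol]) auto
  have 1: "G z = z * G1 z" for z
    using z0 by (auto simp: G1_def)
  have odd: "G1 (- z) = - G1 z" if "z \<in> ball 0 r" "z \<noteq> 0" for z
    using that ev[of z] z0 by (simp add: G1_def)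
  have c: "isCont G1 0"
    using h1 r by (metis analytic_at_ball analytic_at_imp_isCont)
  have l1: "((\<lambda>z. G1 (- z)) \<longlongrightarrow> G1 0) (at 0)"
  proof -
    have "isCont (\<lambda>z. G1 (- z)) 0"
      by (rule isCont_o2[where g = G1]) (use c in auto)
    then show ?thesis by (simp add: isCont_def)
  qed
  have l2: "((\<lambda>z. - G1 z) \<longlongrightarrow> - G1 0) (at 0)"
    using c by (intro tendsto_intros) (auto simp: isCont_def)
  have "\<forall>\<^sub>F z in at 0. z \<in> ball 0 r - {0}"
    using r by (intro eventually_at_in_open) auto
  then have "\<forall>\<^sub>F z in at 0. - G1 z = G1 (- z)"
    by eventually_elim (use odd in auto)
  then have "((\<lambda>z. G1 (- z)) \<longlongrightarrow> - G1 0) (at 0)"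
    using l2 by (rule Lim_transform_eventually[rotated])
  from tendsto_unique[OF _ l1 this] have G10: "G1 0 = 0"
    by simp
  define k where "k = (\<lambda>z. if z = 0 then deriv G1 0 else (G1 z - G1 0) / (z - 0))"
  have h2: "k holomorphic_on ball 0 r"
    unfolding k_def by (rule pole_lemma_open[OF h1]) auto
  have "G z = z\<^sup>2 * k z" for z
    using 1[of z] G10 by (auto simp: k_def power2_eq_square)
  with h2 show ?thesis
    using that by blast
qed

text \<open>With M the maximum, M^(-3) splits as M^(-3/2) times M^(-3/2), which is at most the
  product of one term in m and one term in k. Since 3/2 > 1, each one-variable series converges. The
  \<open>max 1\<close> in \<open>g\<close> only keeps the base positive at 0.\<close>

lemma summable_on_int_pair_max:
  "(\<lambda>(m::int, k::int). 1 / real_of_int (max \<bar>m\<bar> \<bar>k\<bar>) ^ 3) summable_on (UNIV - {(0,0)})"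
proof -
  define g where "g = (\<lambda>m::int. (max 1 \<bar>real_of_int m\<bar>) powr (-3/2))"
  have nat: "(\<lambda>n::nat. (max 1 (real n)) powr (-3/2)) summable_on UNIV"
  proof -
    have "summable (\<lambda>n::nat. (max 1 (real n)) powr (-3/2))"
    proof (rule summable_comparison_test_ev)
      show "\<forall>\<^sub>F n in sequentially. norm ((max 1 (real n)) powr (-3/2)) \<le> real n powr (-3/2)"
        using eventually_ge_at_top[of 1] by eventually_elim auto
      show "summable (\<lambda>n. real n powr (-3/2))"
        by (simp add: summable_real_powr_iff)
    qed
    then show ?thesis
      by (intro summable_nonneg_imp_summable_on) auto
  qed
  have g1: "g summable_on {0..}"
  proof -
    have "(\<lambda>n::nat. (max 1 (real n)) powr (-3/2)) summable_on UNIV \<longleftrightarrow> g summable_on {0..}"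
      by (rule summable_on_reindex_bij_witness[of _ nat int]) (auto simp: g_def)
    with nat show ?thesis by simp
  qed
  have g2: "g summable_on {..0}"
  proof -
    have "g summable_on {0..} \<longleftrightarrow> g summable_on {..0}"
      by (rule summable_on_reindex_bij_witness[of _ uminus uminus]) (auto simp: g_def)
    with g1 show ?thesis by simp
  qed
  have "{0..} \<union> {..0::int} = UNIV" by auto
  then have gs: "g summable_on UNIV"
    using summable_on_union[OF g1 g2] by simp
  have "(\<lambda>(m,k). g m * g k) summable_on UNIV \<times> UNIV"
  proof (rule summable_on_SigmaI)
    show "((\<lambda>y. case (x, y) of (m, k) \<Rightarrow> g m * g k) has_sum g x * infsum g UNIV) UNIV" for x
      using has_sum_cmult_right[OF has_sum_infsum[OF gs], of "g x"] by simp
    show "(\<lambda>x. g x * infsum g UNIV) summable_on UNIV"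
      using gs by (rule summable_on_cmult_left)
  qed (auto simp: g_def)
  then have "(\<lambda>(m,k). g m * g k) summable_on UNIV - {(0,0)}"
    by (rule summable_on_subset) auto
  then show ?thesis
  proof (rule summable_on_comparison_test)
    fix x :: "int \<times> int" assume x: "x \<in> UNIV - {(0,0)}"
    obtain m k where mk: "x = (m,k)" by force
    define M where "M = real_of_int (max \<bar>m\<bar> \<bar>k\<bar>)"
    have M: "M \<ge> 1" using x mk by (auto simp: M_def)
    have ge: "max 1 \<bar>real_of_int m\<bar> \<le> M" "max 1 \<bar>real_of_int k\<bar> \<le> M"
      using M by (auto simp: M_def)
    have "1 / M ^ 3 = M powr (-3/2) * M powr (-3/2)"
    proof -
      have "M powr (-3/2) * M powr (-3/2) = M powr (- 3)"
        by (subst powr_add[symmetric]) simp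
      also have "\<dots> = 1 / M powr 3"
        by (rule powr_minus_divide)
      also have "M powr 3 = M ^ 3"
        using M by (intro powr_numeral) auto
      finally show ?thesis by simp
    qed
    also have "\<dots> \<le> g m * g k"
      unfolding g_def using ge M by (intro mult_mono powr_mono2') auto
    finally show "(case x of (m, k) \<Rightarrow> 1 / real_of_int (max \<bar>m\<bar> \<bar>k\<bar>) ^ 3) \<le> (case x of (m, k) \<Rightarrow> g m * g k)"
      by (simp add: mk M_def)
  qed auto
qed

section \<open>Period lattices: discreteness and convergence of the cubic sum\<close>

locale period_lattice =
  fixes w1 w2 :: complex
  assumes basis: "is_lattice_basis w1 w2"
begin

abbreviation L where "L \<equiv> lattice w1 w2"

lemma L_add: "a \<in> L \<Longrightarrow> b \<in> L \<Longrightarrow> a + b \<in> L"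
  unfolding lattice_def mem_Collect_eq
  by (elim exE conjE, rename_tac m m' k k', rule_tac x = "m + m'" in exI, rule_tac x = "k + k'" in exI)
    (simp add: algebra_simps)

lemma L_uminus: "a \<in> L \<Longrightarrow> - a \<in> L"
  unfolding lattice_def mem_Collect_eq
  by (elim exE conjE, rename_tac m k, rule_tac x = "- m" in exI, rule_tac x = "- k" in exI)
    (simp add: algebra_simps)

lemma L_uminus_iff [simp]: "- a \<in> L \<longleftrightarrow> a \<in> L"
  using L_uminus[of a] L_uminus[of "- a"] by auto

lemma L_diff: "a \<in> L \<Longrightarrow> b \<in> L \<Longrightarrow> a - b \<in> L"
  using L_add[of a "- b"] by simp

lemma L_minus_commute: "a - b \<in> L \<longleftrightarrow> b - a \<in> L"
  using L_uminus_iff[of "a - b"] by simp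

lemma L_add_iff: "b \<in> L \<Longrightarrow> a + b \<in> L \<longleftrightarrow> a \<in> L"
  using L_add[of a b] L_diff[of "a + b" b] by auto

lemma L_0 [simp]: "0 \<in> L"
  unfolding lattice_def mem_Collect_eq by (rule exI[of _ 0], rule exI[of _ 0]) simp

text \<open>After division by one period, the imaginary part sees only the coefficient of the other,
  up to a fixed nonzero factor. So the norm controls both coefficients. Discreteness of
  \<open>L\<close> and convergence of all lattice sums rest on this bound.\<close>

lemma lattice_bound:
  "\<exists>c>0. \<forall>m k. c * real_of_int (max \<bar>m\<bar> \<bar>k\<bar>) \<le> norm (of_int m * w1 + of_int k * w2)"
proof -
  have w1: "w1 \<noteq> 0" and im: "Im (w2 / w1) \<noteq> 0"
    using basis by (auto simp: is_lattice_basis_def)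
  have w2: "w2 \<noteq> 0" using im by auto
  have im': "Im (w1 / w2) \<noteq> 0"
  proof
    assume "Im (w1 / w2) = 0"
    then have "w1 / w2 \<in> \<real>" by (simp add: complex_is_Real_iff)
    then have "inverse (w1 / w2) \<in> \<real>" by (rule Reals_inverse)
    then show False using im by (simp add: complex_is_Real_iff)
  qed
  have b1: "norm w1 * \<bar>Im (w2 / w1)\<bar> * \<bar>of_int k\<bar> \<le> norm (of_int m * w1 + of_int k * w2)" for m k :: int
  proof -
    have "\<bar>Im (w2 / w1)\<bar> * \<bar>of_int k\<bar> = \<bar>Im ((of_int m * w1 + of_int k * w2) / w1)\<bar>"
    proof -
      have "(of_int m * w1 + of_int k * w2) / w1 = of_int m + of_int k * (w2 / w1)"
        using w1 by (simp add: field_simps)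
      then show ?thesis by (simp add: abs_mult mult.commute del: times_divide_eq_right)
    qed
    also have "\<dots> \<le> norm ((of_int m * w1 + of_int k * w2) / w1)"
      by (rule abs_Im_le_cmod)
    finally show ?thesis
      using w1 by (simp add: norm_divide field_simps)
  qed
  have b2: "norm w2 * \<bar>Im (w1 / w2)\<bar> * \<bar>of_int m\<bar> \<le> norm (of_int m * w1 + of_int k * w2)" for m k :: int
  proof -
    have "\<bar>Im (w1 / w2)\<bar> * \<bar>of_int m\<bar> = \<bar>Im ((of_int m * w1 + of_int k * w2) / w2)\<bar>"
    proof -
      have "(of_int m * w1 + of_int k * w2) / w2 = of_int k + of_int m * (w1 / w2)"
        using w2 by (simp add: field_simps)
      then show ?thesis by (simp add: abs_mult mult.commute del: times_divide_eq_right)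
    qed
    also have "\<dots> \<le> norm ((of_int m * w1 + of_int k * w2) / w2)"
      by (rule abs_Im_le_cmod)
    finally show ?thesis
      using w2 by (simp add: norm_divide field_simps)
  qed
  define c where "c = min (norm w1 * \<bar>Im (w2 / w1)\<bar>) (norm w2 * \<bar>Im (w1 / w2)\<bar>)"
  have "c > 0" using w1 w2 im im' by (simp add: c_def)
  moreover have "c * real_of_int (max \<bar>m\<bar> \<bar>k\<bar>) \<le> norm (of_int m * w1 + of_int k * w2)" for m k
  proof (cases "\<bar>m\<bar> \<le> \<bar>k\<bar>")
    case True
    have "c * \<bar>of_int k\<bar> \<le> norm w1 * \<bar>Im (w2 / w1)\<bar> * \<bar>of_int k\<bar>"
      by (intro mult_right_mono) (auto simp: c_def)
    with b1[of k m] True show ?thesis by (simp add: max_def)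
  next
    case False
    have "c * \<bar>of_int m\<bar> \<le> norm w2 * \<bar>Im (w1 / w2)\<bar> * \<bar>of_int m\<bar>"
      by (intro mult_right_mono) (auto simp: c_def)
    with b2[of m k] False show ?thesis by (simp add: max_def)
  qed
  ultimately show ?thesis by blast
qed

lemma finite_L_cball: "finite (L \<inter> cball 0 r)"
proof -
  obtain c where c: "c > 0"
    "\<And>m k. c * real_of_int (max \<bar>m\<bar> \<bar>k\<bar>) \<le> norm (of_int m * w1 + of_int k * w2)"
    using lattice_bound by blast
  define N where "N = \<lceil>r / c\<rceil>"
  have "L \<inter> cball 0 r \<subseteq> (\<lambda>(m,k). of_int m * w1 + of_int k * w2) ` ({-N..N} \<times> {-N..N})"
  proof
    fix w assume w: "w \<in> L \<inter> cball 0 r"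
    then obtain m k where mk: "w = of_int m * w1 + of_int k * w2"
      by (auto simp: lattice_def)
    have "c * real_of_int (max \<bar>m\<bar> \<bar>k\<bar>) \<le> r"
      using c(2)[of m k] w mk by simp
    then have "real_of_int (max \<bar>m\<bar> \<bar>k\<bar>) \<le> r / c"
      using c(1) by (simp add: field_simps)
    then have "max \<bar>m\<bar> \<bar>k\<bar> \<le> N"
      unfolding N_def by linarith
    then show "w \<in> (\<lambda>(m,k). of_int m * w1 + of_int k * w2) ` ({-N..N} \<times> {-N..N})"
      unfolding mk by (intro image_eqI[of _ _ "(m,k)"]) auto
  qed
  then show ?thesis
    by (rule finite_subset) auto
qed

lemma countable_L: "countable L"
proof -
  have "L = (\<lambda>(m,k). of_int m * w1 + of_int k * w2) ` UNIV"
    by (auto simp: lattice_def)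
  then show ?thesis by simp
qed

lemma closed_L: "closed L"
proof -
  have "\<exists>T. open T \<and> x \<in> T \<and> T \<subseteq> - L" if "x \<notin> L" for x
  proof (intro exI conjI)
    show "open (ball x 1 - L \<inter> cball 0 (norm x + 1))"
      using finite_L_cball by (intro open_Diff finite_imp_closed) auto
    show "ball x 1 - L \<inter> cball 0 (norm x + 1) \<subseteq> - L"
    proof -
      have "norm y \<le> norm x + 1" if "y \<in> ball x 1" for y
        using that norm_triangle_sub[of y x] by (simp add: dist_norm norm_minus_commute)
      then show ?thesis by auto
    qed
  qed (use that in auto)
  then have "open (- L)"
    by (subst open_subopen) auto
  then show ?thesis by (simp add: closed_def)
qed

lemma summable_L_cube: "(\<lambda>w. 1 / norm w ^ 3) summable_on (L - {0})"
proof -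
  obtain c where c: "c > 0"
    "\<And>m k. c * real_of_int (max \<bar>m\<bar> \<bar>k\<bar>) \<le> norm (of_int m * w1 + of_int k * w2)"
    using lattice_bound by blast
  define h :: "int \<times> int \<Rightarrow> complex" where "h = (\<lambda>(m,k). of_int m * w1 + of_int k * w2)"
  have pos: "real_of_int (max \<bar>m\<bar> \<bar>k\<bar>) > 0" if "(m,k) \<noteq> (0,0)" for m k :: int
    using that by auto
  have nz: "h x \<noteq> 0" if "x \<noteq> (0,0)" for x
  proof -
    obtain m k where x: "x = (m,k)" by force
    have "0 < c * real_of_int (max \<bar>m\<bar> \<bar>k\<bar>)"
      using pos[of m k] that c(1) x by simp
    also have "\<dots> \<le> norm (h x)" using c(2)[of m k] by (simp add: h_def x)
    finally show ?thesis by auto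
  qed
  have hd: "h x - h y = h (fst x - fst y, snd x - snd y)" for x y
    by (auto simp: h_def case_prod_beta algebra_simps)
  \<comment> \<open>The lower bound also gives independence of the periods over the integers, so the
    sum over \<open>L\<close> may be reindexed by pairs of coefficients.\<close>
  have inj: "inj h"
  proof (rule injI)
    fix x y assume "h x = h y"
    then have "h (fst x - fst y, snd x - snd y) = 0" using hd[of x y] by simp
    then have "(fst x - fst y, snd x - snd y) = (0,0)" using nz by blast
    then show "x = y" by (auto simp: prod_eq_iff)
  qed
  have h0: "h (0,0) = 0" by (simp add: h_def)
  have img: "L - {0} = h ` (UNIV - {(0,0)})"
  proof -
    have "L = range h" by (auto simp: lattice_def h_def)
    then show ?thesis
      using image_set_diff[OF inj, of UNIV "{(0,0)}"] h0 by simp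
  qed
  have "(\<lambda>x. 1 / c ^ 3 * (\<lambda>(m, k). 1 / real_of_int (max \<bar>m\<bar> \<bar>k\<bar>) ^ 3) x) summable_on (UNIV - {(0,0)})"
    by (intro summable_on_cmult_right summable_on_int_pair_max)
  then have "(\<lambda>x. 1 / norm (h x) ^ 3) summable_on (UNIV - {(0,0)})"
  proof (rule summable_on_comparison_test)
    fix x :: "int \<times> int" assume x: "x \<in> UNIV - {(0,0)}"
    obtain m k where mk: "x = (m,k)" by force
    have "0 < c * real_of_int (max \<bar>m\<bar> \<bar>k\<bar>)"
      using pos[of m k] x c(1) mk by simp
    moreover have "\<dots> \<le> norm (h x)" using c(2)[of m k] by (simp add: h_def mk)
    ultimately have "1 / norm (h x) ^ 3 \<le> 1 / (c * real_of_int (max \<bar>m\<bar> \<bar>k\<bar>)) ^ 3"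
      by (intro frac_le power_mono zero_less_power) linarith+
    then show "1 / norm (h x) ^ 3 \<le> 1 / c ^ 3 * (\<lambda>(m, k). 1 / real_of_int (max \<bar>m\<bar> \<bar>k\<bar>) ^ 3) x"
      by (simp add: mk power_mult_distrib)
  qed auto
  then show ?thesis
    unfolding img using summable_on_reindex[of h "UNIV - {(0,0)}" "\<lambda>w. 1 / norm w ^ 3"] inj
    by (simp add: o_def inj_on_subset)
qed

end

section \<open>Weierstrass functions\<close>

lemma DERIV_prod_log:
  fixes f :: "'a \<Rightarrow> complex \<Rightarrow> complex"
  assumes "finite A" "\<And>i. i \<in> A \<Longrightarrow> (f i has_field_derivative f i z * g i) (at z)"
  shows "((\<lambda>z. \<Prod>i\<in>A. f i z) has_field_derivative (\<Prod>i\<in>A. f i z) * (\<Sum>i\<in>A. g i)) (at z)"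
  using assms
proof (induction A rule: finite_induct)
  case (insert x F)
  have "((\<lambda>z. f x z * (\<Prod>i\<in>F. f i z)) has_field_derivative
     (f x z * g x * (\<Prod>i\<in>F. f i z) + ((\<Prod>i\<in>F. f i z) * (\<Sum>i\<in>F. g i)) * f x z)) (at z)"
    by (intro DERIV_mult insert) auto
  with insert.hyps show ?case
    by (simp add: algebra_simps)
qed auto

definition sigma_factor :: "complex \<Rightarrow> complex \<Rightarrow> complex" where
  "sigma_factor w z = (1 - z / w) * exp (z / w + (z / w) ^ 2 / 2)"

text \<open>A logarithm of \<open>sigma_factor w\<close>. It is used for lattice points with
  \<open>2 * R < norm w\<close> and arguments of norm below \<open>R\<close>, where
  \<open>1 - z / w\<close> has positive real part and the principal branch is holomorphic.\<close>

definition sigma_log :: "complex \<Rightarrow> complex \<Rightarrow> complex" where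
  "sigma_log w z = Ln (1 - z / w) + z / w + (z / w) ^ 2 / 2"

text \<open>The logarithmic derivative of \<open>sigma_factor w\<close>, and the general term of the
  Weierstrass zeta function.\<close>

definition zeta_term :: "complex \<Rightarrow> complex \<Rightarrow> complex" where
  "zeta_term w z = 1 / (z - w) + 1 / w + z / w ^ 2"

lemma sigma_factor_deriv:
  assumes "w \<noteq> 0" "z \<noteq> w"
  shows "(sigma_factor w has_field_derivative sigma_factor w z * zeta_term w z) (at z)"
proof -
  have "(sigma_factor w has_field_derivative
     (- 1 / w) * exp (z / w + (z / w)\<^sup>2 / 2) +
     (1 - z / w) * (exp (z / w + (z / w)\<^sup>2 / 2) * (1 / w + z / w ^ 2))) (at z)"
    unfolding sigma_factor_def using assms(1)
    by (auto intro!: derivative_eq_intros simp: power2_eq_square field_simps)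
  also have "A * e + B * (e * C) = (A + B * C) * e" for A B C e :: complex
    by algebra
  also have "(- 1 / w) + (1 - z / w) * (1 / w + z / w ^ 2) = (1 - z / w) * zeta_term w z"
    using assms by (simp add: zeta_term_def divide_simps) (simp add: algebra_simps power2_eq_square)
  finally show ?thesis
    unfolding sigma_factor_def by (simp add: mult_ac)
qed

lemma zeta_term_deriv:
  assumes "z \<noteq> w"
  shows "(zeta_term w has_field_derivative 1 / w ^ 2 - 1 / (z - w) ^ 2) (at z)"
proof -
  have "(zeta_term w has_field_derivative - 1 / ((z - w) * (z - w)) + 0 + 1 / w ^ 2) (at z)"
    unfolding zeta_term_def using assms
    by (intro DERIV_add DERIV_cdivide DERIV_ident DERIV_const)
       (auto intro!: derivative_eq_intros)
  then show ?thesis by (simp add: power2_eq_square)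
qed

lemma wp_term_deriv:
  fixes z w :: complex
  assumes "z \<noteq> w"
  shows "((\<lambda>z. 1 / w ^ 2 - 1 / (z - w) ^ 2) has_field_derivative 2 / (z - w) ^ 3) (at z)"
proof -
  have "((\<lambda>z. 1 / w ^ 2 - 1 / (z - w) ^ 2) has_field_derivative
     (2 * (z - w)) / ((z - w) ^ 2 * (z - w) ^ 2)) (at z)"
    by (rule derivative_eq_intros refl | simp add: assms | simp add: diff_divide_distrib)+
  also have "(2 * d) / (d ^ 2 * d ^ 2) = 2 / d ^ 3" for d :: complex
    by (cases "d = 0") (simp_all add: field_simps power2_eq_square power3_eq_cube)
  finally show ?thesis .
qed

lemma wp'_term_deriv:
  fixes z w :: complex
  assumes "z \<noteq> w"
  shows "((\<lambda>z. 2 / (z - w) ^ 3) has_field_derivative - 6 / (z - w) ^ 4) (at z)"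
proof -
  have "((\<lambda>z. 2 / (z - w) ^ 3) has_field_derivative
     - (2 * (3 * (z - w) ^ 2)) / ((z - w) ^ 3 * (z - w) ^ 3)) (at z)"
    by (rule derivative_eq_intros refl | simp add: assms)+
  also have "- (2 * (3 * d ^ 2)) / (d ^ 3 * d ^ 3) = - 6 / d ^ 4" for d :: complex
    by (cases "d = 0") (simp_all add: field_simps power2_eq_square power3_eq_cube power4_eq_xxxx)
  finally show ?thesis .
qed

lemma far_point_bounds:
  fixes z w :: complex
  assumes "norm z < R" "2 * R < norm w"
  shows "norm w / 2 < norm (z - w)" "w \<noteq> 0" "z \<noteq> w" "norm (z / w) < 1 / 2"
proof -
  have "norm w \<le> norm z + norm (z - w)"
    using norm_triangle_ineq[of z "w - z"] by (simp add: norm_minus_commute)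
  with assms show 1: "norm w / 2 < norm (z - w)" by linarith
  have R: "R > 0" using assms(1) norm_ge_zero[of z] by linarith
  with assms have "norm w > 0" by linarith
  then show "w \<noteq> 0" by auto
  show "z \<noteq> w" using 1 \<open>norm w > 0\<close> by auto
  show "norm (z / w) < 1 / 2"
    using assms \<open>norm w > 0\<close> by (simp add: norm_divide field_simps)
qed

lemma sigma_log_deriv:
  assumes "norm z < R" "2 * R < norm w"
  shows "(sigma_log w has_field_derivative zeta_term w z) (at z)"
proof -
  note b = far_point_bounds[OF assms]
  have "\<bar>Re (z / w)\<bar> < 1 / 2" using abs_Re_le_cmod[of "z / w"] b(4) by linarith
  then have "Re (1 - z / w) > 0" by simp
  then have nn: "1 - z / w \<notin> \<real>\<^sub>\<le>\<^sub>0"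
    using complex_nonpos_Reals_iff[of "1 - z / w"] by linarith
  have "(sigma_log w has_field_derivative (- 1 / w) / (1 - z / w) + 1 / w + z / w ^ 2) (at z)"
    unfolding sigma_log_def
  proof (intro DERIV_add)
    show "((\<lambda>z. Ln (1 - z / w)) has_field_derivative (- 1 / w) / (1 - z / w)) (at z)"
      by (rule derivative_eq_intros refl nn | simp add: b inverse_eq_divide)+
    show "((\<lambda>z. z / w) has_field_derivative 1 / w) (at z)"
      by (intro DERIV_cdivide DERIV_ident)
    show "((\<lambda>z. (z / w)\<^sup>2 / 2) has_field_derivative z / w\<^sup>2) (at z)"
      using b(2) by (auto intro!: derivative_eq_intros simp: power2_eq_square)
  qed
  also have "(- 1 / w) / (1 - z / w) = 1 / (z - w)"
    using b by (simp add: field_simps)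
  finally show ?thesis
    by (simp add: zeta_term_def)
qed

text \<open>Over a common denominator the three terms cancel down to order w^(-3), the decay that
  makes the lattice series converge absolutely.\<close>

lemma zeta_term_eq:
  "w \<noteq> 0 \<Longrightarrow> z \<noteq> w \<Longrightarrow> zeta_term w z = z ^ 2 / (w ^ 2 * (z - w))"
  by (simp add: zeta_term_def divide_simps) (simp add: algebra_simps power2_eq_square)

lemma zeta_term_bound:
  assumes "norm z < R" "2 * R < norm w"
  shows "norm (zeta_term w z) \<le> 2 * R ^ 2 * (1 / norm w ^ 3)"
proof -
  note b = far_point_bounds[OF assms]
  have "norm (zeta_term w z) = norm z ^ 2 / (norm w ^ 2 * norm (z - w))"
    using b by (simp add: zeta_term_eq norm_divide norm_mult norm_power)
  also have "\<dots> \<le> R ^ 2 / (norm w ^ 2 * (norm w / 2))"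
    using b assms by (intro frac_le mult_left_mono power_mono mult_pos_pos) auto
  also have "\<dots> = 2 * R ^ 2 * (1 / norm w ^ 3)"
    by (simp add: power2_eq_square power3_eq_cube)
  finally show ?thesis .
qed

text \<open>Since \<open>sigma_log w 0 = 0\<close>, integrating the bound for the derivative along
  the disc suffices; no expansion of the logarithm is required.\<close>

lemma sigma_log_bound:
  assumes "norm z < R" "2 * R < norm w"
  shows "norm (sigma_log w z) \<le> 2 * R ^ 3 * (1 / norm w ^ 3)"
proof -
  have R: "R > 0" using assms(1) norm_ge_zero[of z] by linarith
  have "norm (sigma_log w z - sigma_log w 0) \<le> (2 * R ^ 2 * (1 / norm w ^ 3)) * norm (z - 0)"
  proof (rule field_differentiable_bound[of "ball 0 R"])
    show "(sigma_log w has_field_derivative zeta_term w x) (at x within ball 0 R)" if "x \<in> ball 0 R" for x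
      using sigma_log_deriv[of x R w] that assms by (simp add: has_field_derivative_at_within)
    show "norm (zeta_term w x) \<le> 2 * R ^ 2 * (1 / norm w ^ 3)" if "x \<in> ball 0 R" for x
      using zeta_term_bound[of x R w] that assms by simp
  qed (use assms R in auto)
  also have "\<dots> \<le> (2 * R ^ 2 * (1 / norm w ^ 3)) * R"
    using assms R by (intro mult_left_mono) auto
  finally show ?thesis
    by (simp add: sigma_log_def power2_eq_square power3_eq_cube)
qed

lemma wp_term_bound:
  assumes "norm z < R" "2 * R < norm w"
  shows "cmod (1 / w ^ 2 - 1 / (z - w) ^ 2) \<le> 12 * R * (1 / norm w ^ 3)"
proof -
  note b = far_point_bounds[OF assms]
  have R: "R > 0" using assms(1) norm_ge_zero[of z] by linarith
  have "1 / w ^ 2 - 1 / (z - w) ^ 2 = z * (z - 2 * w) / (w ^ 2 * (z - w) ^ 2)"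
    using b by (simp add: divide_simps) (simp add: algebra_simps power2_eq_square)
  then have "norm (1 / w ^ 2 - 1 / (z - w) ^ 2) = norm z * norm (z - 2 * w) / (norm w ^ 2 * norm (z - w) ^ 2)"
    by (simp add: norm_divide norm_mult norm_power)
  also have "norm (z - 2 * w) \<le> norm z + norm (2 * w)" by (rule norm_triangle_ineq4)
  then have n3: "norm (z - 2 * w) \<le> 3 * norm w"
    using assms R by (simp add: norm_mult)
  have "norm z * norm (z - 2 * w) / (norm w ^ 2 * norm (z - w) ^ 2) \<le> R * (3 * norm w) / (norm w ^ 2 * (norm w / 2) ^ 2)"
    using b assms R n3 by (intro frac_le mult_mono mult_left_mono power_mono mult_pos_pos) auto
  also have "\<dots> = 12 * R * (1 / norm w ^ 3)"
    using b by (simp add: field_simps power2_eq_square power3_eq_cube)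
  finally show ?thesis .
qed

lemma wp'_term_bound:
  assumes "norm z < R" "2 * R < norm w"
  shows "cmod (2 / (z - w) ^ 3) \<le> 16 * (1 / norm w ^ 3)"
proof -
  note b = far_point_bounds[OF assms]
  have "norm (2 / (z - w) ^ 3) = 2 / norm (z - w) ^ 3"
    by (simp add: norm_divide norm_power)
  also have "\<dots> \<le> 2 / (norm w / 2) ^ 3"
    using b by (intro frac_le power_mono zero_less_power) auto
  also have "\<dots> = 16 * (1 / norm w ^ 3)"
    by (simp add: power3_eq_cube)
  finally show ?thesis .
qed

context period_lattice
begin

text \<open>Apart from the origin, every lattice point in the disc of radius \<open>R\<close> lies
  in the finite set \<open>near R\<close>, so the zeros and poles there come from finitely many
  terms. The factor 2 keeps the points of \<open>far R\<close> at a distance from the disc, where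
  their tail is holomorphic.\<close>

definition far :: "real \<Rightarrow> complex set" where "far R = {w \<in> L. 2 * R < norm w}"
definition near :: "real \<Rightarrow> complex set" where "near R = {w \<in> L. w \<noteq> 0 \<and> norm w \<le> 2 * R}"

lemma finite_near: "finite (near R)"
  by (rule finite_subset[OF _ finite_L_cball[of "2 * R"]]) (auto simp: near_def)

lemma near_far:
  assumes "R > 0"
  shows "L - {0} = near R \<union> far R" "near R \<inter> far R = {}"
  using assms by (auto simp: near_def far_def)

lemma summable_far: "R > 0 \<Longrightarrow> (\<lambda>w. C * (1 / norm w ^ 3)) summable_on far R"
  using near_far[of R] by (intro summable_on_cmult_right summable_on_subset[OF summable_L_cube]) auto

lemma infsum_near_far:
  fixes g :: "complex \<Rightarrow> complex"
  assumes "R > 0" "g summable_on far R"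
  shows "g summable_on (L - {0})" "infsum g (L - {0}) = sum g (near R) + infsum g (far R)"
proof -
  have "(g has_sum (sum g (near R) + infsum g (far R))) (near R \<union> far R)"
    using near_far[OF assms(1)] finite_near assms(2)
    by (intro has_sum_Un_disjoint has_sum_infsum) auto
  then show "g summable_on (L - {0})" "infsum g (L - {0}) = sum g (near R) + infsum g (far R)"
    using near_far[OF assms(1)] by (simp_all add: has_sum_imp_summable infsumI)
qed

text \<open>One majorant, a multiple of 1 / |w|^3 with a constant depending only on
  \<open>R\<close>, serves each differentiated series. The chain runs from the logarithm of
  \<open>\<sigma>\<close> through the zeta function to the second derivative of
  \<open>\<wp>\<close>; the last series is summable because it is a termwise derivative.\<close>

lemma tail_derivs:
  assumes z: "z \<in> ball 0 R"
  shows "(\<lambda>w. sigma_log w z) summable_on far R"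
    "(\<lambda>w. zeta_term w z) summable_on far R"
    "(\<lambda>w. 1 / w ^ 2 - 1 / (z - w) ^ 2) summable_on far R"
    "(\<lambda>w. 2 / (z - w) ^ 3) summable_on far R"
    "(\<lambda>w. - 6 / (z - w) ^ 4) summable_on far R"
    "((\<lambda>z. \<Sum>\<^sub>\<infinity>w\<in>far R. sigma_log w z) has_field_derivative (\<Sum>\<^sub>\<infinity>w\<in>far R. zeta_term w z)) (at z)"
    "((\<lambda>z. \<Sum>\<^sub>\<infinity>w\<in>far R. zeta_term w z) has_field_derivative (\<Sum>\<^sub>\<infinity>w\<in>far R. 1 / w ^ 2 - 1 / (z - w) ^ 2)) (at z)"
    "((\<lambda>z. \<Sum>\<^sub>\<infinity>w\<in>far R. 1 / w ^ 2 - 1 / (z - w) ^ 2) has_field_derivative (\<Sum>\<^sub>\<infinity>w\<in>far R. 2 / (z - w) ^ 3)) (at z)"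
    "((\<lambda>z. \<Sum>\<^sub>\<infinity>w\<in>far R. 2 / (z - w) ^ 3) has_field_derivative (\<Sum>\<^sub>\<infinity>w\<in>far R. - 6 / (z - w) ^ 4)) (at z)"
proof -
  have R: "R > 0" using z norm_ge_zero[of z] by (auto simp del: norm_ge_zero)
  have ne: "x \<noteq> w" if "w \<in> far R" "x \<in> ball 0 R" for x w
    using far_point_bounds(3)[of x R w] that by (auto simp: far_def)
  note 1 = infsum_has_field_derivative[of "far R" 0 R sigma_log zeta_term, OF _ _ summable_far[OF R] z]
  show "(\<lambda>w. sigma_log w z) summable_on far R" 
    "((\<lambda>z. \<Sum>\<^sub>\<infinity>w\<in>far R. sigma_log w z) has_field_derivative (\<Sum>\<^sub>\<infinity>w\<in>far R. zeta_term w z)) (at z)"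
    by (rule 1[OF sigma_log_deriv[of _ R] sigma_log_bound[of _ R]]; auto simp: far_def)+
  note 2 = infsum_has_field_derivative[of "far R" 0 R zeta_term "\<lambda>w z. 1 / w ^ 2 - 1 / (z - w) ^ 2", OF _ _ summable_far[OF R] z]
  show "(\<lambda>w. zeta_term w z) summable_on far R" "(\<lambda>w. 1 / w ^ 2 - 1 / (z - w) ^ 2) summable_on far R"
    "((\<lambda>z. \<Sum>\<^sub>\<infinity>w\<in>far R. zeta_term w z) has_field_derivative (\<Sum>\<^sub>\<infinity>w\<in>far R. 1 / w ^ 2 - 1 / (z - w) ^ 2)) (at z)"
    by (rule 2[OF zeta_term_deriv zeta_term_bound[of _ R]]; use ne in \<open>auto simp: far_def\<close>)+
  note 3 = infsum_has_field_derivative[of "far R" 0 R "\<lambda>w z. 1 / w ^ 2 - 1 / (z - w) ^ 2" "\<lambda>w z. 2 / (z - w) ^ 3", OF _ _ summable_far[OF R] z]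
  show "((\<lambda>z. \<Sum>\<^sub>\<infinity>w\<in>far R. 1 / w ^ 2 - 1 / (z - w) ^ 2) has_field_derivative (\<Sum>\<^sub>\<infinity>w\<in>far R. 2 / (z - w) ^ 3)) (at z)"
    by (rule 3[OF wp_term_deriv wp_term_bound[of _ R]]; use ne in \<open>auto simp: far_def\<close>)
  note 4 = infsum_has_field_derivative[of "far R" 0 R "\<lambda>w z. 2 / (z - w) ^ 3" "\<lambda>w z. - 6 / (z - w) ^ 4", OF _ _ summable_far[OF R] z]
  show "(\<lambda>w. 2 / (z - w) ^ 3) summable_on far R" "(\<lambda>w. - 6 / (z - w) ^ 4) summable_on far R"
    "((\<lambda>z. \<Sum>\<^sub>\<infinity>w\<in>far R. 2 / (z - w) ^ 3) has_field_derivative (\<Sum>\<^sub>\<infinity>w\<in>far R. - 6 / (z - w) ^ 4)) (at z)"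
    by (rule 4[OF wp'_term_deriv wp'_term_bound[of _ R]]; use ne in \<open>auto simp: far_def\<close>)+
qed

definition zeta :: "complex \<Rightarrow> complex" where
  "zeta z = 1 / z + (\<Sum>\<^sub>\<infinity>w\<in>L-{0}. zeta_term w z)"
definition wp' :: "complex \<Rightarrow> complex" where
  "wp' z = - 2 / z ^ 3 - (\<Sum>\<^sub>\<infinity>w\<in>L-{0}. 2 / (z - w) ^ 3)"
definition wp'' :: "complex \<Rightarrow> complex" where
  "wp'' z = 6 / z ^ 4 - (\<Sum>\<^sub>\<infinity>w\<in>L-{0}. - 6 / (z - w) ^ 4)"

abbreviation \<sigma> where "\<sigma> \<equiv> wsigma L"
abbreviation wpf ("\<wp>") where "\<wp> \<equiv> wp L"

lemma wp_alt: "\<wp> z = 1 / z ^ 2 - (\<Sum>\<^sub>\<infinity>w\<in>L-{0}. 1 / w ^ 2 - 1 / (z - w) ^ 2)"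
proof -
  have "(\<Sum>\<^sub>\<infinity>w\<in>L-{0}. 1 / (z - w) ^ 2 - 1 / w ^ 2) = (\<Sum>\<^sub>\<infinity>w\<in>L-{0}. - (1 / w ^ 2 - 1 / (z - w) ^ 2))"
    by simp
  also have "\<dots> = - (\<Sum>\<^sub>\<infinity>w\<in>L-{0}. 1 / w ^ 2 - 1 / (z - w) ^ 2)"
    by (rule infsum_uminus)
  finally show ?thesis by (simp add: wp_def)
qed

lemma open_compl_L: "open (- L)"
  using closed_L by (simp add: open_Compl)

lemma local_derivs:
  assumes z: "z \<notin> L"
  shows "(zeta has_field_derivative - \<wp> z) (at z)"
    "(\<wp> has_field_derivative wp' z) (at z)"
    "(wp' has_field_derivative wp'' z) (at z)"
proof -
  define R where "R = norm z + 1"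
  have R: "R > 0" and zR: "z \<in> ball 0 R"
    by (simp_all add: R_def add_nonneg_pos)
  have z0: "z \<noteq> 0" using z by auto
  have ne: "z \<noteq> w" if "w \<in> near R" for w
    using that z by (auto simp: near_def)
  have op: "open (ball 0 R - L)" using closed_L by (intro open_Diff) auto
  have zin: "z \<in> ball 0 R - L" using z zR by auto
  note sp = infsum_near_far(2)[OF R]
  have a: "((\<lambda>z. 1 / z + ((\<Sum>w\<in>near R. zeta_term w z) + (\<Sum>\<^sub>\<infinity>w\<in>far R. zeta_term w z))) has_field_derivative
      - 1 / z ^ 2 + ((\<Sum>w\<in>near R. 1 / w ^ 2 - 1 / (z - w) ^ 2) + (\<Sum>\<^sub>\<infinity>w\<in>far R. 1 / w ^ 2 - 1 / (z - w) ^ 2))) (at z)"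
    using z0 ne by (intro DERIV_add DERIV_sum tail_derivs[OF zR] zeta_term_deriv)
       (auto intro!: derivative_eq_intros simp: power2_eq_square)
  have "(zeta has_field_derivative - 1 / z ^ 2 + ((\<Sum>w\<in>near R. 1 / w ^ 2 - 1 / (z - w) ^ 2) + (\<Sum>\<^sub>\<infinity>w\<in>far R. 1 / w ^ 2 - 1 / (z - w) ^ 2))) (at z)"
    by (rule has_field_derivative_transform_within_open[OF a op zin])
       (simp add: zeta_def sp tail_derivs)
  then show "(zeta has_field_derivative - \<wp> z) (at z)"
    using tail_derivs[OF zR] by (simp add: wp_alt sp)
  have a: "((\<lambda>z. 1 / z ^ 2 - ((\<Sum>w\<in>near R. 1 / w ^ 2 - 1 / (z - w) ^ 2) + (\<Sum>\<^sub>\<infinity>w\<in>far R. 1 / w ^ 2 - 1 / (z - w) ^ 2))) has_field_derivative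
      - 2 / z ^ 3 - ((\<Sum>w\<in>near R. 2 / (z - w) ^ 3) + (\<Sum>\<^sub>\<infinity>w\<in>far R. 2 / (z - w) ^ 3))) (at z)"
  proof (intro DERIV_diff DERIV_add DERIV_sum tail_derivs[OF zR] wp_term_deriv ne)
    show "((\<lambda>z. 1 / z\<^sup>2) has_field_derivative - 2 / z ^ 3) (at z)"
      using DERIV_minus[OF wp_term_deriv[of z 0]] z0 by simp
  qed auto
  have "(\<wp> has_field_derivative - 2 / z ^ 3 - ((\<Sum>w\<in>near R. 2 / (z - w) ^ 3) + (\<Sum>\<^sub>\<infinity>w\<in>far R. 2 / (z - w) ^ 3))) (at z)"
    by (rule has_field_derivative_transform_within_open[OF a op zin])
       (simp add: wp_alt sp tail_derivs)
  then show "(\<wp> has_field_derivative wp' z) (at z)"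
    using tail_derivs[OF zR] by (simp add: wp'_def sp)
  have a: "((\<lambda>z. - 2 / z ^ 3 - ((\<Sum>w\<in>near R. 2 / (z - w) ^ 3) + (\<Sum>\<^sub>\<infinity>w\<in>far R. 2 / (z - w) ^ 3))) has_field_derivative
      6 / z ^ 4 - ((\<Sum>w\<in>near R. - 6 / (z - w) ^ 4) + (\<Sum>\<^sub>\<infinity>w\<in>far R. - 6 / (z - w) ^ 4))) (at z)"
  proof (intro DERIV_diff DERIV_add DERIV_sum tail_derivs[OF zR] wp'_term_deriv ne)
    show "((\<lambda>z. - 2 / z ^ 3) has_field_derivative 6 / z ^ 4) (at z)"
      using DERIV_minus[OF wp'_term_deriv[of z 0]] z0 by simp
  qed auto
  have "(wp' has_field_derivative 6 / z ^ 4 - ((\<Sum>w\<in>near R. - 6 / (z - w) ^ 4) + (\<Sum>\<^sub>\<infinity>w\<in>far R. - 6 / (z - w) ^ 4))) (at z)"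
    by (rule has_field_derivative_transform_within_open[OF a op zin])
       (simp add: wp'_def sp tail_derivs)
  then show "(wp' has_field_derivative wp'' z) (at z)"
    using tail_derivs[OF zR] by (simp add: wp''_def sp)
qed

text \<open>Finite subsets of \<open>L - {0}\<close> eventually contain \<open>near R\<close>. The
  partial product then splits off a fixed finite factor, and the rest is the exponential of a
  partial sum of logarithms. Zeros and holomorphy of \<open>\<sigma>\<close> can be read off,
  because the exponential never vanishes.\<close>

lemma sigma_near_far:
  assumes z: "z \<in> ball 0 R"
  shows "\<sigma> z = z * (\<Prod>w\<in>near R. sigma_factor w z) * exp (\<Sum>\<^sub>\<infinity>w\<in>far R. sigma_log w z)"
proof -
  have R: "R > 0" using z norm_ge_zero[of z] by (auto simp del: norm_ge_zero)
  define S where "S = (\<Sum>\<^sub>\<infinity>w\<in>far R. sigma_log w z)"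
  have "((\<lambda>w. sigma_log w z) has_sum S) (far R)"
    unfolding S_def using tail_derivs(1)[OF z] by simp
  then have "((\<lambda>w. if w \<in> far R then sigma_log w z else 0) has_sum S) (L - {0})"
    by (rule has_sum_cong_neutral[THEN iffD1, rotated -1]) (use near_far[OF R] in auto)
  then have lim: "((\<lambda>F. z * (\<Prod>w\<in>near R. sigma_factor w z) * exp (\<Sum>w\<in>F. if w \<in> far R then sigma_log w z else 0))
       \<longlongrightarrow> z * (\<Prod>w\<in>near R. sigma_factor w z) * exp S) (finite_subsets_at_top (L - {0}))"
    by (intro tendsto_intros) (simp add: has_sum_def)
  have ev: "\<forall>\<^sub>F F in finite_subsets_at_top (L - {0}).
      z * (\<Prod>w\<in>near R. sigma_factor w z) * exp (\<Sum>w\<in>F. if w \<in> far R then sigma_log w z else 0)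
       = z * (\<Prod>w\<in>F. (1 - z / w) * exp (z / w + (z / w) ^ 2 / 2))"
  proof -
    have "\<forall>\<^sub>F F in finite_subsets_at_top (L - {0}). finite F \<and> near R \<subseteq> F \<and> F \<subseteq> L - {0}"
      unfolding eventually_finite_subsets_at_top
      by (rule exI[of _ "near R"]) (use near_far[OF R] finite_near in auto)
    then show ?thesis
    proof eventually_elim
      case (elim F)
      have F: "F = near R \<union> (F \<inter> far R)" using elim near_far[OF R] by auto
      have e: "exp (sigma_log w z) = sigma_factor w z" if "w \<in> far R" for w
      proof -
        have b: "w \<noteq> 0" "z \<noteq> w" using far_point_bounds[of z R w] that z by (auto simp: far_def)
        then have "1 - z / w \<noteq> 0" by simp
        then show ?thesis by (simp add: sigma_log_def sigma_factor_def exp_add mult_ac)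
      qed
      have "(\<Sum>w\<in>F. if w \<in> far R then sigma_log w z else 0) = (\<Sum>w\<in>F \<inter> far R. sigma_log w z)"
        using elim by (simp add: sum.If_cases)
      then have "exp (\<Sum>w\<in>F. if w \<in> far R then sigma_log w z else 0) = (\<Prod>w\<in>F \<inter> far R. sigma_factor w z)"
        using elim by (simp add: exp_sum e)
      moreover have "(\<Prod>w\<in>F. sigma_factor w z) = (\<Prod>w\<in>near R. sigma_factor w z) * (\<Prod>w\<in>F \<inter> far R. sigma_factor w z)"
        using near_far[OF R] elim finite_near by (subst F, subst prod.union_disjoint) auto
      ultimately show ?case by (simp add: sigma_factor_def)
    qed
  qed
  have "((\<lambda>F. z * (\<Prod>w\<in>F. (1 - z / w) * exp (z / w + (z / w) ^ 2 / 2)))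
     \<longlongrightarrow> z * (\<Prod>w\<in>near R. sigma_factor w z) * exp S) (finite_subsets_at_top (L - {0}))"
    by (rule Lim_transform_eventually[OF lim ev])
  then show ?thesis
    unfolding wsigma_def S_def[symmetric] by (intro tendsto_Lim) auto
qed

lemma sigma_eq_0_iff: "\<sigma> z = 0 \<longleftrightarrow> z \<in> L"
proof -
  define R where "R = norm z + 1"
  have R: "R > 0" and zR: "z \<in> ball 0 R"
    by (simp_all add: R_def add_nonneg_pos)
  have *: "sigma_factor w z = 0 \<longleftrightarrow> w = z" if "w \<in> near R" for w
    using that by (auto simp: sigma_factor_def near_def)
  have "\<sigma> z = 0 \<longleftrightarrow> z = 0 \<or> (\<exists>w\<in>near R. w = z)"
    unfolding sigma_near_far[OF zR] using finite_near * by auto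
  also have "\<dots> \<longleftrightarrow> z \<in> L"
    using R by (auto simp: near_def R_def)
  finally show ?thesis .
qed

lemma sigma_holomorphic: "\<sigma> holomorphic_on A"
proof -
  have "\<sigma> field_differentiable at z" for z
  proof -
    define R where "R = norm z + 1"
    have zR: "z \<in> ball 0 R" by (auto simp: R_def)
    have "(\<lambda>z. \<Sum>\<^sub>\<infinity>w\<in>far R. sigma_log w z) holomorphic_on ball 0 R"
      using tail_derivs(6) by (subst holomorphic_on_open) blast+
    moreover have "sigma_factor w holomorphic_on ball 0 R" if "w \<in> near R" for w
      unfolding sigma_factor_def using that by (intro holomorphic_intros) (auto simp: near_def)
    ultimately have "(\<lambda>z. z * (\<Prod>w\<in>near R. sigma_factor w z) * exp (\<Sum>\<^sub>\<infinity>w\<in>far R. sigma_log w z)) holomorphic_on ball 0 R"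
      by (intro holomorphic_intros) auto
    then have "\<sigma> holomorphic_on ball 0 R"
      by (rule holomorphic_transform) (simp add: sigma_near_far)
    then show ?thesis
      using zR holomorphic_on_imp_differentiable_at by blast
  qed
  then show ?thesis
    by (simp add: holomorphic_on_def field_differentiable_at_within)
qed

lemma sigma_deriv: 
  assumes z: "z \<notin> L"
  shows "(\<sigma> has_field_derivative \<sigma> z * zeta z) (at z)"
proof -
  define R where "R = norm z + 1"
  have R: "R > 0" and zR: "z \<in> ball 0 R"
    by (simp_all add: R_def add_nonneg_pos)
  define S where "S = (\<lambda>z. \<Sum>\<^sub>\<infinity>w\<in>far R. sigma_log w z)"
  define S' where "S' = (\<Sum>\<^sub>\<infinity>w\<in>far R. zeta_term w z)"
  define P where "P = (\<lambda>z. \<Prod>w\<in>near R. sigma_factor w z)"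
  have dS: "(S has_field_derivative S') (at z)"
    unfolding S_def S'_def by (rule tail_derivs[OF zR])
  have dP: "(P has_field_derivative P z * (\<Sum>w\<in>near R. zeta_term w z)) (at z)"
    unfolding P_def using finite_near z
    by (intro DERIV_prod_log sigma_factor_deriv) (auto simp: near_def)
  have "((\<lambda>z. z * P z * exp (S z)) has_field_derivative
     (1 * P z + P z * (\<Sum>w\<in>near R. zeta_term w z) * z) * exp (S z) + (exp (S z) * S') * (z * P z)) (at z)"
    by (intro DERIV_mult DERIV_ident dP DERIV_fun_exp dS)
  moreover have "(1 * P z + P z * (\<Sum>w\<in>near R. zeta_term w z) * z) * exp (S z) + (exp (S z) * S') * (z * P z)
      = (z * P z * exp (S z)) * (1 / z + ((\<Sum>w\<in>near R. zeta_term w z) + S'))"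
    using z by (auto simp: field_simps)
  ultimately have d: "((\<lambda>z. z * P z * exp (S z)) has_field_derivative
     (z * P z * exp (S z)) * (1 / z + ((\<Sum>w\<in>near R. zeta_term w z) + S'))) (at z)"
    by simp
  have "(\<sigma> has_field_derivative (z * P z * exp (S z)) * (1 / z + ((\<Sum>w\<in>near R. zeta_term w z) + S'))) (at z)"
    by (rule has_field_derivative_transform_within_open[OF d open_ball zR])
       (simp add: sigma_near_far P_def S_def)
  then show ?thesis
    using tail_derivs(2)[OF zR] sigma_near_far[OF zR]
    by (simp add: P_def S_def S'_def zeta_def infsum_near_far(2)[OF R])
qed

text \<open>With such a radius the tail is the whole sum over \<open>L - {0}\<close>, so the parts
  that remain after removing the terms of the origin are holomorphic around 0.\<close>

lemma small_radius: obtains R where "R > 0" "near R = {}" "far R = L - {0}" "ball 0 R \<inter> L = {0}"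
proof -
  \<comment> \<open>The inserted 1 covers the case that \<open>near 1\<close> is empty, and halving
    the minimum turns the bound on the norms into a strict one.\<close>
  define e where "e = Min (insert 1 (norm ` near 1)) / 2"
  have "Min (insert 1 (norm ` near 1)) > 0"
  proof (subst Min_gr_iff)
    show "\<forall>a\<in>insert 1 (norm ` near 1). 0 < a"
      by (auto simp: near_def)
  qed (use finite_near[of 1] in simp_all)
  then have e: "e > 0" "2 * e > e"
    by (simp_all add: e_def)
  have e2: "e < norm w" if "w \<in> near 1" for w
  proof -
    have "2 * e \<le> norm w"
      unfolding e_def using finite_near[of 1] that by (simp add: Min_le)
    with e show ?thesis by linarith
  qed
  define R where "R = min 1 (e / 2)"
  have R: "R > 0" "R \<le> 1" "2 * R \<le> e" using e by (auto simp: R_def)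
  have n: "near R = {}"
  proof -
    have "w \<in> near 1" if "w \<in> near R" for w using that R by (auto simp: near_def)
    then have False if "w \<in> near R" for w
      using e2[of w] R that by (auto simp: near_def)
    then show ?thesis by blast
  qed
  moreover have "far R = L - {0}" using near_far[OF R(1)] n by auto
  moreover have "ball 0 R \<inter> L = {0}"
    using n R by (auto simp: near_def)
  ultimately show ?thesis using that R by blast
qed

end

section \<open>Parity, periodicity and Liouville's theorem for elliptic functions\<close>

context period_lattice
begin

lemma infsum_L0_uminus:
  fixes f :: "complex \<Rightarrow> complex"
  shows "(\<Sum>\<^sub>\<infinity>w\<in>L-{0}. f (- w)) = (\<Sum>\<^sub>\<infinity>w\<in>L-{0}. f w)"
  by (rule infsum_reindex_bij_witness[of _ uminus uminus]) auto

lemma wp_even: "\<wp> (- z) = \<wp> z"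
proof -
  have "(\<Sum>\<^sub>\<infinity>w\<in>L-{0}. 1 / (- z - w) ^ 2 - 1 / w ^ 2) = (\<Sum>\<^sub>\<infinity>w\<in>L-{0}. 1 / (- z - (- w)) ^ 2 - 1 / (- w) ^ 2)"
    by (rule infsum_L0_uminus[symmetric])
  also have "\<dots> = (\<Sum>\<^sub>\<infinity>w\<in>L-{0}. 1 / (z - w) ^ 2 - 1 / w ^ 2)"
    by (intro infsum_cong) (simp add: power2_commute)
  finally show ?thesis by (simp add: wp_def)
qed

lemma zeta_odd: "zeta (- z) = - zeta z"
proof -
  have "(\<Sum>\<^sub>\<infinity>w\<in>L-{0}. zeta_term w (- z)) = (\<Sum>\<^sub>\<infinity>w\<in>L-{0}. zeta_term (- w) (- z))"
    by (rule infsum_L0_uminus[symmetric])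
  also have "\<dots> = (\<Sum>\<^sub>\<infinity>w\<in>L-{0}. - zeta_term w z)"
  proof (rule infsum_cong)
    fix w
    have "1 / (w - z) = - (1 / (z - w))"
      by (metis minus_diff_eq minus_divide_right)
    then show "zeta_term (- w) (- z) = - zeta_term w z"
      by (simp add: zeta_term_def)
  qed
  finally show ?thesis by (simp add: zeta_def infsum_uminus)
qed

lemma sigma_odd: "\<sigma> (- z) = - \<sigma> z"
proof -
  define R where "R = norm z + 1"
  have zR: "z \<in> ball 0 R" "- z \<in> ball 0 R" by (auto simp: R_def)
  have "(\<Prod>w\<in>near R. sigma_factor w (- z)) = (\<Prod>w\<in>near R. sigma_factor w z)"
    by (rule prod.reindex_bij_witness[of _ uminus uminus]) (auto simp: near_def sigma_factor_def)
  moreover have "(\<Sum>\<^sub>\<infinity>w\<in>far R. sigma_log w (- z)) = (\<Sum>\<^sub>\<infinity>w\<in>far R. sigma_log w z)"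
    by (rule infsum_reindex_bij_witness[of _ uminus uminus]) (auto simp: far_def sigma_log_def)
  ultimately show ?thesis
    using sigma_near_far[OF zR(1)] sigma_near_far[OF zR(2)] by simp
qed

lemma summable_wp'_terms: "(\<lambda>w. 2 / (z - w) ^ 3) summable_on (L - {0})"
proof (rule infsum_near_far)
  show "norm z + 1 > 0" by (simp add: add_nonneg_pos)
  show "(\<lambda>w. 2 / (z - w) ^ 3) summable_on far (norm z + 1)"
    by (rule tail_derivs) auto
qed

text \<open>The series of the derivative carries no convergence corrections. Once the principal part
  at the origin is absorbed it runs over all of \<open>L\<close>, and a translation by a period is a
  mere reindexing.\<close>

lemma wp'_L: "wp' z = - (\<Sum>\<^sub>\<infinity>w\<in>L. 2 / (z - w) ^ 3)"
proof -
  have "(\<Sum>\<^sub>\<infinity>w\<in>insert 0 (L - {0}). 2 / (z - w) ^ 3) = 2 / (z - 0) ^ 3 + (\<Sum>\<^sub>\<infinity>w\<in>L-{0}. 2 / (z - w) ^ 3)"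
    by (rule infsum_insert[OF summable_wp'_terms]) auto
  moreover have "insert 0 (L - {0}) = L" by auto
  ultimately show ?thesis by (simp add: wp'_def)
qed

lemma wp'_periodic:
  assumes "\<omega> \<in> L"
  shows "wp' (z + \<omega>) = wp' z"
  unfolding wp'_L
  by (rule arg_cong[where f = uminus], rule infsum_reindex_bij_witness[of _ "\<lambda>w. w + \<omega>" "\<lambda>w. w - \<omega>"])
     (use assms L_add L_diff in \<open>auto simp: algebra_simps\<close>)

text \<open>The plane minus a countable set is connected, so a vanishing derivative gives a single
  constant for all arguments off the lattice.\<close>

lemma L_compl_constant:
  assumes "\<And>z. z \<notin> L \<Longrightarrow> (f has_field_derivative 0) (at z)"
  shows "\<exists>c::complex. \<forall>z. z \<notin> L \<longrightarrow> f z = c"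
proof -
  have con: "connected (- L)"
    using countable_L path_connected_complement_countable[of L] by (simp add: path_connected_imp_connected)
  have cont: "continuous_on (- L) f"
    using assms by (intro continuous_at_imp_continuous_on) (auto intro: DERIV_isCont)
  obtain c where "\<And>x. x \<in> - L \<Longrightarrow> f x = c"
    by (rule DERIV_zero_connected_constant[OF con open_compl_L finite.emptyI cont])
       (use assms in auto)
  then show ?thesis by auto
qed

lemma ex_not_in_L: "\<exists>z. z \<notin> L"
  using countable_L uncountable_UNIV_complex by (metis UNIV_eq_I)

lemma wp_periodic:
  assumes w: "\<omega> \<in> L" and z: "z \<notin> L"
  shows "\<wp> (z + \<omega>) = \<wp> z"
proof -
  have per: "\<exists>c. \<forall>z. z \<notin> L \<longrightarrow> \<wp> (z + a) - \<wp> z = c" if a: "a \<in> L" for a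
  proof -
    have "((\<lambda>z. \<wp> (z + a) - \<wp> z) has_field_derivative 0) (at z)" if z: "z \<notin> L" for z
    proof -
      have "(\<wp> has_field_derivative wp' (z + a)) (at (z + a))"
        using z a by (intro local_derivs) (simp add: L_add_iff)
      then have "((\<lambda>z. \<wp> (z + a)) has_field_derivative wp' (z + a)) (at z)"
        by (simp only: DERIV_shift)
      then have "((\<lambda>z. \<wp> (z + a) - \<wp> z) has_field_derivative wp' (z + a) - wp' z) (at z)"
        by (intro DERIV_diff local_derivs z)
      then show ?thesis using wp'_periodic[OF a] by simp
    qed
    then show ?thesis by (rule L_compl_constant)
  qed
  obtain c where c: "\<And>z. z \<notin> L \<Longrightarrow> \<wp> (z + \<omega>) - \<wp> z = c"
    using per[OF w] by blast
  \<comment> \<open>The usual evaluation at minus half the period fails when that half is itself a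
    period. The substitution of \<open>- z - \<omega>\<close> for \<open>z\<close> never meets the
    lattice; by evenness it exchanges the two values, whence \<open>c = - c\<close>.\<close>
  have "\<wp> (- z - \<omega> + \<omega>) - \<wp> (- z - \<omega>) = c"
    using z w L_add_iff[OF w, of z] L_uminus_iff[of "z + \<omega>"] by (intro c) auto
  then have "\<wp> z - \<wp> (z + \<omega>) = c"
    using wp_even[of z] wp_even[of "z + \<omega>"] by simp
  with c[OF z] have "c = - c" by (metis minus_diff_eq)
  then have "c + c = 0" by (metis add.right_inverse)
  then have "2 * c = 0" by (simp only: mult_2)
  then have "c = 0" by simp
  with c[OF z] show ?thesis by simp
qed

text \<open>Periodicity of \<open>\<wp>\<close> makes the zeta function change by a constant
  \<open>a\<close> under the period. Then the quotient of the two sides without \<open>C\<close> has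
  vanishing logarithmic derivative. In \<open>sigma_wp\<close> both constants cancel, so their
  values are left open.\<close>

lemma sigma_quasi_periodic:
  assumes w: "\<omega> \<in> L"
  obtains a C where "C \<noteq> 0" "\<And>z. \<sigma> (z + \<omega>) = C * exp (a * z) * \<sigma> z"
proof -
  have "((\<lambda>z. zeta (z + \<omega>) - zeta z) has_field_derivative 0) (at z)" if z: "z \<notin> L" for z
  proof -
    have "(zeta has_field_derivative - \<wp> (z + \<omega>)) (at (z + \<omega>))"
      using z w by (intro local_derivs) (simp add: L_add_iff)
    then have "((\<lambda>z. zeta (z + \<omega>)) has_field_derivative - \<wp> (z + \<omega>)) (at z)"
      by (simp only: DERIV_shift)
    then have "((\<lambda>z. zeta (z + \<omega>) - zeta z) has_field_derivative - \<wp> (z + \<omega>) - (- \<wp> z)) (at z)"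
      by (intro DERIV_diff local_derivs z)
    then show ?thesis using wp_periodic[OF w z] by simp
  qed
  then have "\<exists>a. \<forall>z. z \<notin> L \<longrightarrow> zeta (z + \<omega>) - zeta z = a"
    by (rule L_compl_constant)
  then obtain a where a: "\<And>z. z \<notin> L \<Longrightarrow> zeta (z + \<omega>) - zeta z = a"
    by blast
  have "((\<lambda>z. \<sigma> (z + \<omega>) * exp (- a * z) / \<sigma> z) has_field_derivative 0) (at z)" if z: "z \<notin> L" for z
  proof -
    have "(\<sigma> has_field_derivative \<sigma> (z + \<omega>) * zeta (z + \<omega>)) (at (z + \<omega>))"
      using z w by (intro sigma_deriv) (simp add: L_add_iff)
    then have d1: "((\<lambda>z. \<sigma> (z + \<omega>)) has_field_derivative \<sigma> (z + \<omega>) * zeta (z + \<omega>)) (at z)"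
      by (simp only: DERIV_shift)
    have d2: "((\<lambda>z. exp (- a * z)) has_field_derivative exp (- a * z) * (- a)) (at z)"
      by (auto intro!: derivative_eq_intros)
    have nz: "\<sigma> z \<noteq> 0" using z by (simp add: sigma_eq_0_iff)
    have "((\<lambda>z. \<sigma> (z + \<omega>) * exp (- a * z) / \<sigma> z) has_field_derivative
       ((\<sigma> (z + \<omega>) * zeta (z + \<omega>) * exp (- a * z) + exp (- a * z) * (- a) * \<sigma> (z + \<omega>)) * \<sigma> z
         - \<sigma> (z + \<omega>) * exp (- a * z) * (\<sigma> z * zeta z)) / (\<sigma> z * \<sigma> z)) (at z)"
      by (intro DERIV_divide DERIV_mult d1 d2 sigma_deriv z nz)
    moreover have "(s * Z * e + e * (- a) * s) * t - s * e * (t * Y) = s * e * t * (Z - Y - a)"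
      for s Z e t Y :: complex by algebra
    ultimately show ?thesis using a[OF z] by simp
  qed
  then have "\<exists>C. \<forall>z. z \<notin> L \<longrightarrow> \<sigma> (z + \<omega>) * exp (- a * z) / \<sigma> z = C"
    by (rule L_compl_constant)
  then obtain C where C: "\<And>z. z \<notin> L \<Longrightarrow> \<sigma> (z + \<omega>) * exp (- a * z) / \<sigma> z = C"
    by blast
  obtain y where y: "y \<notin> L" using ex_not_in_L by blast
  have "C \<noteq> 0"
    using C[OF y] y w by (auto simp: sigma_eq_0_iff L_add_iff)
  moreover have "\<sigma> (z + \<omega>) = C * exp (a * z) * \<sigma> z" for z
  proof (cases "z \<in> L")
    case True
    then have "\<sigma> z = 0" "\<sigma> (z + \<omega>) = 0"
      using w by (simp_all add: sigma_eq_0_iff L_add_iff)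
    then show ?thesis by simp
  next
    case False
    then have e: "\<sigma> (z + \<omega>) * exp (- a * z) = C * \<sigma> z"
      using C[OF False] by (auto simp: sigma_eq_0_iff field_simps)
    have "\<sigma> (z + \<omega>) = \<sigma> (z + \<omega>) * exp (- a * z) * exp (a * z)"
      by (simp add: mult.assoc flip: exp_add)
    also have "\<dots> = C * exp (a * z) * \<sigma> z"
      unfolding e by (simp only: mult_ac)
    finally show ?thesis .
  qed
  ultimately show ?thesis using that by blast
qed

lemma fundamental_domain:
  obtains \<omega> where "\<omega> \<in> L" "norm (z - \<omega>) \<le> norm w1 + norm w2"
proof -
  have w1: "w1 \<noteq> 0" and im: "Im (w2 / w1) \<noteq> 0"
    using basis by (auto simp: is_lattice_basis_def)
  define t where "t = Im (z / w1) / Im (w2 / w1)"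
  define s where "s = Re (z / w1) - t * Re (w2 / w1)"
  have "z / w1 = of_real s + of_real t * (w2 / w1)"
  proof -
    define \<tau> where "\<tau> = w2 / w1"
    have "t * Im \<tau> = Im (z / w1)" using im by (simp add: t_def \<tau>_def)
    moreover have "s + t * Re \<tau> = Re (z / w1)" by (simp add: s_def \<tau>_def)
    ultimately have "z / w1 = of_real s + of_real t * \<tau>" by (simp add: complex_eq_iff)
    then show ?thesis by (simp add: \<tau>_def)
  qed
  then have z: "z = of_real s * w1 + of_real t * w2"
    using w1 by (simp add: field_simps)
  define \<omega> where "\<omega> = of_int \<lfloor>s\<rfloor> * w1 + of_int \<lfloor>t\<rfloor> * w2"
  have "z - \<omega> = of_real (s - \<lfloor>s\<rfloor>) * w1 + of_real (t - \<lfloor>t\<rfloor>) * w2"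
    by (simp add: z \<omega>_def algebra_simps)
  also have "norm \<dots> \<le> norm (of_real (s - \<lfloor>s\<rfloor>) * w1) + norm (of_real (t - \<lfloor>t\<rfloor>) * w2)"
    by (rule norm_triangle_ineq)
  also have "\<dots> = \<bar>s - \<lfloor>s\<rfloor>\<bar> * norm w1 + \<bar>t - \<lfloor>t\<rfloor>\<bar> * norm w2"
    unfolding norm_mult norm_of_real by simp
  also have "\<dots> \<le> 1 * norm w1 + 1 * norm w2"
    by (intro add_mono mult_right_mono) (auto, linarith+)
  finally have "norm (z - \<omega>) \<le> norm w1 + norm w2" by simp
  moreover have "\<omega> \<in> L" by (auto simp: \<omega>_def lattice_def)
  ultimately show ?thesis using that by blast
qed

lemma eventually_not_L: "\<forall>\<^sub>F h in at a. h \<notin> L" if "a \<in> L"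
proof -
  obtain R where R: "R > 0" "ball 0 R \<inter> L = {0}"
    by (rule small_radius)
  have "\<forall>\<^sub>F h in at a. h \<in> ball a R - {a}"
    using R by (intro eventually_at_in_open) auto
  then show ?thesis
  proof eventually_elim
    case (elim h)
    have "h - a \<in> ball 0 R" using elim by (simp add: dist_norm norm_minus_commute)
    moreover have "h - a \<noteq> 0" using elim by simp
    ultimately have "h - a \<notin> L" using R by blast
    with \<open>a \<in> L\<close> show ?case using L_diff by blast
  qed
qed

text \<open>Periodicity carries the limit at 0 to every lattice point, so all singularities are
  removable. Boundedness on one disc containing a period parallelogram is boundedness everywhere,
  Liouville's theorem applies, and the limit identifies the constant.\<close>

lemma elliptic_constant:
  assumes hol: "F holomorphic_on - L"
    and per: "\<And>z \<omega>. z \<notin> L \<Longrightarrow> \<omega> \<in> L \<Longrightarrow> F (z + \<omega>) = F z"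
    and lim: "(F \<longlongrightarrow> c) (at 0)" and z: "z \<notin> L"
  shows "F z = c"
proof -
  define G where "G = (\<lambda>z. if z \<in> L then c else F z)"
  have contL: "isCont G a" if a: "a \<in> L" for a
  proof -
    have "\<forall>\<^sub>F h in at 0. F h = G (a + h)"
      using eventually_not_L[OF L_0]
    proof eventually_elim
      case (elim h)
      then show ?case
        using per[OF elim a] L_add_iff[OF a, of h] by (simp add: G_def add.commute)
    qed
    then have "((\<lambda>h. G (a + h)) \<longlongrightarrow> c) (at 0)"
      using lim by (rule Lim_transform_eventually[rotated])
    then have "(G \<longlongrightarrow> c) (at a)"
      by (subst LIM_offset_zero_iff) auto
    then show ?thesis using a by (simp add: isCont_def G_def)
  qed
  have holG: "G holomorphic_on - L"
    using hol by (rule holomorphic_transform) (simp add: G_def)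
  have contG: "isCont G y" for y
  proof (cases "y \<in> L")
    case False
    then have "G field_differentiable at y"
      using holG open_compl_L holomorphic_on_imp_differentiable_at by blast
    then show ?thesis by (rule field_differentiable_imp_continuous_at)
  qed (rule contL)
  obtain R where R: "R > 0" "ball 0 R \<inter> L = {0}"
    by (rule small_radius)
  have "G field_differentiable at y" for y
  proof (cases "y \<in> L")
    case True
    have "ball y R - {y} \<subseteq> - L"
    proof safe
      fix x assume x: "x \<in> ball y R" "x \<in> L" "x \<noteq> y"
      then have "x - y \<in> ball 0 R \<inter> L"
        using True L_diff by (simp add: dist_norm norm_minus_commute)
      with R x show False by auto
    qed
    then have h: "G holomorphic_on ball y R - {y}"
      by (rule holomorphic_on_subset[OF holG])
    have "continuous_on (ball y R) G"
      using contG by (intro continuous_at_imp_continuous_on) auto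
    then have "G holomorphic_on ball y R"
      using h by (rule no_isolated_singularity) auto
    then show ?thesis
      using R holomorphic_on_imp_differentiable_at[of G "ball y R" y] by simp
  next
    case False
    then show ?thesis
      using holG open_compl_L holomorphic_on_imp_differentiable_at by blast
  qed
  then have "G holomorphic_on UNIV"
    by (simp add: holomorphic_on_def)
  moreover have "bounded (range G)"
  proof -
    have "compact (G ` cball 0 (norm w1 + norm w2))"
      using contG by (intro compact_continuous_image continuous_at_imp_continuous_on) auto
    moreover have "range G \<subseteq> G ` cball 0 (norm w1 + norm w2)"
    proof safe
      fix y
      obtain \<omega> where w: "\<omega> \<in> L" "norm (y - \<omega>) \<le> norm w1 + norm w2"
        by (rule fundamental_domain)
      have "G y = G (y - \<omega>)"
        using per[of "y - \<omega>" \<omega>] w L_add_iff[OF w(1), of "y - \<omega>"] by (auto simp: G_def)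
      with w show "G y \<in> G ` cball 0 (norm w1 + norm w2)"
        by (intro image_eqI[of _ _ "y - \<omega>"]) auto
    qed
    ultimately show ?thesis
      using bounded_subset compact_imp_bounded by blast
  qed
  ultimately have "G constant_on UNIV" by (rule Liouville_theorem)
  then have "G z = G 0" by (auto simp: constant_on_def)
  with z show ?thesis by (simp add: G_def)
qed

end

section \<open>The differential equation and the product formula for sigma\<close>

context period_lattice
begin

definition wp_reg :: "complex \<Rightarrow> complex" where
  "wp_reg z = - (\<Sum>\<^sub>\<infinity>w\<in>L-{0}. 1 / w ^ 2 - 1 / (z - w) ^ 2)"
definition wp_reg' :: "complex \<Rightarrow> complex" where
  "wp_reg' z = - (\<Sum>\<^sub>\<infinity>w\<in>L-{0}. 2 / (z - w) ^ 3)"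
definition wp_reg'' :: "complex \<Rightarrow> complex" where
  "wp_reg'' z = - (\<Sum>\<^sub>\<infinity>w\<in>L-{0}. - 6 / (z - w) ^ 4)"
text \<open>A logarithm of \<open>\<sigma> z / z\<close> on a disc around the origin containing no
  other lattice point.\<close>

definition slog :: "complex \<Rightarrow> complex" where
  "slog z = (\<Sum>\<^sub>\<infinity>w\<in>L-{0}. sigma_log w z)"

lemma wp_reg_eq: "\<wp> z = 1 / z ^ 2 + wp_reg z"
  by (simp add: wp_alt wp_reg_def)

lemma wp''_reg_eq: "wp'' z = 6 / z ^ 4 + wp_reg'' z"
  by (simp add: wp''_def wp_reg''_def)

lemma wp_reg_even: "wp_reg (- z) = wp_reg z"
  using wp_even[of z] by (simp add: wp_reg_eq)

lemma wp_reg_0 [simp]: "wp_reg 0 = 0"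
  by (simp add: wp_reg_def)

lemma slog_0 [simp]: "slog 0 = 0"
  by (simp add: slog_def sigma_log_def)

lemma wp_reg''_0: "wp_reg'' 0 = g2 L / 10"
proof -
  have "wp_reg'' 0 = - (\<Sum>\<^sub>\<infinity>w\<in>L-{0}. - 6 * (1 / w ^ 4))"
    by (simp add: wp_reg''_def)
  also have "\<dots> = 6 * (\<Sum>\<^sub>\<infinity>w\<in>L-{0}. 1 / w ^ 4)"
    by (subst infsum_cmult_right') simp
  finally show ?thesis by (simp add: g2_def)
qed

lemma origin_derivs:
  assumes far: "far R = L - {0}" and z: "z \<in> ball 0 R"
  shows "(wp_reg has_field_derivative wp_reg' z) (at z)" "(wp_reg' has_field_derivative wp_reg'' z) (at z)"
    "(slog has_field_derivative (\<Sum>\<^sub>\<infinity>w\<in>L-{0}. zeta_term w z)) (at z)"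
  unfolding wp_reg_def[abs_def] wp_reg'_def[abs_def] wp_reg''_def slog_def[abs_def]
  using tail_derivs[OF z] by (auto intro!: DERIV_minus simp: far)

lemma wp_reg_holomorphic:
  assumes far: "far R = L - {0}"
  shows "wp_reg holomorphic_on ball 0 R" "wp_reg' holomorphic_on ball 0 R"  "slog holomorphic_on ball 0 R"
proof -
  show "wp_reg holomorphic_on ball 0 R"
    using origin_derivs(1)[OF far] by (subst holomorphic_on_open) blast+
  show "wp_reg' holomorphic_on ball 0 R"
    using origin_derivs(2)[OF far] by (subst holomorphic_on_open) blast+
  show "slog holomorphic_on ball 0 R"
    using origin_derivs(3)[OF far] by (subst holomorphic_on_open) blast+
qed

lemma wp_holomorphic: "\<wp> holomorphic_on - L" "wp' holomorphic_on - L" "wp'' holomorphic_on - L"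
proof -
  show "\<wp> holomorphic_on - L"
    using local_derivs(2) by (subst holomorphic_on_open[OF open_compl_L]) blast
  show h: "wp' holomorphic_on - L"
    using local_derivs(3) by (subst holomorphic_on_open[OF open_compl_L]) blast
  have "deriv wp' holomorphic_on - L"
    using h open_compl_L by (rule holomorphic_deriv)
  then show "wp'' holomorphic_on - L"
    by (rule holomorphic_transform) (use local_derivs(3) in \<open>auto intro: DERIV_imp_deriv\<close>)
qed

lemma wp''_periodic:
  assumes w: "\<omega> \<in> L" and z: "z \<notin> L"
  shows "wp'' (z + \<omega>) = wp'' z"
proof -
  have "(wp' has_field_derivative wp'' (z + \<omega>)) (at (z + \<omega>))"
    using z w by (intro local_derivs) (simp add: L_add_iff)
  then have "((\<lambda>z. wp' (z + \<omega>)) has_field_derivative wp'' (z + \<omega>)) (at z)"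
    by (simp only: DERIV_shift)
  then have "(wp' has_field_derivative wp'' (z + \<omega>)) (at z)"
    by (simp only: wp'_periodic[OF w])
  with local_derivs(3)[OF z] show ?thesis by (rule DERIV_unique[symmetric])
qed

text \<open>Write \<open>\<wp> z\<close> as 1/z^2 + z^2 k(z) near 0. Then the poles of
  \<open>wp'' z\<close> and \<open>6 * \<wp> z ^ 2\<close> agree, and their difference is elliptic
  with the value \<open>wp_reg'' 0 - 12 * k 0\<close> at 0. As \<open>wp_reg'' 0\<close> is both
  \<open>2 * k 0\<close> and \<open>g2 L / 10\<close>, this value is
  \<open>- g2 L / 2\<close>.\<close>

lemma wp''_eq:
  assumes z: "z \<notin> L"
  shows "wp'' z = 6 * \<wp> z ^ 2 - g2 L / 2"
proof -
  obtain R where R: "R > 0" "far R = L - {0}" "ball 0 R \<inter> L = {0}"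
    by (rule small_radius)
  have op0: "0 \<in> ball (0::complex) R" using R by simp
  obtain k where k: "k holomorphic_on ball 0 R" "\<And>z. z \<in> ball 0 R \<Longrightarrow> wp_reg z = z\<^sup>2 * k z"
    using even_double_zero_factor[OF wp_reg_holomorphic(1)[OF R(2)] R(1) wp_reg_even wp_reg_0] by metis
  have dk: "(k has_field_derivative deriv k x) (at x)" if "x \<in> ball 0 R" for x
    using that k(1) by (intro holomorphic_derivI[of _ "ball 0 R"]) auto
  have hdk: "deriv k holomorphic_on ball 0 R"
    using k(1) by (intro holomorphic_deriv) auto
  have ddk: "(deriv k has_field_derivative deriv (deriv k) 0) (at 0)"
    using op0 hdk by (intro holomorphic_derivI[of _ "ball 0 R"]) auto
  have e1: "2 * x * k x + x\<^sup>2 * deriv k x = wp_reg' x" if x: "x \<in> ball 0 R" for x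
  proof -
    have "((\<lambda>x. x\<^sup>2 * k x) has_field_derivative 2 * x * k x + x\<^sup>2 * deriv k x) (at x)"
      by (rule derivative_eq_intros refl dk x | simp)+
    then have "(wp_reg has_field_derivative 2 * x * k x + x\<^sup>2 * deriv k x) (at x)"
      by (rule has_field_derivative_transform_within_open[OF _ open_ball x]) (use k in auto)
    then show ?thesis using origin_derivs(1)[OF R(2) x] by (rule DERIV_unique)
  qed
  have "((\<lambda>x. 2 * x * k x + x\<^sup>2 * deriv k x) has_field_derivative 2 * k 0) (at 0)"
    by (rule derivative_eq_intros refl dk[OF op0] ddk | simp)+
  then have "(wp_reg' has_field_derivative 2 * k 0) (at 0)"
    by (rule has_field_derivative_transform_within_open[OF _ open_ball op0]) (use e1 in auto)
  then have k0: "wp_reg'' 0 = 2 * k 0"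
    using origin_derivs(2)[OF R(2) op0] by (rule DERIV_unique[symmetric])
  have hphi'': "wp_reg'' holomorphic_on ball 0 R"
  proof -
    have "deriv wp_reg' holomorphic_on ball 0 R"
      using wp_reg_holomorphic(2)[OF R(2)] by (intro holomorphic_deriv) auto
    then show ?thesis
      by (rule holomorphic_transform) (use origin_derivs(2)[OF R(2)] in \<open>auto intro: DERIV_imp_deriv\<close>)
  qed
  have hol: "(\<lambda>z. wp_reg'' z - 12 * k z - 6 * wp_reg z ^ 2) holomorphic_on ball 0 R"
    by (intro holomorphic_intros hphi'' k wp_reg_holomorphic(1)[OF R(2)])
  have "isCont (\<lambda>z. wp_reg'' z - 12 * k z - 6 * wp_reg z ^ 2) 0"
    using hol op0 by (metis R(1) analytic_at_ball analytic_at_imp_isCont)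
  then have "((\<lambda>z. wp_reg'' z - 12 * k z - 6 * wp_reg z ^ 2) \<longlongrightarrow> wp_reg'' 0 - 12 * k 0) (at 0)"
    by (simp add: isCont_def)
  moreover have "\<forall>\<^sub>F x in at 0. wp_reg'' x - 12 * k x - 6 * wp_reg x ^ 2 = wp'' x - 6 * \<wp> x ^ 2"
  proof -
    have "\<forall>\<^sub>F x in at 0. x \<in> ball 0 R - {0}"
      using op0 by (intro eventually_at_in_open) auto
    then show ?thesis
    proof eventually_elim
      case (elim x)
      have "wp_reg x = x\<^sup>2 * k x" using elim k by auto
      then have "6 * \<wp> x ^ 2 = 6 / x ^ 4 + 12 * k x + 6 * wp_reg x ^ 2"
        using elim by (simp add: wp_reg_eq divide_simps) (simp add: algebra_simps power2_eq_square power4_eq_xxxx)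
      then show ?case by (simp add: wp''_reg_eq)
    qed
  qed
  ultimately have lim: "((\<lambda>x. wp'' x - 6 * \<wp> x ^ 2) \<longlongrightarrow> wp_reg'' 0 - 12 * k 0) (at 0)"
    by (rule Lim_transform_eventually)
  have "wp'' z - 6 * \<wp> z ^ 2 = wp_reg'' 0 - 12 * k 0"
    by (rule elliptic_constant[OF _ _ lim z])
       (auto intro!: holomorphic_intros wp_holomorphic simp: wp_periodic wp''_periodic)
  then have "wp'' z = wp_reg'' 0 - 12 * k 0 + 6 * \<wp> z ^ 2"
    by (simp add: diff_eq_eq)
  with k0 wp_reg''_0 show ?thesis by simp
qed

text \<open>A first integral of \<open>wp''_eq\<close>. The constant of integration stays open here
  and is later evaluated at a point of the curve.\<close>

lemma wp_ode: "\<exists>C. \<forall>z. z \<notin> L \<longrightarrow> wp' z ^ 2 = 4 * \<wp> z ^ 3 - g2 L * \<wp> z - C"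
proof -
  have "((\<lambda>z. 4 * \<wp> z ^ 3 - g2 L * \<wp> z - wp' z ^ 2) has_field_derivative 0) (at z)" if z: "z \<notin> L" for z
  proof -
    have "((\<lambda>z. 4 * \<wp> z ^ 3 - g2 L * \<wp> z - wp' z ^ 2) has_field_derivative
      4 * (3 * \<wp> z ^ 2 * wp' z) - g2 L * wp' z - 2 * wp' z * wp'' z) (at z)"
      by (rule derivative_eq_intros refl local_derivs z | simp)+
    also have "4 * (3 * \<wp> z ^ 2 * wp' z) - g2 L * wp' z - 2 * wp' z * wp'' z = 0"
      unfolding wp''_eq[OF z] by (simp add: algebra_simps)
    finally show ?thesis .
  qed
  then have "\<exists>C. \<forall>z. z \<notin> L \<longrightarrow> 4 * \<wp> z ^ 3 - g2 L * \<wp> z - wp' z ^ 2 = C"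
    by (rule L_compl_constant)
  then obtain C where C: "\<And>z. z \<notin> L \<Longrightarrow> 4 * \<wp> z ^ 3 - g2 L * \<wp> z - wp' z ^ 2 = C"
    by blast
  show ?thesis
  proof (intro exI allI impI)
    fix z assume "z \<notin> L"
    then show "wp' z ^ 2 = 4 * \<wp> z ^ 3 - g2 L * \<wp> z - C"
      using C[symmetric] by simp
  qed
qed

lemma sigma_near_origin:
  assumes "near R = {}" "far R = L - {0}" "z \<in> ball 0 R"
  shows "\<sigma> z = z * exp (slog z)"
  using sigma_near_far[OF assms(3)] assms by (simp add: slog_def)

text \<open>As a function of \<open>z\<close>, the quotient of the left side by
  \<open>\<sigma> z ^ 2\<close> plus \<open>\<sigma> w ^ 2 * \<wp> z\<close> is elliptic and its
  double pole at the origin cancels, so it is constant. At \<open>z = w\<close> the factor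
  \<open>\<sigma> 0 = 0\<close> removes the quotient, which evaluates the constant.\<close>

lemma sigma_wp:
  assumes z: "z \<notin> L" and w: "w \<notin> L"
  shows "\<sigma> (z + w) * \<sigma> (z - w) = - (\<sigma> z ^ 2 * \<sigma> w ^ 2 * (\<wp> z - \<wp> w))"
proof -
  obtain R where R: "R > 0" "near R = {}" "far R = L - {0}" "ball 0 R \<inter> L = {0}"
    by (rule small_radius)
  have op0: "0 \<in> ball (0::complex) R" using R by simp
  define F where "F = (\<lambda>z. \<sigma> (z + w) * \<sigma> (z - w) / \<sigma> z ^ 2 + \<sigma> w ^ 2 * \<wp> z)"
  \<comment> \<open>\<open>G\<close> is z^2 times \<open>F\<close>, written so that it is
    holomorphic at the origin. It is even, and oddness of \<open>\<sigma>\<close> gives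
    \<open>G 0 = 0\<close>; hence it has a double zero and \<open>F\<close> a limit.\<close>
  define G where "G = (\<lambda>z. \<sigma> (z + w) * \<sigma> (z - w) / exp (slog z) ^ 2 + \<sigma> w ^ 2 + \<sigma> w ^ 2 * (z ^ 2 * wp_reg z))"
  have hs: "(\<lambda>z. \<sigma> (z + w)) holomorphic_on A" "(\<lambda>z. \<sigma> (z - w)) holomorphic_on A" for A
  proof -
    have "\<sigma> \<circ> (\<lambda>z. z + w) holomorphic_on A" "\<sigma> \<circ> (\<lambda>z. z - w) holomorphic_on A"
      by (intro holomorphic_on_compose sigma_holomorphic holomorphic_intros)+
    then show "(\<lambda>z. \<sigma> (z + w)) holomorphic_on A" "(\<lambda>z. \<sigma> (z - w)) holomorphic_on A"
      by (simp_all add: o_def)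
  qed
  have holG: "G holomorphic_on ball 0 R"
    unfolding G_def by (intro holomorphic_intros hs wp_reg_holomorphic R) auto
  have slog_even: "exp (slog (- x)) = exp (slog x)" if "x \<in> ball 0 R" for x
  proof (cases "x = 0")
    case False
    have "\<sigma> (- x) = - x * exp (slog (- x))" "\<sigma> x = x * exp (slog x)"
      by (rule sigma_near_origin[OF R(2,3)]; use that in simp)+
    then show ?thesis using sigma_odd[of x] False by simp
  qed auto
  have evG: "G (- x) = G x" if "x \<in> ball 0 R" for x
  proof -
    have "\<sigma> (- x + w) = - \<sigma> (x - w)" "\<sigma> (- x - w) = - \<sigma> (x + w)"
    proof -
      have "- x + w = - (x - w)" "- x - w = - (x + w)" by simp_all
      then show "\<sigma> (- x + w) = - \<sigma> (x - w)" "\<sigma> (- x - w) = - \<sigma> (x + w)"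
        by (simp_all only: sigma_odd)
    qed
    then show ?thesis
      unfolding G_def using slog_even[OF that] by (simp add: wp_reg_even mult.commute)
  qed
  have G0: "G 0 = 0"
    using sigma_odd[of w] by (simp add: G_def power2_eq_square)
  obtain k where k: "k holomorphic_on ball 0 R" "\<And>z. z \<in> ball 0 R \<Longrightarrow> G z = z\<^sup>2 * k z"
    using even_double_zero_factor[OF holG R(1) evG G0] by metis
  have "isCont k 0"
    using k(1) op0 by (metis R(1) analytic_at_ball analytic_at_imp_isCont)
  then have "(k \<longlongrightarrow> k 0) (at 0)" by (simp add: isCont_def)
  moreover have "\<forall>\<^sub>F x in at 0. k x = F x"
  proof -
    have "\<forall>\<^sub>F x in at 0. x \<in> ball 0 R - {0}"
      using op0 by (intro eventually_at_in_open) auto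
    then show ?thesis
    proof eventually_elim
      case (elim x)
      have "\<sigma> x = x * exp (slog x)"
        using elim R by (intro sigma_near_origin) auto
      then have "F x = G x / x\<^sup>2"
      proof -
        have gen: "N / (y * e) ^ 2 + s * (1 / y ^ 2 + p) = (N / e ^ 2 + s + s * (y ^ 2 * p)) / y ^ 2"
          if "y \<noteq> 0" "e \<noteq> 0" for N y e s p :: complex
          using that by (simp add: field_simps power2_eq_square)
        show ?thesis
          unfolding F_def G_def wp_reg_eq \<open>\<sigma> x = x * exp (slog x)\<close> using elim by (intro gen) auto
      qed
      then show ?case using k(2)[of x] elim by simp
    qed
  qed
  ultimately have lim: "(F \<longlongrightarrow> k 0) (at 0)"
    by (rule Lim_transform_eventually)
  have holF: "F holomorphic_on - L"
    unfolding F_def by (intro holomorphic_intros hs sigma_holomorphic wp_holomorphic) (auto simp: sigma_eq_0_iff)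
  have perF: "F (x + \<omega>) = F x" if x: "x \<notin> L" and om: "\<omega> \<in> L" for x \<omega>
  proof -
    obtain a C where C: "C \<noteq> 0" "\<And>z. \<sigma> (z + \<omega>) = C * exp (a * z) * \<sigma> z"
      using sigma_quasi_periodic[OF om] by metis
    \<comment> \<open>The shifts by \<open>w\<close> cancel in the exponents, so numerator and
      denominator of \<open>F\<close> pick up the same factor.\<close>
    have e: "exp (a * (x + w)) * exp (a * (x - w)) = exp (a * x) ^ 2"
      by (simp add: power2_eq_square algebra_simps flip: exp_add)
    have "\<sigma> (x + \<omega> + w) * \<sigma> (x + \<omega> - w) = \<sigma> ((x + w) + \<omega>) * \<sigma> ((x - w) + \<omega>)"
      by (simp add: algebra_simps)
    also have "\<dots> = C ^ 2 * (exp (a * (x + w)) * exp (a * (x - w))) * (\<sigma> (x + w) * \<sigma> (x - w))"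
      unfolding C(2) by (simp add: power2_eq_square mult_ac)
    also have "\<dots> = (C * exp (a * x)) ^ 2 * (\<sigma> (x + w) * \<sigma> (x - w))"
      unfolding e by (simp add: power_mult_distrib)
    finally have n: "\<sigma> (x + \<omega> + w) * \<sigma> (x + \<omega> - w) = (C * exp (a * x)) ^ 2 * (\<sigma> (x + w) * \<sigma> (x - w))" .
    have "(C * exp (a * x)) ^ 2 \<noteq> 0" using C(1) by simp
    then show ?thesis
      unfolding F_def n wp_periodic[OF om x] C(2)[of x] power_mult_distrib[of _ "\<sigma> x"] by simp
  qed
  have "F z = k 0" by (rule elliptic_constant[OF holF perF lim z])
  also have "k 0 = F w" by (rule elliptic_constant[OF holF perF lim w, symmetric])
  also have "F w = \<sigma> w ^ 2 * \<wp> w"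
    using sigma_eq_0_iff[of 0] by (simp add: F_def)
  finally have "\<sigma> (z + w) * \<sigma> (z - w) / \<sigma> z ^ 2 = - (\<sigma> w ^ 2 * (\<wp> z - \<wp> w))"
    unfolding F_def by (simp add: right_diff_distrib eq_diff_eq)
  then show ?thesis
    using z by (simp add: sigma_eq_0_iff divide_eq_eq mult_ac)
qed

end

section \<open>Addition theorems and the three-term relation\<close>

context period_lattice
begin

lemma open_L_shift: "open ((\<lambda>z. z + c) -` (- L))" "open ((\<lambda>z. z - c) -` (- L))" "open ((\<lambda>z. c + z) -` (- L))"
  by (intro open_vimage open_compl_L continuous_intros)+

lemma isCont_sigma: "isCont \<sigma> z"
  using sigma_holomorphic[of UNIV] by (simp add: holomorphic_on_imp_differentiable_at field_differentiable_imp_continuous_at)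

lemma sigma_over_id_tendsto: "((\<lambda>h. \<sigma> h / h) \<longlongrightarrow> 1) (at 0)"
proof -
  obtain R where R: "R > 0" "near R = {}" "far R = L - {0}" "ball 0 R \<inter> L = {0}"
    by (rule small_radius)
  have "isCont slog 0"
    using wp_reg_holomorphic(3)[OF R(3)] R(1) by (metis analytic_at_ball analytic_at_imp_isCont)
  then have "((\<lambda>h. exp (slog h)) \<longlongrightarrow> exp (slog 0)) (at 0)"
    by (intro tendsto_intros) (simp add: isCont_def)
  moreover have "\<forall>\<^sub>F x in at 0. exp (slog x) = \<sigma> x / x"
  proof -
    have "\<forall>\<^sub>F x in at 0. x \<in> ball 0 R - {0}"
      using R by (intro eventually_at_in_open) auto
    then show ?thesis
      by eventually_elim (use sigma_near_origin[OF R(2,3)] in auto)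
  qed
  ultimately show ?thesis
    by (simp add: Lim_transform_eventually)
qed

lemma eventually_at_L_compl:
  fixes z :: complex
  assumes "z \<notin> L"
  shows "\<forall>\<^sub>F w in at z. w \<notin> L \<and> w - z \<notin> L"
proof -
  have 1: "\<forall>\<^sub>F w in at z. w \<in> - L - {z}"
    using assms open_compl_L by (intro eventually_at_in_open) auto
  have "\<forall>\<^sub>F h in at 0. h + z - z \<notin> L"
    using eventually_not_L[OF L_0] by simp
  then have 2: "\<forall>\<^sub>F w in at z. w - z \<notin> L"
    by (subst at_to_0) (simp add: eventually_filtermap)
  from 1 2 show ?thesis by eventually_elim auto
qed

text \<open>Divide \<open>sigma_wp\<close> by \<open>w - z\<close> and let \<open>w\<close> tend to
  \<open>z\<close>: the factor \<open>\<sigma> (w - z)\<close> becomes 1 and the difference of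
  \<open>\<wp>\<close> becomes its derivative.\<close>

lemma sigma_double:
  assumes z: "z \<notin> L"
  shows "\<sigma> (2 * z) = - (wp' z * \<sigma> z ^ 4)"
proof -
  have "((\<lambda>w. \<sigma> (w + z) * (\<sigma> (w - z) / (w - z))) \<longlongrightarrow> \<sigma> (z + z) * 1) (at z)"
  proof (rule tendsto_mult)
    have "isCont (\<lambda>w. \<sigma> (w + z)) z"
      by (rule isCont_o2[where g = \<sigma>]) (auto simp: isCont_sigma)
    then show "((\<lambda>w. \<sigma> (w + z)) \<longlongrightarrow> \<sigma> (z + z)) (at z)"
      by (simp add: isCont_def)
    show "((\<lambda>w. \<sigma> (w - z) / (w - z)) \<longlongrightarrow> 1) (at z)"
      using sigma_over_id_tendsto by (subst LIM_offset_zero_iff) auto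
  qed
  moreover have "((\<lambda>w. \<sigma> (w + z) * (\<sigma> (w - z) / (w - z))) \<longlongrightarrow> - (\<sigma> z ^ 2 * \<sigma> z ^ 2 * wp' z)) (at z)"
  proof (rule Lim_transform_eventually)
    have "((\<lambda>w. (\<wp> w - \<wp> z) / (w - z)) \<longlongrightarrow> wp' z) (at z)"
      using local_derivs(2)[OF z] by (simp add: has_field_derivative_iff)
    then show "((\<lambda>w. - (\<sigma> w ^ 2 * \<sigma> z ^ 2 * ((\<wp> w - \<wp> z) / (w - z)))) \<longlongrightarrow> - (\<sigma> z ^ 2 * \<sigma> z ^ 2 * wp' z)) (at z)"
      using isCont_sigma[of z] by (intro tendsto_intros) (auto simp: isCont_def)
    show "\<forall>\<^sub>F w in at z. - (\<sigma> w ^ 2 * \<sigma> z ^ 2 * ((\<wp> w - \<wp> z) / (w - z))) = \<sigma> (w + z) * (\<sigma> (w - z) / (w - z))"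
      using eventually_at_L_compl[OF z]
    proof eventually_elim
      case (elim w)
      then show ?case
        unfolding times_divide_eq_right using sigma_wp[of w z] z by simp
    qed
  qed
  ultimately have "\<sigma> (z + z) * 1 = - (\<sigma> z ^ 2 * \<sigma> z ^ 2 * wp' z)"
    by (rule tendsto_unique[rotated]) auto
  then show ?thesis
    unfolding mult_2 by (simp add: power2_eq_square power4_eq_xxxx mult_ac)
qed

text \<open>The zeros of the left side of \<open>sigma_wp\<close> are known, so no count of the
  zeros and poles of an elliptic function of order two is involved.\<close>

lemma wp_eq_iff:
  assumes "z \<notin> L" "w \<notin> L"
  shows "\<wp> z = \<wp> w \<longleftrightarrow> z + w \<in> L \<or> z - w \<in> L"
  using sigma_wp[OF assms] assms by (auto simp flip: sigma_eq_0_iff)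

lemma wp'_odd: 
  assumes "z \<notin> L" shows "wp' (- z) = - wp' z"
proof -
  have "((\<lambda>z. \<wp> (- z)) has_field_derivative wp' (- z) * (- 1)) (at z)"
    using assms by (intro DERIV_chain2[of \<wp>] local_derivs) (auto intro!: derivative_eq_intros)
  then have "(\<wp> has_field_derivative - wp' (- z)) (at z)"
    by (simp add: wp_even)
  from DERIV_unique[OF this local_derivs(2)[OF assms]] show ?thesis by (metis minus_minus)
qed

text \<open>The logarithmic derivative of \<open>sigma_wp\<close> in \<open>z\<close>. Adding the
  formula with \<open>z\<close> and \<open>w\<close> exchanged eliminates
  \<open>zeta (z - w)\<close> and gives \<open>zeta_add\<close>.\<close>

lemma zeta_log_deriv:
  assumes "z \<notin> L" "w \<notin> L" "z + w \<notin> L" "z - w \<notin> L"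
  shows "zeta (z + w) + zeta (z - w) = 2 * zeta z + wp' z / (\<wp> z - \<wp> w)"
proof -
  have d1: "((\<lambda>z. \<sigma> (z + w)) has_field_derivative \<sigma> (z + w) * zeta (z + w)) (at z)"
    using sigma_deriv[OF assms(3)] by (simp only: DERIV_shift)
  have d2: "((\<lambda>z. \<sigma> (z - w)) has_field_derivative \<sigma> (z - w) * zeta (z - w)) (at z)"
    using sigma_deriv[OF assms(4)] DERIV_shift[of \<sigma> _ z "- w"] by simp
  have D1: "((\<lambda>z. \<sigma> (z + w) * \<sigma> (z - w)) has_field_derivative
      \<sigma> (z + w) * zeta (z + w) * \<sigma> (z - w) + \<sigma> (z - w) * zeta (z - w) * \<sigma> (z + w)) (at z)"
    by (intro DERIV_mult d1 d2)
  have "((\<lambda>z. - (\<sigma> z ^ 2 * \<sigma> w ^ 2 * (\<wp> z - \<wp> w))) has_field_derivative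
      - (2 * \<sigma> z * (\<sigma> z * zeta z) * \<sigma> w ^ 2 * (\<wp> z - \<wp> w) + \<sigma> z ^ 2 * \<sigma> w ^ 2 * wp' z)) (at z)"
    by (rule derivative_eq_intros refl sigma_deriv local_derivs assms | simp)+
  then have "((\<lambda>z. \<sigma> (z + w) * \<sigma> (z - w)) has_field_derivative
      - (2 * \<sigma> z * (\<sigma> z * zeta z) * \<sigma> w ^ 2 * (\<wp> z - \<wp> w) + \<sigma> z ^ 2 * \<sigma> w ^ 2 * wp' z)) (at z)"
    by (rule has_field_derivative_transform_within_open[OF _ open_compl_L])
       (use assms sigma_wp in auto)
  from DERIV_unique[OF D1 this]
  have eq: "\<sigma> (z + w) * \<sigma> (z - w) * (zeta (z + w) + zeta (z - w)) =
     - (\<sigma> z ^ 2 * \<sigma> w ^ 2 * (\<wp> z - \<wp> w)) * (2 * zeta z) - \<sigma> z ^ 2 * \<sigma> w ^ 2 * wp' z"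
    by (simp add: algebra_simps power2_eq_square)
  define K where "K = \<sigma> z ^ 2 * \<sigma> w ^ 2"
  have K: "K \<noteq> 0" using assms by (simp add: K_def sigma_eq_0_iff)
  have d: "\<wp> z - \<wp> w \<noteq> 0" using assms wp_eq_iff[of z w] by simp
  have "- (K * (\<wp> z - \<wp> w)) * (zeta (z + w) + zeta (z - w)) = - (K * (\<wp> z - \<wp> w)) * (2 * zeta z) - K * wp' z"
    using eq unfolding sigma_wp[OF assms(1,2)] K_def .
  then have "K * ((\<wp> z - \<wp> w) * (zeta (z + w) + zeta (z - w))) = K * ((\<wp> z - \<wp> w) * (2 * zeta z) + wp' z)"
    by (simp add: algebra_simps)
  then have "(\<wp> z - \<wp> w) * (zeta (z + w) + zeta (z - w)) = (\<wp> z - \<wp> w) * (2 * zeta z) + wp' z"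
    using K by simp
  then show ?thesis using d by (simp add: eq_divide_eq add_divide_eq_iff mult.commute)
qed

text \<open>Half the slope of the chord through the points with coordinates \<open>\<wp>\<close> and
  \<open>wp'\<close>. On \<open>E\<close> this is the slope of the chord plus a1/2, because
  \<open>wp'\<close> corresponds to 2y + a1 x + a3.\<close>

definition slope :: "complex \<Rightarrow> complex \<Rightarrow> complex" where
  "slope z w = (wp' z - wp' w) / (2 * (\<wp> z - \<wp> w))"

lemma zeta_add:
  assumes "z \<notin> L" "w \<notin> L" "z + w \<notin> L" "z - w \<notin> L"
  shows "zeta (z + w) = zeta z + zeta w + slope z w"
proof -
  have d: "\<wp> z - \<wp> w \<noteq> 0" using assms wp_eq_iff[of z w] by simp
  have 1: "zeta (z + w) + zeta (z - w) = 2 * zeta z + wp' z / (\<wp> z - \<wp> w)"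
    by (rule zeta_log_deriv[OF assms])
  have "zeta (w + z) + zeta (w - z) = 2 * zeta w + wp' w / (\<wp> w - \<wp> z)"
    using assms by (intro zeta_log_deriv) (auto simp: add.commute L_minus_commute)
  moreover have "zeta (w - z) = - zeta (z - w)" using zeta_odd[of "z - w"] by simp
  moreover have "wp' w / (\<wp> w - \<wp> z) = - (wp' w / (\<wp> z - \<wp> w))"
    by (metis minus_diff_eq minus_divide_right)
  ultimately have 2: "zeta (z + w) - zeta (z - w) = 2 * zeta w - wp' w / (\<wp> z - \<wp> w)"
    by (simp add: add.commute)
  have "2 * zeta (z + w) = (zeta (z + w) + zeta (z - w)) + (zeta (z + w) - zeta (z - w))" by simp
  also have "\<dots> = 2 * (zeta z + zeta w + slope z w)"
  proof -
    have "2 * p + u / D + (2 * q - v / D) = 2 * (p + q + (u - v) / (2 * D))" if "D \<noteq> 0" for p q u v D :: complex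
      using that by (simp add: field_simps)
    from this[OF d] show ?thesis unfolding 1 2 slope_def .
  qed
  finally show ?thesis by (simp only: mult_cancel_left) simp
qed

lemma slope_deriv:
  assumes "z \<notin> L" "w \<notin> L" "z + w \<notin> L" "z - w \<notin> L"
  shows "((\<lambda>z. slope z w) has_field_derivative \<wp> z - \<wp> (z + w)) (at z)"
proof -
  have op: "open (- L \<inter> (\<lambda>z. z + w) -` (- L) \<inter> (\<lambda>z. z - w) -` (- L))"
    by (intro open_Int open_compl_L open_L_shift)
  have "((\<lambda>z. zeta (z + w)) has_field_derivative - \<wp> (z + w)) (at z)"
    using local_derivs(1)[OF assms(3)] by (simp only: DERIV_shift)
  then have "((\<lambda>z. zeta (z + w) - zeta z - zeta w) has_field_derivative - \<wp> (z + w) - (- \<wp> z) - 0) (at z)"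
    by (intro DERIV_diff local_derivs assms DERIV_const)
  then have "((\<lambda>z. slope z w) has_field_derivative - \<wp> (z + w) - (- \<wp> z) - 0) (at z)"
    by (rule has_field_derivative_transform_within_open[OF _ op]) (use assms zeta_add in auto)
  then show ?thesis by simp
qed

text \<open>The derivative of the slope is computed twice, by the quotient rule and by
  \<open>slope_deriv\<close>, where the slope appears as a combination of zeta values. After
  \<open>wp''_eq\<close>, the discrepancy between the outcome and the claim is the difference of the
  differential equations at \<open>z\<close> and \<open>w\<close>, in which \<open>C\<close>
  cancels.\<close>

lemma wp_add:
  assumes ODE: "\<And>z. z \<notin> L \<Longrightarrow> wp' z ^ 2 = 4 * \<wp> z ^ 3 - g2 L * \<wp> z - C"
    and "z \<notin> L" "w \<notin> L" "z + w \<notin> L" "z - w \<notin> L"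
  shows "\<wp> (z + w) = slope z w ^ 2 - \<wp> z - \<wp> w"
proof -
  note z = assms(2-)
  have d: "\<wp> z - \<wp> w \<noteq> 0" using z wp_eq_iff[of z w] by simp
  have "((\<lambda>z. slope z w) has_field_derivative
     (wp'' z * (2 * (\<wp> z - \<wp> w)) - (wp' z - wp' w) * (2 * wp' z)) / (2 * (\<wp> z - \<wp> w)) ^ 2) (at z)"
    unfolding slope_def using d
    by (auto intro!: derivative_eq_intros local_derivs z simp: power2_eq_square)
  from DERIV_unique[OF this slope_deriv[OF z]]
  have "\<wp> (z + w) = \<wp> z - (wp'' z * (2 * (\<wp> z - \<wp> w)) - (wp' z - wp' w) * (2 * wp' z)) / (2 * (\<wp> z - \<wp> w)) ^ 2"
    by simp
  also have "\<dots> = slope z w ^ 2 - \<wp> z - \<wp> w"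
  proof -
    have gen: "X - ((6 * X ^ 2 - g / 2) * (2 * (X - Y)) - (U - V) * (2 * U)) / (2 * (X - Y)) ^ 2 =
       ((U - V) / (2 * (X - Y))) ^ 2 - X - Y"
      if ne: "X - Y \<noteq> 0" and U: "U ^ 2 = 4 * X ^ 3 - g * X - C" and V: "V ^ 2 = 4 * Y ^ 3 - g * Y - C"
      for X Y U V g :: complex
    proof -
      have "X * (2 * (X - Y)) ^ 2 - ((6 * X ^ 2 - g / 2) * (2 * (X - Y)) - (U - V) * (2 * U))
          - ((U - V) ^ 2 - (X + Y) * (2 * (X - Y)) ^ 2)
        = (U ^ 2 - (4 * X ^ 3 - g * X - C)) - (V ^ 2 - (4 * Y ^ 3 - g * Y - C))"
        by (simp add: power2_eq_square power3_eq_cube algebra_simps)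
      then have "X * (2 * (X - Y)) ^ 2 - ((6 * X ^ 2 - g / 2) * (2 * (X - Y)) - (U - V) * (2 * U))
          = (U - V) ^ 2 - (X + Y) * (2 * (X - Y)) ^ 2"
        using U V by simp
      moreover have "X - N / D ^ 2 = (T / D) ^ 2 - X - Y" if "X * D ^ 2 - N = T ^ 2 - (X + Y) * D ^ 2" "D \<noteq> 0"
        for N T D :: complex
        using that by (simp add: field_simps)
      ultimately show ?thesis using ne by simp
    qed
    show ?thesis
      unfolding slope_def wp''_eq[OF z(1)] by (rule gen[OF d ODE[OF z(1)] ODE[OF z(2)]])
  qed
  finally show ?thesis .
qed

lemma wp'_add:
  assumes ODE: "\<And>z. z \<notin> L \<Longrightarrow> wp' z ^ 2 = 4 * \<wp> z ^ 3 - g2 L * \<wp> z - C"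
    and "z \<notin> L" "w \<notin> L" "z + w \<notin> L" "z - w \<notin> L"
  shows "wp' (z + w) = 2 * slope z w * (\<wp> z - \<wp> (z + w)) - wp' z"
proof -
  note z = assms(2-)
  have op: "open (- L \<inter> (\<lambda>z. z + w) -` (- L) \<inter> (\<lambda>z. z - w) -` (- L))"
    by (intro open_Int open_compl_L open_L_shift)
  have 1: "((\<lambda>z. \<wp> (z + w)) has_field_derivative wp' (z + w)) (at z)"
    using local_derivs(2)[OF z(3)] by (simp only: DERIV_shift)
  have "((\<lambda>z. slope z w ^ 2 - \<wp> z - \<wp> w) has_field_derivative 2 * slope z w * (\<wp> z - \<wp> (z + w)) - wp' z) (at z)"
    by (rule derivative_eq_intros refl slope_deriv local_derivs z | simp)+
  then have "((\<lambda>z. \<wp> (z + w)) has_field_derivative 2 * slope z w * (\<wp> z - \<wp> (z + w)) - wp' z) (at z)"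
    by (rule has_field_derivative_transform_within_open[OF _ op]) (use z wp_add[OF ODE] in auto)
  from DERIV_unique[OF 1 this] show ?thesis .
qed

text \<open>The chord becomes the tangent: \<open>m\<close> is the limit of the slope as the second
  argument tends to the first. That the derivative does not vanish is read off from
  \<open>sigma_double\<close>, as \<open>\<sigma> (2 * z)\<close> is nonzero.\<close>

lemma wp_double:
  assumes ODE: "\<And>z. z \<notin> L \<Longrightarrow> wp' z ^ 2 = 4 * \<wp> z ^ 3 - g2 L * \<wp> z - C"
    and z: "z \<notin> L" "2 * z \<notin> L"
  defines "m \<equiv> wp'' z / (2 * wp' z)"
  shows "wp' z \<noteq> 0" "\<wp> (2 * z) = m ^ 2 - 2 * \<wp> z" "wp' (2 * z) = 2 * m * (\<wp> z - \<wp> (2 * z)) - wp' z"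
proof -
  show nz: "wp' z \<noteq> 0"
  proof
    assume "wp' z = 0"
    then have "\<sigma> (2 * z) = 0" using sigma_double[OF z(1)] by simp
    then show False using z(2) by (simp only: sigma_eq_0_iff)
  qed
  have zz: "z + z \<notin> L" using z(2) unfolding mult_2 .
  have wL: "\<forall>\<^sub>F w in at z. w \<notin> L \<and> w - z \<notin> L" by (rule eventually_at_L_compl[OF z(1)])
  have "\<forall>\<^sub>F w in at z. w \<in> (\<lambda>w. w + z) -` (- L) - {z}"
    using zz by (intro eventually_at_in_open open_L_shift) auto
  with wL have ev: "\<forall>\<^sub>F w in at z. w \<notin> L \<and> w - z \<notin> L \<and> w + z \<notin> L"
    by eventually_elim auto
  have l1: "((\<lambda>w. (wp' w - wp' z) / (w - z)) \<longlongrightarrow> wp'' z) (at z)"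
    using local_derivs(3)[OF z(1)] by (simp add: has_field_derivative_iff)
  have l2: "((\<lambda>w. (\<wp> w - \<wp> z) / (w - z)) \<longlongrightarrow> wp' z) (at z)"
    using local_derivs(2)[OF z(1)] by (simp add: has_field_derivative_iff)
  have "((\<lambda>w. ((wp' w - wp' z) / (w - z)) / (2 * ((\<wp> w - \<wp> z) / (w - z)))) \<longlongrightarrow> m) (at z)"
    unfolding m_def using nz by (intro tendsto_intros l1 l2) auto
  moreover have "\<forall>\<^sub>F w in at z. ((wp' w - wp' z) / (w - z)) / (2 * ((\<wp> w - \<wp> z) / (w - z))) = slope w z"
    using wL
  proof eventually_elim
    case (elim w)
    then have "w - z \<noteq> 0" by auto
    then show ?case by (simp add: slope_def)
  qed
  ultimately have m: "((\<lambda>w. slope w z) \<longlongrightarrow> m) (at z)"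
    by (rule Lim_transform_eventually)
  have c0: "((\<lambda>w. \<wp> w) \<longlongrightarrow> \<wp> z) (at z)" "((\<lambda>w. wp' w) \<longlongrightarrow> wp' z) (at z)"
    using DERIV_isCont[OF local_derivs(2)[OF z(1)]] DERIV_isCont[OF local_derivs(3)[OF z(1)]]
    by (simp_all add: isCont_def)
  have "isCont (\<lambda>w. \<wp> (w + z)) z"
    by (rule isCont_o2[where g = \<wp>]) (use DERIV_isCont[OF local_derivs(2)[OF zz]] in auto)
  then have c1: "((\<lambda>w. \<wp> (w + z)) \<longlongrightarrow> \<wp> (z + z)) (at z)" by (simp add: isCont_def)
  have "isCont (\<lambda>w. wp' (w + z)) z"
    by (rule isCont_o2[where g = wp']) (use DERIV_isCont[OF local_derivs(3)[OF zz]] in auto)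
  then have c2: "((\<lambda>w. wp' (w + z)) \<longlongrightarrow> wp' (z + z)) (at z)" by (simp add: isCont_def)
  have "((\<lambda>w. slope w z ^ 2 - \<wp> w - \<wp> z) \<longlongrightarrow> m ^ 2 - \<wp> z - \<wp> z) (at z)"
    by (intro tendsto_intros m c0)
  moreover have "\<forall>\<^sub>F w in at z. slope w z ^ 2 - \<wp> w - \<wp> z = \<wp> (w + z)"
    using ev by eventually_elim (use wp_add[OF ODE] z in auto)
  ultimately have "((\<lambda>w. \<wp> (w + z)) \<longlongrightarrow> m ^ 2 - \<wp> z - \<wp> z) (at z)"
    by (rule Lim_transform_eventually)
  with c1 have "\<wp> (z + z) = m ^ 2 - \<wp> z - \<wp> z"
    by (rule tendsto_unique[rotated]) simp
  then show "\<wp> (2 * z) = m ^ 2 - 2 * \<wp> z"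
    by (simp only: mult_2 diff_diff_eq)
  have "((\<lambda>w. 2 * slope w z * (\<wp> w - \<wp> (w + z)) - wp' w) \<longlongrightarrow> 2 * m * (\<wp> z - \<wp> (z + z)) - wp' z) (at z)"
    by (intro tendsto_intros m c0 c1)
  moreover have "\<forall>\<^sub>F w in at z. 2 * slope w z * (\<wp> w - \<wp> (w + z)) - wp' w = wp' (w + z)"
    using ev by eventually_elim (use wp'_add[OF ODE] z in auto)
  ultimately have "((\<lambda>w. wp' (w + z)) \<longlongrightarrow> 2 * m * (\<wp> z - \<wp> (z + z)) - wp' z) (at z)"
    by (rule Lim_transform_eventually)
  with c2 have "wp' (z + z) = 2 * m * (\<wp> z - \<wp> (z + z)) - wp' z"
    by (rule tendsto_unique[rotated]) simp
  then show "wp' (2 * z) = 2 * m * (\<wp> z - \<wp> (2 * z)) - wp' z"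
    by (simp only: mult_2[of z])
qed

text \<open>By \<open>sigma_wp\<close> each summand is the common factor of the squares of
  \<open>\<sigma>\<close> at the four arguments times a product of two differences of
  \<open>\<wp>\<close>. What remains is the identity (A-B)(C-D) + (B-C)(A-D) + (C-A)(B-D) =
  0.\<close>

lemma sigma_three_term:
  "\<sigma> (a + b) * \<sigma> (a - b) * \<sigma> (c + d) * \<sigma> (c - d)
   + \<sigma> (b + c) * \<sigma> (b - c) * \<sigma> (a + d) * \<sigma> (a - d)
   + \<sigma> (c + a) * \<sigma> (c - a) * \<sigma> (b + d) * \<sigma> (b - d) = 0" (is "?T a b c d = 0")
proof -
  have generic: "?T a b c d = 0" if "a \<notin> L" "b \<notin> L" "c \<notin> L" "d \<notin> L" for a b c d
  proof -
    note s = sigma_wp[OF that(1,2)] sigma_wp[OF that(3,4)] sigma_wp[OF that(2,3)] sigma_wp[OF that(1,4)]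
      sigma_wp[OF that(3,1)] sigma_wp[OF that(2,4)]
    have "?T a b c d = (\<sigma> (a + b) * \<sigma> (a - b)) * (\<sigma> (c + d) * \<sigma> (c - d))
       + (\<sigma> (b + c) * \<sigma> (b - c)) * (\<sigma> (a + d) * \<sigma> (a - d))
       + (\<sigma> (c + a) * \<sigma> (c - a)) * (\<sigma> (b + d) * \<sigma> (b - d))"
      by (simp only: mult.assoc)
    also have "\<dots> = 0"
      unfolding s by (simp add: algebra_simps)
    finally show ?thesis .
  qed
  \<comment> \<open>The exceptional arguments are reached by translating all four of them by a small \<open>h\<close>.\<close>
  have "(\<lambda>h. ?T (a + h) (b + h) (c + h) (d + h)) \<midarrow>0\<rightarrow> ?T (a + 0) (b + 0) (c + 0) (d + 0)"
  proof -
    have c1: "isCont (\<lambda>h. \<sigma> (x + h + (y + h))) 0" for x y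
      by (rule isCont_o2[where g = \<sigma>]) (auto simp: isCont_sigma)
    have c2: "isCont (\<lambda>h. \<sigma> (x + h - (y + h))) 0" for x y
      by (rule isCont_o2[where g = \<sigma>]) (auto simp: isCont_sigma)
    have "isCont (\<lambda>h. ?T (a + h) (b + h) (c + h) (d + h)) 0"
      by (intro continuous_intros c1 c2)
    then show ?thesis by (simp only: isCont_def)
  qed
  moreover have "\<forall>\<^sub>F h in at 0. 0 = ?T (a + h) (b + h) (c + h) (d + h)"
  proof -
    have "\<forall>\<^sub>F h in at 0. x + h \<notin> L" for x
    proof (cases "x \<in> L")
      case True
      show ?thesis using eventually_not_L[OF L_0]
        by eventually_elim (use L_add_iff[OF True] in \<open>simp add: add.commute\<close>)
    next
      case False
      have "\<forall>\<^sub>F h in at 0. h \<in> (\<lambda>h. x + h) -` (- L) - {0}"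
        using False by (intro eventually_at_in_open open_L_shift) auto
      then show ?thesis by eventually_elim auto
    qed
    from this[of a] this[of b] this[of c] this[of d] show ?thesis
      by eventually_elim (rule generic[symmetric])
  qed
  then have "(\<lambda>h. ?T (a + h) (b + h) (c + h) (d + h)) \<midarrow>0\<rightarrow> 0"
    by (rule Lim_transform_eventually[OF tendsto_const])
  ultimately have "?T (a + 0) (b + 0) (c + 0) (d + 0) = 0"
    by (rule tendsto_unique[rotated]) auto
  then show ?thesis by (simp only: add_0_right)
qed

end

section \<open>Reduction modulo primes\<close>

text \<open>Admitting every fraction with denominator prime to \<open>l\<close>, and not only the
  reduced one, makes the closure properties immediate.\<close>

lemma l_integral_iff:
  assumes "prime (l::int)"
  shows "l_integral l q \<longleftrightarrow> (\<exists>a b. q = of_int a / of_int b \<and> \<not> l dvd b)"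
proof
  assume "l_integral l q"
  then show "\<exists>a b. q = of_int a / of_int b \<and> \<not> l dvd b"
    by (intro exI[of _ "fst (quotient_of q)"] exI[of _ "snd (quotient_of q)"])
       (simp add: l_integral_def quotient_of_div)
next
  assume "\<exists>a b. q = of_int a / of_int b \<and> \<not> l dvd b"
  then obtain a b where ab: "q = of_int a / of_int b" "\<not> l dvd b" by blast
  obtain n d where nd: "quotient_of q = (n, d)" by force
  have b0: "b \<noteq> 0" using ab by auto
  have d0: "d > 0" using nd quotient_of_denom_pos by blast
  have "of_int n / of_int d = (of_int a / of_int b :: rat)"
    using quotient_of_div[OF nd] ab by simp
  then have "(of_int (n * b) :: rat) = of_int (a * d)"
    using b0 d0 by (simp add: field_simps)
  then have "n * b = a * d" by (simp only: of_int_eq_iff)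
  then have "d dvd n * b" by simp
  moreover have "coprime d n"
    using quotient_of_coprime[OF nd] by (simp add: coprime_commute)
  ultimately have "d dvd b" by (simp add: coprime_dvd_mult_right_iff)
  then show "l_integral l q"
    using ab(2) nd dvd_trans[of l d b] by (auto simp: l_integral_def)
qed

text \<open>The maximal ideal of the local ring of the integers at \<open>l\<close>;
  \<open>l_integral\<close> is that ring itself.\<close>

definition l_max :: "int \<Rightarrow> rat \<Rightarrow> bool" where
  "l_max l q \<longleftrightarrow> (\<exists>a b. q = of_int a / of_int b \<and> \<not> l dvd b \<and> l dvd a)"

lemma l_zero_iff:
  assumes l: "prime (l::int)" and q: "l_integral l q"
  shows "l_zero l q \<longleftrightarrow> l_max l q"
proof
  assume "l_zero l q"
  with q show "l_max l q"
    unfolding l_max_def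
    by (intro exI[of _ "fst (quotient_of q)"] exI[of _ "snd (quotient_of q)"])
       (simp add: l_integral_def l_zero_def quotient_of_div)
next
  assume "l_max l q"
  then obtain a b where ab: "q = of_int a / of_int b" "\<not> l dvd b" "l dvd a"
    by (auto simp: l_max_def)
  obtain n d where nd: "quotient_of q = (n, d)" by force
  have b0: "b \<noteq> 0" using ab by auto
  have d0: "d > 0" using nd quotient_of_denom_pos by blast
  have "of_int n / of_int d = (of_int a / of_int b :: rat)"
    using quotient_of_div[OF nd] ab by simp
  then have "(of_int (n * b) :: rat) = of_int (a * d)"
    using b0 d0 by (simp add: field_simps)
  then have "n * b = a * d" by (simp only: of_int_eq_iff)
  then have "l dvd n * b" using ab by simp
  then show "l_zero l q"
    using l ab nd by (simp add: l_zero_def prime_dvd_mult_iff)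
qed

context
  fixes l :: int
  assumes l: "prime l"
begin

lemma l_integral_of_int [simp]: "l_integral l (of_int k)"
  unfolding l_integral_iff[OF l] using l by (intro exI[of _ k] exI[of _ 1]) auto

lemma l_integral_numeral [simp]: "l_integral l (numeral k)"
  using l_integral_of_int[of "numeral k"] by simp

lemma l_integral_1 [simp]: "l_integral l 1"
  using l_integral_of_int[of 1] by simp

lemma l_integral_add: 
  assumes "l_integral l x" "l_integral l y" 
  shows "l_integral l (x + y)"
proof -
  obtain a b c d where "x = of_int a / of_int b" "y = of_int c / of_int d" and nd: "\<not> l dvd b" "\<not> l dvd d"
    using assms unfolding l_integral_iff[OF l] by auto
  moreover have "b \<noteq> 0" "d \<noteq> 0" using nd by auto
  ultimately have "x + y = of_int (a * d + c * b) / of_int (b * d)"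
    by (simp add: field_simps)
  then show ?thesis
    unfolding l_integral_iff[OF l] using nd l
    by (intro exI[of _ "a * d + c * b"] exI[of _ "b * d"]) (simp add: prime_dvd_mult_iff)
qed

lemma l_integral_mult: 
  assumes "l_integral l x" "l_integral l y" 
  shows "l_integral l (x * y)"
proof -
  obtain a b c d where "x = of_int a / of_int b" "y = of_int c / of_int d" and nd: "\<not> l dvd b" "\<not> l dvd d"
    using assms unfolding l_integral_iff[OF l] by auto
  then have "x * y = of_int (a * c) / of_int (b * d)"
    by simp
  then show ?thesis
    unfolding l_integral_iff[OF l] using nd l
    by (intro exI[of _ "a * c"] exI[of _ "b * d"]) (simp add: prime_dvd_mult_iff)
qed

lemma l_integral_uminus: "l_integral l x \<Longrightarrow> l_integral l (- x)"
  using l_integral_mult[of "-1" x] l_integral_of_int[of "-1"] by simp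

lemma l_integral_diff: "l_integral l x \<Longrightarrow> l_integral l y \<Longrightarrow> l_integral l (x - y)"
  using l_integral_add[of x "- y"] l_integral_uminus[of y] by simp

lemma l_integral_power: "l_integral l x \<Longrightarrow> l_integral l (x ^ k)"
  by (induction k) (auto intro: l_integral_mult)

lemmas l_integral_intros = l_integral_add l_integral_mult l_integral_uminus l_integral_diff l_integral_power
  l_integral_of_int l_integral_numeral l_integral_1

lemma l_max_imp_integral: "l_max l x \<Longrightarrow> l_integral l x"
  unfolding l_max_def l_integral_iff[OF l] by blast

lemma l_max_0 [simp]: "l_max l 0"
  unfolding l_max_def using l by (intro exI[of _ 0] exI[of _ 1]) auto

lemma l_max_add: 
  assumes "l_max l x" "l_max l y" 
  shows "l_max l (x + y)"
proof -
  obtain a b c d where xy: "x = of_int a / of_int b" "y = of_int c / of_int d"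
    and nd: "\<not> l dvd b" "\<not> l dvd d" "l dvd a" "l dvd c"
    using assms unfolding l_max_def by auto
  moreover have "b \<noteq> 0" "d \<noteq> 0" using nd by auto
  ultimately have "x + y = of_int (a * d + c * b) / of_int (b * d)"
    by (simp add: field_simps)
  then show ?thesis
    unfolding l_max_def using nd l
    by (intro exI[of _ "a * d + c * b"] exI[of _ "b * d"]) (simp add: prime_dvd_mult_iff)
qed

lemma l_max_mult: 
  assumes "l_max l x" "l_integral l y" 
  shows "l_max l (x * y)"
proof -
  obtain a b where x: "x = of_int a / of_int b" "\<not> l dvd b" "l dvd a"
    using assms unfolding l_max_def by auto
  obtain c d where y: "y = of_int c / of_int d" "\<not> l dvd d"
    using assms unfolding l_integral_iff[OF l] by auto
  have "x * y = of_int (a * c) / of_int (b * d)"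
    by (simp add: x y)
  then show ?thesis
    unfolding l_max_def using x y l
    by (intro exI[of _ "a * c"] exI[of _ "b * d"]) (simp add: prime_dvd_mult_iff)
qed

lemma l_max_mult': "l_integral l y \<Longrightarrow> l_max l x \<Longrightarrow> l_max l (y * x)"
  using l_max_mult[of x y] by (simp add: mult.commute)

lemma l_max_uminus: "l_max l x \<Longrightarrow> l_max l (- x)"
  using l_max_mult[of x "-1"] l_integral_of_int[of "-1"] by simp

lemma l_max_diff: "l_max l x \<Longrightarrow> l_max l y \<Longrightarrow> l_max l (x - y)"
  using l_max_add[of x "- y"] l_max_uminus[of y] by simp

lemma not_l_max_1: "\<not> l_max l 1"
proof
  assume "l_max l 1"
  then obtain a b where ab: "(1::rat) = of_int a / of_int b" "\<not> l dvd b" "l dvd a"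
    unfolding l_max_def by auto
  have "b \<noteq> 0" using ab by auto
  then have "(of_int a :: rat) = of_int b" using ab by (simp add: field_simps)
  with ab show False by simp
qed

lemma l_integral_inverse:
  assumes "\<not> l_max l x"
  shows "l_integral l (1 / x)"
proof -
  obtain n d where nd: "quotient_of x = (n, d)" by force
  have x: "x = of_int n / of_int d" using quotient_of_div[OF nd] .
  have "\<not> l dvd n"
  proof
    assume n: "l dvd n"
    have "\<not> l dvd d"
    proof
      assume "l dvd d"
      with n show False
        using coprime_common_divisor[OF quotient_of_coprime[OF nd]] l not_prime_unit by blast
    qed
    with n x assms show False unfolding l_max_def by blast
  qed
  moreover have "1 / x = of_int d / of_int n" by (simp add: x)
  ultimately show ?thesis unfolding l_integral_iff[OF l] by blast
qed

lemma l_max_inverse: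
  assumes "\<not> l_integral l x"
  shows "l_max l (1 / x)"
proof -
  obtain n d where nd: "quotient_of x = (n, d)" by force
  have x: "x = of_int n / of_int d" using quotient_of_div[OF nd] .
  have d: "l dvd d"
    using assms nd by (simp add: l_integral_def)
  have "\<not> l dvd n"
  proof
    assume "l dvd n"
    with d show False
      using coprime_common_divisor[OF quotient_of_coprime[OF nd]] l not_prime_unit by blast
  qed
  moreover have "1 / x = of_int d / of_int n" by (simp add: x)
  ultimately show ?thesis unfolding l_max_def using d by blast
qed

lemma nonsing_red_iff:
  "nonsing_red E l (Pt x y) \<longleftrightarrow> \<not> (l_integral l x \<and> l_integral l y \<and>
     l_max l (of_int (a1 E) * y - 3 * x^2 - 2 * of_int (a2 E) * x - of_int (a4 E)) \<and>
     l_max l (2 * y + of_int (a1 E) * x + of_int (a3 E)))"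
proof -
  have "l_integral l (of_int (a1 E) * y - 3 * x^2 - 2 * of_int (a2 E) * x - of_int (a4 E))"
    "l_integral l (2 * y + of_int (a1 E) * x + of_int (a3 E))" if "l_integral l x" "l_integral l y"
    using that by (auto intro!: l_integral_intros)
  then show ?thesis
    using l_zero_iff[OF l] by (auto simp: nonsing_red_def)
qed

text \<open>Negation is an involution of the curve with integral coefficients: it changes the sign
  of the partial derivative in y and alters the one in x by a1 times the former, so both lie in the
  maximal ideal together.\<close>

lemma nonsing_red_eneg:
  "nonsing_red E l P \<Longrightarrow> nonsing_red E l (eneg E P)"
proof (cases P)
  case (Pt x y)
  assume ns: "nonsing_red E l P"
  define A1 A2 A3 A4 where "A1 = (of_int (a1 E) :: rat)" "A2 = (of_int (a2 E) :: rat)"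
    "A3 = (of_int (a3 E) :: rat)" "A4 = (of_int (a4 E) :: rat)"
  have Ai: "l_integral l A1" "l_integral l A3" by (simp_all add: A1_A2_A3_A4_def)
  define y' where "y' = - y - A1 * x - A3"
  show ?thesis
  proof (rule ccontr)
    assume "\<not> ?thesis"
    then have h: "l_integral l x" "l_integral l y'" "l_max l (A1 * y' - 3 * x^2 - 2 * A2 * x - A4)"
      "l_max l (2 * y' + A1 * x + A3)"
      by (simp_all add: Pt eneg_def nonsing_red_iff y'_def A1_A2_A3_A4_def)
    have y: "y = - y' - A1 * x - A3" by (simp add: y'_def)
    have "l_integral l y" unfolding y using h Ai by (intro l_integral_intros)
    moreover have "l_max l (2 * y + A1 * x + A3)"
    proof -
      have eq: "2 * y + A1 * x + A3 = - (2 * y' + A1 * x + A3)" by (simp add: y)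
      show ?thesis unfolding eq by (rule l_max_uminus[OF h(4)])
    qed
    moreover have "l_max l (A1 * y - 3 * x^2 - 2 * A2 * x - A4)"
    proof -
      have eq: "A1 * y - 3 * x^2 - 2 * A2 * x - A4 =
        (A1 * y' - 3 * x^2 - 2 * A2 * x - A4) - A1 * (2 * y' + A1 * x + A3)"
        by (simp add: y algebra_simps)
      show ?thesis unfolding eq by (rule l_max_diff[OF h(3) l_max_mult'[OF Ai(1) h(4)]])
    qed
    ultimately show False
      using ns h by (simp add: Pt nonsing_red_iff A1_A2_A3_A4_def)
  qed
qed (simp add: eneg_def)

end

text \<open>Chord and tangent are brought under one line, as is necessary for reduction modulo a
  prime, where distinct points may collide. The formula for \<open>x3\<close> and the fifth equation
  are Vieta's relations for the three abscissae on the line.\<close>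

lemma eadd_line:
  fixes x1 y1 x2 y2 x3 y3 :: rat
  assumes c1: "on_curve E (Pt x1 y1)" and c2: "on_curve E (Pt x2 y2)"
    and add: "eadd E (Pt x1 y1) (Pt x2 y2) = Pt x3 y3"
  obtains lam nu where "y1 = lam * x1 + nu" "y2 = lam * x2 + nu"
    "x3 = lam ^ 2 + of_int (a1 E) * lam - of_int (a2 E) - x1 - x2"
    "y3 = - (lam * x3 + nu) - of_int (a1 E) * x3 - of_int (a3 E)"
    "x1 * x2 + (x1 + x2) * x3 = of_int (a4 E) - 2 * lam * nu - of_int (a1 E) * nu - of_int (a3 E) * lam"
    "x1 \<noteq> x2 \<Longrightarrow> lam = (y2 - y1) / (x2 - x1)"
    "x1 = x2 \<Longrightarrow> lam * (2 * y1 + of_int (a1 E) * x1 + of_int (a3 E))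
        = 3 * x1^2 + 2 * of_int (a2 E) * x1 + of_int (a4 E) - of_int (a1 E) * y1"
proof -
  define A1 A2 A3 A4 A6 where A: "A1 = (of_int (a1 E) :: rat)" "A2 = (of_int (a2 E) :: rat)"
    "A3 = (of_int (a3 E) :: rat)" "A4 = (of_int (a4 E) :: rat)" "A6 = (of_int (a6 E) :: rat)"
  have C1: "y1^2 + A1 * x1 * y1 + A3 * y1 = x1^3 + A2 * x1^2 + A4 * x1 + A6"
    and C2: "y2^2 + A1 * x2 * y2 + A3 * y2 = x2^3 + A2 * x2^2 + A4 * x2 + A6"
    using c1 c2 by (simp_all add: on_curve_def A)
  show ?thesis
  proof (cases "x1 = x2")
    case False
    define lam where "lam = (y2 - y1) / (x2 - x1)"
    define nu where "nu = (y1 * x2 - y2 * x1) / (x2 - x1)"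
    have d: "x2 - x1 \<noteq> 0" using False by simp
    have y1: "y1 = lam * x1 + nu"
      using d by (simp add: lam_def nu_def divide_simps) (simp add: algebra_simps)
    have y2: "y2 = lam * x2 + nu"
      using d by (simp add: lam_def nu_def divide_simps) (simp add: algebra_simps)
    have x3: "x3 = lam ^ 2 + A1 * lam - A2 - x1 - x2"
      and y3: "y3 = - (lam + A1) * x3 - nu - A3"
      using add False by (auto simp: eadd_def Let_def lam_def nu_def A)
    have "(x2 - x1) * (lam ^ 2 * (x1 + x2) + 2 * lam * nu + A1 * (lam * (x1 + x2) + nu) + A3 * lam
       - (x1^2 + x1 * x2 + x2^2 + A2 * (x1 + x2) + A4)) = 
       (y2^2 + A1 * x2 * y2 + A3 * y2 - (x2^3 + A2 * x2^2 + A4 * x2 + A6))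
       - (y1^2 + A1 * x1 * y1 + A3 * y1 - (x1^3 + A2 * x1^2 + A4 * x1 + A6))"
      unfolding y1 y2 by (simp add: algebra_simps power2_eq_square power3_eq_cube)
    then have "lam ^ 2 * (x1 + x2) + 2 * lam * nu + A1 * (lam * (x1 + x2) + nu) + A3 * lam
       - (x1^2 + x1 * x2 + x2^2 + A2 * (x1 + x2) + A4) = 0"
      using C1 C2 d by simp
    then have "A4 = lam ^ 2 * (x1 + x2) + 2 * lam * nu + A1 * (lam * (x1 + x2) + nu) + A3 * lam
       - (x1^2 + x1 * x2 + x2^2 + A2 * (x1 + x2))"
      by simp
    then have e2: "x1 * x2 + (x1 + x2) * x3 = A4 - 2 * lam * nu - A1 * nu - A3 * lam"
      unfolding x3 by (simp add: algebra_simps power2_eq_square)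
    have y3': "y3 = - (lam * x3 + nu) - A1 * x3 - A3"
      unfolding y3 by (simp add: algebra_simps)
    show ?thesis
      by (rule that[of lam nu, folded A, OF y1 y2 x3 y3' e2]) (use False in \<open>simp_all only: lam_def\<close>)
  next
    case True
    define psi where "psi = 2 * y1 + A1 * x1 + A3"
    have ne: "y1 + y2 + A1 * x2 + A3 \<noteq> 0"
      using add True by (auto simp: eadd_def A)
    have "(y1 - y2) * (y1 + y2 + A1 * x2 + A3) = 0"
    proof -
      have "(y1 - y2) * (y1 + y2 + A1 * x2 + A3) = (y1^2 + A1 * x1 * y1 + A3 * y1) - (y2^2 + A1 * x2 * y2 + A3 * y2)"
        using True by (simp add: algebra_simps power2_eq_square)
      then show ?thesis using C1 C2 True by simp
    qed
    then have yy: "y2 = y1" using ne by simp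
    have p: "psi \<noteq> 0" using ne True yy by (simp add: psi_def)
    define lam where "lam = (3 * x1^2 + 2 * A2 * x1 + A4 - A1 * y1) / psi"
    define nu where "nu = (- (x1^3) + A4 * x1 + 2 * A6 - A3 * y1) / psi"
    have lp: "lam * psi = 3 * x1^2 + 2 * A2 * x1 + A4 - A1 * y1" using p by (simp add: lam_def)
    have np: "nu * psi = - (x1^3) + A4 * x1 + 2 * A6 - A3 * y1" using p by (simp add: nu_def)
    have x3: "x3 = lam ^ 2 + A1 * lam - A2 - x1 - x2"
      and y3: "y3 = - (lam + A1) * x3 - nu - A3"
      using add True ne yy by (auto simp: eadd_def Let_def lam_def nu_def A psi_def)
    have "y1 * psi = (lam * x1 + nu) * psi"
    proof -
      have "(lam * x1 + nu) * psi = x1 * (lam * psi) + nu * psi" by (simp add: algebra_simps)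
      also have "\<dots> = x1 * (3 * x1^2 + 2 * A2 * x1 + A4 - A1 * y1) + (- (x1^3) + A4 * x1 - A3 * y1) + 2 * A6"
        unfolding lp np by simp
      also have "A6 = y1^2 + A1 * x1 * y1 + A3 * y1 - (x1^3 + A2 * x1^2 + A4 * x1)"
        using C1 by simp
      finally show ?thesis
        by (simp add: psi_def algebra_simps power2_eq_square power3_eq_cube)
    qed
    then have y1: "y1 = lam * x1 + nu" using p by simp
    have nu: "nu = y1 - lam * x1" using y1 by simp
    have "x1 * x2 + (x1 + x2) * x3 - (A4 - 2 * lam * nu - A1 * nu - A3 * lam) = 
      lam * psi - (3 * x1^2 + 2 * A2 * x1 + A4 - A1 * y1)"
      unfolding x3 nu True[symmetric] psi_def by (simp add: algebra_simps power2_eq_square)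
    then have e2: "x1 * x2 + (x1 + x2) * x3 = A4 - 2 * lam * nu - A1 * nu - A3 * lam"
      using lp by simp
    have y3': "y3 = - (lam * x3 + nu) - A1 * x3 - A3"
      unfolding y3 by (simp add: algebra_simps)
    have y2: "y2 = lam * x2 + nu"
      using y1 unfolding yy True .
    show ?thesis
      by (rule that[of lam nu, folded A, OF y1 y2 x3 y3' e2]) (use True lp in \<open>simp_all only: psi_def\<close>)
  qed
qed

text \<open>If the sum were singular modulo \<open>l\<close>, the line through \<open>P\<close> and \<open>Q\<close> would meet the
  reduced cubic at least doubly there, so that \<open>P\<close> or \<open>Q\<close> would reduce to the same singular point.\<close>

lemma nonsing_red_eadd:
  assumes l: "prime (l::int)" and P: "on_curve E P" "nonsing_red E l P" and Q: "on_curve E Q" "nonsing_red E l Q"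
  shows "nonsing_red E l (eadd E P Q)"
proof (cases P)
  case Inf
  then show ?thesis using Q by (simp add: eadd_def)
next
  case P': (Pt x1 y1)
  show ?thesis
  proof (cases Q)
    case Inf
    then show ?thesis using P P' by (simp add: eadd_def)
  next
    case Q': (Pt x2 y2)
    show ?thesis
    proof (cases "eadd E P Q")
      case Inf
      then show ?thesis by (simp add: nonsing_red_def)
    next
      case R: (Pt x3 y3)
      define A1 A2 A3 A4 where A: "A1 = (of_int (a1 E) :: rat)" "A2 = (of_int (a2 E) :: rat)"
        "A3 = (of_int (a3 E) :: rat)" "A4 = (of_int (a4 E) :: rat)"
      have Ai: "l_integral l A1" "l_integral l A2" "l_integral l A3" "l_integral l A4"
        by (simp_all add: A l l_integral_of_int)
      obtain lam nu where line: "y1 = lam * x1 + nu" "y2 = lam * x2 + nu"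
        and x3: "x3 = lam ^ 2 + A1 * lam - A2 - x1 - x2"
        and y3: "y3 = - (lam * x3 + nu) - A1 * x3 - A3"
        and e2: "x1 * x2 + (x1 + x2) * x3 = A4 - 2 * lam * nu - A1 * nu - A3 * lam"
        using eadd_line[of E x1 y1 x2 y2 x3 y3] P Q R P' Q' unfolding A by metis
      \<comment> \<open>The point with coordinates \<open>x3\<close> and \<open>y'\<close> is the
        third intersection with the line, that is, the negative of the sum.\<close>
      define y' where "y' = lam * x3 + nu"
      define fx where "fx = (\<lambda>x y. A1 * y - 3 * x^2 - 2 * A2 * x - A4)"
      define fy where "fy = (\<lambda>x y. 2 * y + A1 * x + A3)"
      have ns: "nonsing_red E l (Pt x y) \<longleftrightarrow> \<not> (l_integral l x \<and> l_integral l y \<and> l_max l (fx x y) \<and> l_max l (fy x y))" for x y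
        by (simp add: nonsing_red_iff[OF l] fx_def fy_def A)
      show ?thesis
      proof (rule ccontr)
        assume "\<not> ?thesis"
        then have "\<not> nonsing_red E l (eneg E (Pt x3 y3))"
          using nonsing_red_eneg[OF l, of E "eneg E (Pt x3 y3)"] R by (auto simp: eneg_def)
        then have s: "l_integral l x3" "l_integral l y'" "l_max l (fx x3 y')" "l_max l (fy x3 y')"
          using y3 by (simp_all add: eneg_def ns y'_def flip: A)
        define d1 d2 where d: "d1 = x1 - x3" "d2 = x2 - x3"
        have xy: "x1 = x3 + d1" "y1 = y' + lam * d1" "x2 = x3 + d2" "y2 = y' + lam * d2"
          using line by (simp_all add: d y'_def algebra_simps)
        \<comment> \<open>Restricted to the line, the curve equation is a cubic with roots
          \<open>x1\<close>, \<open>x2\<close>, \<open>x3\<close>. Its derivative at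
          \<open>x3\<close> is the product of root differences on one side and a combination of the
          partial derivatives on the other, up to sign.\<close>
        have prod: "d1 * d2 = - (fx x3 y' + lam * fy x3 y')"
        proof -
          have "d1 * d2 + fx x3 y' + lam * fy x3 y' =
            (x1 * x2 + (x1 + x2) * x3) - (A4 - 2 * lam * nu - A1 * nu - A3 * lam)
            + 2 * x3 * ((lam ^ 2 + A1 * lam - A2 - x1 - x2) - x3)"
            unfolding d fx_def fy_def y'_def by (simp add: algebra_simps power2_eq_square)
          then have "d1 * d2 + fx x3 y' + lam * fy x3 y' = 0"
            using e2 x3 by simp
          then show ?thesis by (simp add: algebra_simps eq_neg_iff_add_eq_0)
        qed
        have sum: "d1 + d2 = lam ^ 2 + A1 * lam - A2 - 3 * x3"
          using x3 by (simp add: d)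
        \<comment> \<open>A point congruent to the singular one modulo \<open>l\<close> is singular
          too. Both displacements, in x and in y, have to lie in the maximal ideal, and the slope
          may have a denominator.\<close>
        have key: "\<not> nonsing_red E l (Pt (x3 + e) (y' + lam * e))" if e: "l_max l e" "l_max l (lam * e)" for e
        proof -
          have ei: "l_integral l e" "l_integral l (lam * e)" using e l_max_imp_integral[OF l] by blast+
          have "l_integral l (x3 + e)" "l_integral l (y' + lam * e)"
            using s ei by (intro l_integral_add[OF l]; simp)+
          moreover have "l_max l (fx (x3 + e) (y' + lam * e))"
          proof -
            have "fx (x3 + e) (y' + lam * e) = fx x3 y' + (A1 * (lam * e) - (6 * x3 + 3 * e + 2 * A2) * e)"
              by (simp add: fx_def algebra_simps power2_eq_square)
            moreover have "l_integral l (6 * x3 + 3 * e + 2 * A2)"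
              using s ei Ai by (intro l_integral_intros[OF l])
            ultimately show ?thesis
              using s e Ai by (auto intro!: l_max_add[OF l] l_max_diff[OF l] l_max_mult'[OF l])
          qed
          moreover have "l_max l (fy (x3 + e) (y' + lam * e))"
          proof -
            have "fy (x3 + e) (y' + lam * e) = fy x3 y' + (2 * (lam * e) + A1 * e)"
              by (simp add: fy_def algebra_simps)
            then show ?thesis
              using s e Ai l_integral_numeral[OF l] by (auto intro!: l_max_add[OF l] l_max_mult'[OF l])
          qed
          ultimately show ?thesis by (simp add: ns)
        qed
        have n1: "\<not> (l_max l d1 \<and> l_max l (lam * d1))"
          using key[of d1] P P' xy by auto
        have n2: "\<not> (l_max l d2 \<and> l_max l (lam * d2))"
          using key[of d2] Q Q' xy by auto
        show False
        proof (cases "l_integral l lam")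
          case True
          have "l_max l (d1 * d2)"
            unfolding prod using s True by (intro l_max_uminus[OF l] l_max_add[OF l] l_max_mult'[OF l])
          \<comment> \<open>The ideal is prime in the sense needed here: the inverse of an element
            outside it is integral.\<close>
          have "l_max l d1 \<or> l_max l d2"
          proof (rule ccontr)
            assume n: "\<not> ?thesis"
            then have "d1 \<noteq> 0" using l_max_0[OF l] by auto
            then have "d2 = (1 / d1) * (d1 * d2)" by simp
            moreover have "l_max l ((1 / d1) * (d1 * d2))"
              by (rule l_max_mult'[OF l l_integral_inverse[OF l]]) (use n \<open>l_max l (d1 * d2)\<close> in auto)
            ultimately show False using n by simp
          qed
          then show False
            using n1 n2 l_max_mult'[OF l True] by blast
        next
          case False
          \<comment> \<open>Modulo \<open>l\<close> the line is vertical, so the reciprocal slope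
            \<open>mu\<close> and the differences of ordinates \<open>u1\<close>, \<open>u2\<close>
            are the proper parameters.\<close>
          define mu where "mu = 1 / lam"
          have mu: "l_max l mu" unfolding mu_def by (rule l_max_inverse[OF l False])
          have lam0: "lam \<noteq> 0" using False l_integral_of_int[OF l, of 0] by auto
          have mui: "l_integral l mu" by (rule l_max_imp_integral[OF l mu])
          define u1 u2 where u: "u1 = lam * d1" "u2 = lam * d2"
          have du: "d1 = mu * u1" "d2 = mu * u2" using lam0 by (simp_all add: u mu_def)
          have nu1: "\<not> l_max l u1" using n1 l_max_mult'[OF l mui, of u1] unfolding du(1)[symmetric] u(1)[symmetric] by blast
          have nu2: "\<not> l_max l u2" using n2 l_max_mult'[OF l mui, of u2] unfolding du(2)[symmetric] u(2)[symmetric] by blast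
          have u0: "u1 \<noteq> 0" "u2 \<noteq> 0" using nu1 nu2 l_max_0[OF l] by auto
          define g where "g = fx x3 y' * mu + fy x3 y'"
          \<comment> \<open>\<open>kap\<close> is congruent to 1. The sum and the product of the
            root differences nevertheless express it as \<open>g\<close> times a sum of inverses of
            non-elements of the maximal ideal, and \<open>g\<close> lies in that ideal: a
            contradiction.\<close>
          define kap where "kap = 1 + (A1 - (A2 + 3 * x3) * mu) * mu"
          have k1: "kap = mu ^ 2 * (d1 + d2)"
            unfolding sum kap_def mu_def using lam0 by (simp add: field_simps power2_eq_square)
          have k2: "g = - mu * (d1 * d2)"
            unfolding prod g_def mu_def using lam0 by (simp add: field_simps)
          have "kap * (u1 * u2) = - g * (u1 + u2)"
            unfolding k1 k2 u using lam0 by (simp add: mu_def field_simps power2_eq_square)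
          then have "kap = - (g * (1 / u1 + 1 / u2))"
            using u0 by (simp add: field_simps)
          moreover have "l_max l (- (g * (1 / u1 + 1 / u2)))"
          proof (intro l_max_uminus[OF l] l_max_mult[OF l] l_integral_add[OF l] l_integral_inverse[OF l] nu1 nu2)
            show "l_max l g" unfolding g_def
              using s mui l_max_imp_integral[OF l] by (intro l_max_add[OF l] l_max_mult[OF l]) auto
          qed
          ultimately have "l_max l kap" by simp
          moreover have "l_max l ((A1 - (A2 + 3 * x3) * mu) * mu)"
            using mu mui Ai s by (intro l_max_mult'[OF l] l_integral_intros[OF l]) 
          ultimately have "l_max l (kap - (A1 - (A2 + 3 * x3) * mu) * mu)"
            by (rule l_max_diff[OF l])
          then show False using not_l_max_1[OF l] by (simp add: kap_def)
        qed
      qed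
    qed
  qed
qed

section \<open>Denominators of rational points\<close>

text \<open>Both triples have content 1 and the cross products agree, so x times the content of the
  second triple equals x' times the content of the first. This compares two integral representatives
  of one projective point.\<close>

lemma primitive_triple_unique:
  fixes x y z x' y' z' :: int
  assumes "\<And>l. prime l \<Longrightarrow> \<not> (l dvd x \<and> l dvd y \<and> l dvd z)"
    and "\<And>l. prime l \<Longrightarrow> \<not> (l dvd x' \<and> l dvd y' \<and> l dvd z')"
    and eq: "x * y' = x' * y" "x * z' = x' * z" and nonneg: "x \<ge> 0" "x' \<ge> 0"
  shows "x = x'"
proof -
  have unit: "gcd (gcd a b) c = 1" if "\<And>l. prime l \<Longrightarrow> \<not> (l dvd a \<and> l dvd b \<and> l dvd c)" for a b c :: int
  proof (rule ccontr)
    assume "gcd (gcd a b) c \<noteq> 1"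
    then have "\<bar>gcd (gcd a b) c\<bar> \<noteq> 1" by simp
    then obtain p where "prime p" "p dvd gcd (gcd a b) c"
      by (rule prime_factor_int)
    then show False using that by auto
  qed
  have "x = x * gcd (gcd x' y') z'" using unit[OF assms(2)] by simp
  also have "\<dots> = gcd (gcd (x * x') (x * y')) (x * z')"
    using nonneg by (simp add: gcd_mult_left)
  also have "\<dots> = gcd (gcd (x' * x) (x' * y)) (x' * z)"
    unfolding eq by (simp add: mult.commute)
  also have "\<dots> = x' * gcd (gcd x y) z"
    using nonneg by (simp add: gcd_mult_left)
  also have "\<dots> = x'" using unit[OF assms(1)] by simp
  finally show ?thesis .
qed

definition denom_form :: "rat \<Rightarrow> rat \<Rightarrow> int \<Rightarrow> int \<Rightarrow> int \<Rightarrow> bool" where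
  "denom_form x y A B D \<longleftrightarrow> D > 0 \<and> x = of_int A / of_int D ^ 2 \<and> y = of_int B / of_int D ^ 3 \<and> coprime A D \<and> coprime B D"

lemma coprime_add_multiple:
  fixes q r k :: int
  assumes "coprime q r"
  shows "coprime q (r + q * k)"
  using assms gcd_add_mult[of q k r] by (simp only: coprime_iff_gcd_eq_1 add.commute mult.commute)

text \<open>\<open>U\<close> is the numerator of the cubic in x and is prime to the denominator
  \<open>q\<close> of x. Clearing denominators gives \<open>q^2 dvd s^2\<close>, so
  \<open>s = q * t\<close>. The remaining equation \<open>q * V = t^2 * U\<close>, with
  \<open>t\<close> prime to \<open>V\<close>, forces \<open>q = t^2\<close>, and then
  \<open>s = t^3\<close>.\<close>

lemma denom_form_exists:
  assumes "on_curve E (Pt x y)"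
  obtains A B D where "denom_form x y A B D"
proof -
  obtain p q where pq: "quotient_of x = (p, q)" by force
  obtain r s where rs: "quotient_of y = (r, s)" by force
  have pos: "q > 0" "s > 0" using pq rs quotient_of_denom_pos by blast+
  have x: "x = of_int p / of_int q" and y: "y = of_int r / of_int s"
    using quotient_of_div[OF pq] quotient_of_div[OF rs] by auto
  have cop: "coprime p q" "coprime r s"
    using quotient_of_coprime[OF pq] quotient_of_coprime[OF rs] by auto
  define U where "U = p^3 + q * (a2 E * p^2 + a4 E * p * q + a6 E * q^2)"
  have eq: "q^2 * (q * (r^2 + a3 E * r * s) + a1 E * p * r * s) = s^2 * U"
  proof -
    have "y^2 + of_int (a1 E) * x * y + of_int (a3 E) * y
       = x^3 + of_int (a2 E) * x^2 + of_int (a4 E) * x + of_int (a6 E)"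
      using assms by (simp add: on_curve_def)
    then have "(y^2 + of_int (a1 E) * x * y + of_int (a3 E) * y) * (of_int q ^ 3 * of_int s ^ 2)
       = (x^3 + of_int (a2 E) * x^2 + of_int (a4 E) * x + of_int (a6 E)) * (of_int q ^ 3 * of_int s ^ 2)"
      by simp
    moreover have "(y^2 + of_int (a1 E) * x * y + of_int (a3 E) * y) * (of_int q ^ 3 * of_int s ^ 2)
       = of_int (q^2 * (q * (r^2 + a3 E * r * s) + a1 E * p * r * s))"
      unfolding x y using pos by (simp add: field_simps power2_eq_square power3_eq_cube)
    moreover have "(x^3 + of_int (a2 E) * x^2 + of_int (a4 E) * x + of_int (a6 E)) * (of_int q ^ 3 * of_int s ^ 2)
       = of_int (s^2 * U)"
      unfolding x U_def using pos by (simp add: field_simps power2_eq_square power3_eq_cube)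
    ultimately show ?thesis by (simp only: of_int_eq_iff)
  qed
  have cU: "coprime q U"
    unfolding U_def using cop by (intro coprime_add_multiple) (simp add: coprime_commute)
  have "q^2 dvd s^2 * U" using eq by (metis dvd_triv_left)
  then have "q^2 dvd s^2" using cU by (simp add: coprime_dvd_mult_left_iff)
  then have "q dvd s" by simp
  then obtain t where t: "s = q * t" by blast
  have t0: "t > 0" using pos t by (simp add: zero_less_mult_iff)
  define V where "V = r^2 + t * (a3 E * r * q + a1 E * p * r)"
  have eq2: "q * V = t^2 * U"
  proof -
    have "q^2 * (q * V) = q^2 * (t^2 * U)"
      using eq unfolding t V_def by (simp add: algebra_simps power2_eq_square)
    then show ?thesis using pos by simp
  qed
  have cV: "coprime t V"
    unfolding V_def using cop(2) by (intro coprime_add_multiple) (simp add: t coprime_commute)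
  have "q dvd t^2 * U" using eq2 by (metis dvd_triv_left)
  then have 1: "q dvd t^2" using cU by (simp add: coprime_dvd_mult_left_iff)
  have "t^2 dvd q * V" using eq2 by (metis dvd_triv_left)
  then have 2: "t^2 dvd q" using cV by (simp add: coprime_dvd_mult_left_iff)
  have qt: "q = t^2" using 1 2 pos t0 by (simp add: zdvd_antisym_nonneg)
  have "denom_form x y p r t"
    unfolding denom_form_def x y t qt using t0 cop unfolding t qt
    by (simp add: power2_eq_square power3_eq_cube)
  then show ?thesis using that by blast
qed

lemma denom_form_edenom:
  assumes "denom_form x y A B D"
  shows "edenom (Pt x y) = D"
proof -
  have uniq: "D' = D" if "denom_form x y A' B' D'" for A' B' D'
  proof -
    have pos: "D > 0" "D' > 0" using assms that by (auto simp: denom_form_def)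
    have c: "coprime A D" "coprime A' D'" using assms that by (auto simp: denom_form_def)
    have "of_int A / of_int D ^ 2 = (of_int A' / of_int D' ^ 2 :: rat)"
      using assms that by (auto simp: denom_form_def)
    then have "(of_int (A * D' ^ 2) :: rat) = of_int (A' * D ^ 2)"
      using pos by (simp add: field_simps)
    then have eq: "A * D' ^ 2 = A' * D ^ 2" by (simp only: of_int_eq_iff)
    have "D ^ 2 dvd A * D' ^ 2" unfolding eq by simp
    then have "D ^ 2 dvd D' ^ 2" using c by (simp add: coprime_dvd_mult_right_iff coprime_commute)
    moreover have "D' ^ 2 dvd A' * D ^ 2" unfolding eq[symmetric] by simp
    then have "D' ^ 2 dvd D ^ 2" using c by (simp add: coprime_dvd_mult_right_iff coprime_commute)
    ultimately show ?thesis using pos by (simp add: zdvd_antisym_nonneg)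
  qed
  have "(THE D. D > 0 \<and> (\<exists>A B. x = of_int A / of_int D ^ 2 \<and> y = of_int B / of_int D ^ 3
        \<and> coprime A D \<and> coprime B D)) = D"
  proof (rule the_equality)
    show "D > 0 \<and> (\<exists>A B. x = of_int A / of_int D ^ 2 \<and> y = of_int B / of_int D ^ 3 \<and> coprime A D \<and> coprime B D)"
      using assms unfolding denom_form_def by blast
  next
    fix D' assume "D' > 0 \<and> (\<exists>A B. x = of_int A / of_int D' ^ 2 \<and> y = of_int B / of_int D' ^ 3 \<and> coprime A D' \<and> coprime B D')"
    then show "D' = D" using uniq unfolding denom_form_def by blast
  qed
  then show ?thesis by (simp add: edenom_def)
qed

lemma edenom_pos: "on_curve E (Pt x y) \<Longrightarrow> edenom (Pt x y) > 0"
  by (metis denom_form_exists denom_form_edenom denom_form_def)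

text \<open>The sum and the product of the abscissae of P+Q and P-Q are invariant under negating
  either point, which is why they are rational functions of the two abscissae alone.\<close>

lemma chord_sum_prod:
  fixes x1 y1 x2 y2 A1 A2 A3 A4 A6 :: rat
  assumes C1: "y1^2 + A1 * x1 * y1 + A3 * y1 = x1^3 + A2 * x1^2 + A4 * x1 + A6"
    and C2: "y2^2 + A1 * x2 * y2 + A3 * y2 = x2^3 + A2 * x2^2 + A4 * x2 + A6"
    and ne: "x1 \<noteq> x2"
  defines "y2' \<equiv> - y2 - A1 * x2 - A3"
  defines "lam \<equiv> (y2 - y1) / (x2 - x1)" and "mu \<equiv> (y2' - y1) / (x2 - x1)"
  defines "xp \<equiv> lam^2 + A1 * lam - A2 - x1 - x2" and "xm \<equiv> mu^2 + A1 * mu - A2 - x1 - x2"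
  shows "(x1 - x2)^2 * (xp + xm) = 2 * x1 * x2 * (x1 + x2) + (A1^2 + 4 * A2) * x1 * x2
       + (2 * A4 + A1 * A3) * (x1 + x2) + (A3^2 + 4 * A6)" (is ?sum)
    and "(x1 - x2)^2 * (xp * xm) = x1^2 * x2^2 - (2 * A4 + A1 * A3) * x1 * x2
       - (A3^2 + 4 * A6) * (x1 + x2) - (A1^2 * A6 + 4 * A2 * A6 - A1 * A3 * A4 + A2 * A3^2 - A4^2)" (is ?prod)
proof -
  define d where "d = x2 - x1"
  have d: "d \<noteq> 0" using ne by (simp add: d_def)
  have x2: "x2 = x1 + d" by (simp add: d_def)
  have ld: "lam * d = y2 - y1" using d by (simp add: lam_def d_def)
  have md: "mu * d = y2' - y1" using d by (simp add: mu_def d_def)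
  have y2: "y2 = y1 + lam * d" using ld by simp
  \<comment> \<open>The two curve equations are solved for \<open>A6\<close> and \<open>A4\<close>
    in terms of one point, the slope and \<open>d\<close>. This leaves independent variables, and
    the claims become polynomial identities.\<close>
  have A6: "A6 = y1^2 + A1 * x1 * y1 + A3 * y1 - x1^3 - A2 * x1^2 - A4 * x1"
    using C1 by simp
  have "d * A4 = d * (lam * (2 * y1 + lam * d) + A1 * (x1 * lam + y1 + lam * d) + A3 * lam
      - (3 * x1^2 + 3 * x1 * d + d^2) - A2 * (2 * x1 + d))"
    using C2 unfolding A6 x2 y2 by (simp add: algebra_simps power2_eq_square power3_eq_cube)
  then have A4: "A4 = lam * (2 * y1 + lam * d) + A1 * (x1 * lam + y1 + lam * d) + A3 * lam
      - (3 * x1^2 + 3 * x1 * d + d^2) - A2 * (2 * x1 + d)"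
    using d by simp
  have dd: "(x1 - x2)^2 = d^2" by (simp add: x2)
  have M: "d^2 * xm = (y2' - y1)^2 + A1 * d * (y2' - y1) - (A2 + x1 + x2) * d^2"
    unfolding xm_def md[symmetric] by (simp add: algebra_simps power2_eq_square)
  have y2': "y2' = - (y1 + lam * d) - A1 * (x1 + d) - A3"
    unfolding y2'_def x2 y2 ..
  have "d^2 * (xp + xm) = d^2 * xp + d^2 * xm" by (simp add: algebra_simps)
  then show ?sum
    unfolding dd M unfolding xp_def y2' x2 A6 A4
    by (simp add: algebra_simps power2_eq_square power3_eq_cube)
  have "d^2 * (xp * xm) = xp * (d^2 * xm)" by (simp add: algebra_simps)
  then show ?prod
    unfolding dd M unfolding xp_def y2' x2 A6 A4
    by (simp add: algebra_simps power2_eq_square power3_eq_cube)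
qed

text \<open>Modulo a prime dividing \<open>\<Delta>\<close> the two points have the same \<open>x\<close>-coordinate, so \<open>S\<close> and \<open>T\<close> become
  the denominator and the numerator of the duplication formula, which have no common zero at a
  nonsingular point.\<close>

lemma sum_prod_primitive:
  fixes l :: int
  assumes l: "prime l"
    and P: "on_curve E (Pt x1 y1)" "nonsing_red E l (Pt x1 y1)" "denom_form x1 y1 A B D"
    and Q: "coprime A' D'"
  defines "\<Delta> \<equiv> A * D'^2 - A' * D^2"
  defines "S \<equiv> 2 * A * A' * (A * D'^2 + A' * D^2) + b2 E * A * A' * D^2 * D'^2
       + b4 E * (A * D'^2 + A' * D^2) * D^2 * D'^2 + b6 E * D^4 * D'^4"
  defines "T \<equiv> A^2 * A'^2 - b4 E * A * A' * D^2 * D'^2 - b6 E * (A * D'^2 + A' * D^2) * D^2 * D'^2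
       - b8 E * D^4 * D'^4"
  shows "\<not> (l dvd \<Delta>^2 \<and> l dvd S \<and> l dvd T)"
proof
  assume "l dvd \<Delta>^2 \<and> l dvd S \<and> l dvd T"
  then have dv: "l dvd \<Delta>" "l dvd S" "l dvd T"
    using l prime_dvd_power by blast+
  have D: "D > 0" "x1 = of_int A / of_int D ^ 2" "y1 = of_int B / of_int D ^ 3" "coprime A D"
    using P by (auto simp: denom_form_def)
  have cop: "\<not> (l dvd u \<and> l dvd v)" if "coprime u v" for u v
    using that l coprime_common_divisor not_prime_unit by blast
  have mult: "l dvd u * v \<longleftrightarrow> l dvd u \<or> l dvd v" for u v
    using l by (rule prime_dvd_mult_iff)
  have pow: "l dvd u ^ k \<Longrightarrow> l dvd u" for u k
    using l prime_dvd_power by blast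
  show False
  proof (cases "l dvd D")
    case True
    \<comment> \<open>At a prime dividing \<open>D\<close> both points reduce to the point at
      infinity: \<open>\<Delta>\<close> puts the prime into \<open>D'\<close>, and then
      \<open>T\<close> is congruent to the square of \<open>A * A'\<close>, which is prime to
      it.\<close>
    have "A * D'^2 = \<Delta> + A' * D^2" by (simp add: \<Delta>_def)
    also have "l dvd \<dots>" using dv(1) True by (simp add: power2_eq_square)
    finally have "l dvd D'" using cop[OF D(4)] True pow by (auto simp: mult)
    have "A^2 * A'^2 = T + D * (D * D'^2 * (b4 E * A * A' + b6 E * (A * D'^2 + A' * D^2) + b8 E * D^2 * D'^2))"
      by (simp add: T_def algebra_simps power2_eq_square power4_eq_xxxx)
    also have "l dvd \<dots>" using dv(3) True by simp
    finally have "l dvd A \<or> l dvd A'" using pow by (auto simp: mult)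
    then show False using cop[OF D(4)] cop[OF Q] True \<open>l dvd D'\<close> by blast
  next
    case False
    have nD': "\<not> l dvd D'"
    proof
      assume h: "l dvd D'"
      have "A' * D^2 = A * D'^2 - \<Delta>" by (simp add: \<Delta>_def)
      also have "l dvd \<dots>" using dv(1) h by (simp add: power2_eq_square)
      finally have "l dvd A'" using False pow by (auto simp: mult)
      then show False using cop[OF Q] h by blast
    qed
    \<comment> \<open>The partial derivatives at the first point with denominators cleared:
      \<open>psi\<close> is D^3 times the one in y, and \<open>N\<close> is -D^4 times the one in
      x.\<close>
    define psi where "psi = 2 * B + a1 E * A * D + a3 E * D^3"
    define N where "N = 3 * A^2 + 2 * a2 E * A * D^2 + a4 E * D^4 - a1 E * B * D"
    have curve: "B^2 + a1 E * A * B * D + a3 E * B * D^3 = A^3 + a2 E * A^2 * D^2 + a4 E * A * D^4 + a6 E * D^6"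
    proof -
      have "y1^2 + of_int (a1 E) * x1 * y1 + of_int (a3 E) * y1
         = x1^3 + of_int (a2 E) * x1^2 + of_int (a4 E) * x1 + of_int (a6 E)"
        using P(1) by (simp add: on_curve_def)
      then have "(y1^2 + of_int (a1 E) * x1 * y1 + of_int (a3 E) * y1) * of_int D ^ 6
         = (x1^3 + of_int (a2 E) * x1^2 + of_int (a4 E) * x1 + of_int (a6 E)) * of_int D ^ 6"
        by simp
      moreover have "(y1^2 + of_int (a1 E) * x1 * y1 + of_int (a3 E) * y1) * of_int D ^ 6
         = of_int (B^2 + a1 E * A * B * D + a3 E * B * D^3)"
        unfolding D(2,3) using D(1) by (simp add: field_simps eval_nat_numeral)
      moreover have "(x1^3 + of_int (a2 E) * x1^2 + of_int (a4 E) * x1 + of_int (a6 E)) * of_int D ^ 6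
         = of_int (A^3 + a2 E * A^2 * D^2 + a4 E * A * D^4 + a6 E * D^6)"
        unfolding D(2) using D(1) by (simp add: field_simps eval_nat_numeral)
      ultimately show ?thesis by (simp only: of_int_eq_iff)
    qed
    have Bsq: "B^2 = A^3 + a2 E * A^2 * D^2 + a4 E * A * D^4 + a6 E * D^6 - a1 E * A * B * D - a3 E * B * D^3"
      using curve by simp
    have a6: "a6 E * D^6 = B^2 + a1 E * A * B * D + a3 E * B * D^3 - A^3 - a2 E * A^2 * D^2 - a4 E * A * D^4"
      using curve by simp
    have "l dvd psi"
    proof -
      have AD: "A' * D^2 = A * D'^2 - \<Delta>" by (simp add: \<Delta>_def)
      \<comment> \<open>Modulo \<open>\<Delta>\<close> the two abscissae coincide; substituting for
        \<open>X\<close> eliminates \<open>A'\<close> and turns \<open>S\<close> into a unit times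
        the square of \<open>psi\<close>.\<close>
      define X where "X = A' * D^2"
      have "D^4 * S = 2 * A * X * D^2 * (A * D'^2 + X) + b2 E * A * X * D^4 * D'^2
         + b4 E * (A * D'^2 + X) * D^6 * D'^2 + b6 E * D^8 * D'^4"
        unfolding S_def X_def by (simp add: algebra_simps eval_nat_numeral)
      also have "X = A * D'^2 - \<Delta>" unfolding X_def by (rule AD)
      finally have "D^4 * S = D'^4 * D^2 * (4 * A^3 + b2 E * A^2 * D^2 + 2 * b4 E * A * D^4 + b6 E * D^6)
         + \<Delta> * (- 2 * A * D^2 * (2 * A * D'^2 - \<Delta>) - 2 * A * A * D'^2 * D^2 - b2 E * A * D^4 * D'^2 - b4 E * D^6 * D'^2)"
        by (simp add: algebra_simps eval_nat_numeral)
      moreover have "4 * A^3 + b2 E * A^2 * D^2 + 2 * b4 E * A * D^4 + b6 E * D^6 = psi^2"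
      proof -
        have "psi^2 = 4 * B^2 + 4 * B * (a1 E * A * D + a3 E * D^3) + (a1 E * A * D + a3 E * D^3)^2"
          unfolding psi_def by (simp add: algebra_simps power2_eq_square)
        then show ?thesis
          unfolding Bsq by (simp add: b2_def b4_def b6_def algebra_simps eval_nat_numeral)
      qed
      ultimately have "D^4 * S = D'^4 * D^2 * psi^2
         + \<Delta> * (- 2 * A * D^2 * (2 * A * D'^2 - \<Delta>) - 2 * A * A * D'^2 * D^2 - b2 E * A * D^4 * D'^2 - b4 E * D^6 * D'^2)"
        by simp
      then have "D'^4 * D^2 * psi^2 = D^4 * S
         - \<Delta> * (- 2 * A * D^2 * (2 * A * D'^2 - \<Delta>) - 2 * A * A * D'^2 * D^2 - b2 E * A * D^4 * D'^2 - b4 E * D^6 * D'^2)"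
        by simp
      also have "l dvd \<dots>" using dv by (intro dvd_diff dvd_mult dvd_mult2)
      finally show ?thesis using False nD' pow by (auto simp: mult)
    qed
    moreover have "l dvd N"
    proof -
      define X where "X = A' * D^2"
      have AD: "X = A * D'^2 - \<Delta>" by (simp add: \<Delta>_def X_def)
      have "D^4 * T = A^2 * X^2 - b4 E * A * X * D^4 * D'^2 - b6 E * (A * D'^2 + X) * D^6 * D'^2 - b8 E * D^8 * D'^4"
        unfolding T_def X_def by (simp add: algebra_simps eval_nat_numeral)
      also have "\<dots> = D'^4 * (A^4 - b4 E * A^2 * D^4 - 2 * b6 E * A * D^6 - b8 E * D^8)
         + \<Delta> * (A^2 * (\<Delta> - 2 * A * D'^2) + b4 E * A * D^4 * D'^2 + b6 E * D^6 * D'^2)"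
        unfolding AD by (simp add: algebra_simps eval_nat_numeral)
      \<comment> \<open>The quartic is the numerator of the duplication formula. With tangent slope
        \<open>N\<close> over \<open>psi\<close> (up to a power of \<open>D\<close>), the formula
        for the abscissa of 2P shows that it is \<open>N^2\<close> modulo
        \<open>psi\<close>.\<close>
      also have "A^4 - b4 E * A^2 * D^4 - 2 * b6 E * A * D^6 - b8 E * D^8 =
          N^2 + psi * (a1 E * N * D - (a2 E * D^2 + 2 * A) * psi)"
      proof -
        have "A^4 - b4 E * A^2 * D^4 - 2 * b6 E * A * D^6 - b8 E * D^8 =
          A^4 - (2 * a4 E + a1 E * a3 E) * A^2 * D^4 - 2 * a3 E^2 * A * D^6 - 8 * A * (a6 E * D^6)
          - D^2 * ((a1 E^2 + 4 * a2 E) * (a6 E * D^6)) - D^8 * (- a1 E * a3 E * a4 E + a2 E * a3 E^2 - a4 E^2)"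
          by (simp add: b4_def b6_def b8_def algebra_simps eval_nat_numeral)
        also have "\<dots> = N^2 + psi * (a1 E * N * D - (a2 E * D^2 + 2 * A) * psi)"
          unfolding a6 N_def psi_def by (simp add: algebra_simps eval_nat_numeral)
        finally show ?thesis .
      qed
      finally have "D'^4 * N^2 = D^4 * T - \<Delta> * (A^2 * (\<Delta> - 2 * A * D'^2) + b4 E * A * D^4 * D'^2 + b6 E * D^6 * D'^2)
         - psi * (D'^4 * (a1 E * N * D - (a2 E * D^2 + 2 * A) * psi))"
        by (simp add: algebra_simps)
      also have "l dvd \<dots>"
        using dv \<open>l dvd psi\<close> by (intro dvd_diff) auto
      finally show ?thesis using nD' pow by (auto simp: mult)
    qed
    moreover have "of_int (a1 E) * y1 - 3 * x1^2 - 2 * of_int (a2 E) * x1 - of_int (a4 E) = of_int (- N) / of_int (D^4)"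
      unfolding D(2,3) N_def using D(1) by (simp add: field_simps eval_nat_numeral)
    moreover have "2 * y1 + of_int (a1 E) * x1 + of_int (a3 E) = of_int psi / of_int (D^3)"
      unfolding D(2,3) psi_def using D(1) by (simp add: field_simps eval_nat_numeral)
    moreover have nd: "\<not> l dvd D ^ k" for k using False pow by blast
    ultimately have "l_max l (of_int (a1 E) * y1 - 3 * x1^2 - 2 * of_int (a2 E) * x1 - of_int (a4 E))"
      "l_max l (2 * y1 + of_int (a1 E) * x1 + of_int (a3 E))"
      unfolding l_max_def by (metis dvd_minus_iff)+
    moreover have "l_integral l x1" "l_integral l y1"
      unfolding l_integral_iff[OF l] using D(2,3) nd by (metis of_int_power)+
    ultimately show False using P(2) nonsing_red_iff[OF l] by blast
  qed
qed

text \<open>The projective point with coordinates 1, sum and product of the abscissae of P+Q and P-Q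
  has two integral representatives. One comes from the addition formulas and begins with
  \<open>\<Delta>^2\<close>, the other from reduced fractions and begins with
  \<open>(d * d')^2\<close>. Good reduction makes the first primitive, so the leading entries
  agree.\<close>

theorem edenom_parallelogram:
  assumes P: "on_curve E (Pt x1 y1)" "\<And>l. prime l \<Longrightarrow> nonsing_red E l (Pt x1 y1)"
    and Q: "on_curve E (Pt x2 y2)"
    and ne: "x1 \<noteq> x2"
    and plus: "eadd E (Pt x1 y1) (Pt x2 y2) = Pt xp yp" "on_curve E (Pt xp yp)"
    and minus: "eadd E (Pt x1 y1) (eneg E (Pt x2 y2)) = Pt xm ym" "on_curve E (Pt xm ym)"
  shows "of_int (edenom (Pt xp yp) * edenom (Pt xm ym)) =
    of_int (edenom (Pt x1 y1) ^ 2 * edenom (Pt x2 y2) ^ 2) * \<bar>x1 - x2\<bar>"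
proof -
  obtain A B D where f1: "denom_form x1 y1 A B D" using denom_form_exists[OF P(1)] by blast
  obtain A' B' D' where f2: "denom_form x2 y2 A' B' D'" using denom_form_exists[OF Q(1)] by blast
  obtain a b d where fp: "denom_form xp yp a b d" using denom_form_exists[OF plus(2)] by blast
  obtain a' b' d' where fm: "denom_form xm ym a' b' d'" using denom_form_exists[OF minus(2)] by blast
  note ff = f1 f2 fp fm
  have pos: "D > 0" "D' > 0" "d > 0" "d' > 0" using ff by (auto simp: denom_form_def)
  have xs: "x1 = of_int A / of_int D ^ 2" "x2 = of_int A' / of_int D' ^ 2"
    "xp = of_int a / of_int d ^ 2" "xm = of_int a' / of_int d' ^ 2"
    using ff by (auto simp: denom_form_def)
  have cop: "coprime A D" "coprime A' D'" "coprime a d" "coprime a' d'"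
    using ff by (auto simp: denom_form_def)
  define A1 A2 A3 A4 A6 where Ai: "A1 = (of_int (a1 E) :: rat)" "A2 = (of_int (a2 E) :: rat)"
    "A3 = (of_int (a3 E) :: rat)" "A4 = (of_int (a4 E) :: rat)" "A6 = (of_int (a6 E) :: rat)"
  have C1: "y1^2 + A1 * x1 * y1 + A3 * y1 = x1^3 + A2 * x1^2 + A4 * x1 + A6"
    and C2: "y2^2 + A1 * x2 * y2 + A3 * y2 = x2^3 + A2 * x2^2 + A4 * x2 + A6"
    using P Q by (simp_all add: on_curve_def Ai)
  define lam where "lam = (y2 - y1) / (x2 - x1)"
  define mu where "mu = ((- y2 - A1 * x2 - A3) - y1) / (x2 - x1)"
  have xp: "xp = lam^2 + A1 * lam - A2 - x1 - x2"
    using plus(1) ne by (auto simp: eadd_def Let_def lam_def Ai)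
  have xm: "xm = mu^2 + A1 * mu - A2 - x1 - x2"
    using minus(1) ne by (auto simp: eadd_def eneg_def Let_def mu_def Ai)
  have B: "of_int (b2 E) = A1^2 + 4 * A2" "of_int (b4 E) = 2 * A4 + A1 * A3" "of_int (b6 E) = A3^2 + 4 * A6"
    "of_int (b8 E) = A1^2 * A6 + 4 * A2 * A6 - A1 * A3 * A4 + A2 * A3^2 - A4^2"
    by (simp_all add: b2_def b4_def b6_def b8_def Ai)
  have sum: "(x1 - x2)^2 * (xp + xm) = 2 * x1 * x2 * (x1 + x2) + of_int (b2 E) * x1 * x2
       + of_int (b4 E) * (x1 + x2) + of_int (b6 E)"
    unfolding B xp xm lam_def mu_def by (rule chord_sum_prod(1)[OF C1 C2 ne])
  have prod: "(x1 - x2)^2 * (xp * xm) = x1^2 * x2^2 - of_int (b4 E) * x1 * x2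
       - of_int (b6 E) * (x1 + x2) - of_int (b8 E)"
    unfolding B xp xm lam_def mu_def by (rule chord_sum_prod(2)[OF C1 C2 ne])
  define \<Delta> where "\<Delta> = A * D'^2 - A' * D^2"
  define S where "S = 2 * A * A' * (A * D'^2 + A' * D^2) + b2 E * A * A' * D^2 * D'^2
       + b4 E * (A * D'^2 + A' * D^2) * D^2 * D'^2 + b6 E * D^4 * D'^4"
  define T where "T = A^2 * A'^2 - b4 E * A * A' * D^2 * D'^2 - b6 E * (A * D'^2 + A' * D^2) * D^2 * D'^2
       - b8 E * D^4 * D'^4"
  define k where "k = of_int (D^4 * D'^4) * (of_int (d^2 * d'^2) :: rat)"
  have diff: "x1 - x2 = of_int \<Delta> / of_int (D^2 * D'^2)"
    unfolding xs \<Delta>_def using pos by (simp add: field_simps)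
  have k1: "((x1 - x2)^2 * (xp + xm)) * k = of_int (\<Delta>^2 * (a * d'^2 + a' * d^2))"
    unfolding diff k_def xs(3,4) using pos by (simp add: field_simps eval_nat_numeral)
  have k2: "((x1 - x2)^2 * (xp * xm)) * k = of_int (\<Delta>^2 * (a * a'))"
    unfolding diff k_def xs(3,4) using pos by (simp add: field_simps eval_nat_numeral)
  have k3: "(2 * x1 * x2 * (x1 + x2) + of_int (b2 E) * x1 * x2
       + of_int (b4 E) * (x1 + x2) + of_int (b6 E)) * k = of_int ((d * d')^2 * S)"
    unfolding k_def xs(1,2) S_def using pos by (simp add: field_simps eval_nat_numeral)
  have k4: "(x1^2 * x2^2 - of_int (b4 E) * x1 * x2
       - of_int (b6 E) * (x1 + x2) - of_int (b8 E)) * k = of_int ((d * d')^2 * T)"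
    unfolding k_def xs(1,2) T_def using pos by (simp add: field_simps eval_nat_numeral)
  have e1: "\<Delta>^2 * (a * d'^2 + a' * d^2) = (d * d')^2 * S"
    using k1 k3 unfolding sum by (simp only: of_int_eq_iff)
  have e2: "\<Delta>^2 * (a * a') = (d * d')^2 * T"
    using k2 k4 unfolding prod by (simp only: of_int_eq_iff)
  have "\<Delta>^2 = (d * d')^2"
  proof (rule primitive_triple_unique[OF _ _ e1 e2])
    show "\<not> (l dvd \<Delta>^2 \<and> l dvd S \<and> l dvd T)" if l: "prime l" for l
      unfolding \<Delta>_def S_def T_def by (rule sum_prod_primitive[OF l P(1) P(2)[OF l] f1 cop(2)])
    show "\<not> (l dvd (d * d')^2 \<and> l dvd a * d'^2 + a' * d^2 \<and> l dvd a * a')" if l: "prime l" for l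
    proof
      assume "l dvd (d * d')^2 \<and> l dvd a * d'^2 + a' * d^2 \<and> l dvd a * a'"
      then have h: "l dvd d \<or> l dvd d'" "l dvd a * d'^2 + a' * d^2" "l dvd a \<or> l dvd a'"
        using l prime_dvd_power[of l] prime_dvd_mult_iff[of l] by blast+
      have c: "\<not> (l dvd u \<and> l dvd v)" if "coprime u v" for u v
        using that l coprime_common_divisor not_prime_unit by blast
      \<comment> \<open>The middle entry forces a prime in one denominator into the other; then both
        numerators are prime to it, against the third entry.\<close>
      have "l dvd d \<longleftrightarrow> l dvd d'"
      proof
        assume "l dvd d"
        then have "l dvd a * d'^2"
          using h(2) by (simp add: dvd_add_left_iff power2_eq_square)
        moreover have "\<not> l dvd a" using c[OF cop(3)] \<open>l dvd d\<close> by blast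
        ultimately show "l dvd d'"
          using l prime_dvd_power[of l] prime_dvd_mult_iff[of l] by blast
      next
        assume "l dvd d'"
        then have "l dvd a' * d^2"
          using h(2) by (simp add: dvd_add_right_iff power2_eq_square)
        moreover have "\<not> l dvd a'" using c[OF cop(4)] \<open>l dvd d'\<close> by blast
        ultimately show "l dvd d"
          using l prime_dvd_power[of l] prime_dvd_mult_iff[of l] by blast
      qed
      then show False using h c[OF cop(3)] c[OF cop(4)] by blast
    qed
  qed auto
  then have "\<bar>\<Delta>\<bar> = \<bar>d * d'\<bar>" by (metis power2_eq_iff abs_minus_cancel)
  then have "d * d' = \<bar>\<Delta>\<bar>" using pos by simp
  moreover have "of_int (D^2 * D'^2) * \<bar>x1 - x2\<bar> = of_int \<bar>\<Delta>\<bar>"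
    unfolding diff using pos by (simp add: abs_divide abs_mult)
  ultimately show ?thesis
    unfolding ff[THEN denom_form_edenom] by simp
qed

section \<open>The uniformization is a homomorphism\<close>

text \<open>The differential equation is put into the locale with its constant in terms of
  \<open>c6\<close>; \<open>ode_from_point\<close> provides it.\<close>

locale uniformized_curve = period_lattice +
  fixes E :: wcurve
  assumes g2_eq: "g2 (lattice w1 w2) = of_int (c4 E) / 12"
    and ode: "\<And>z. z \<notin> L \<Longrightarrow> wp' z ^ 2 = 4 * \<wp> z ^ 3 - g2 L * \<wp> z - of_int (c6 E) / 216"

context period_lattice
begin

lemma corresponds_Pt:
  "corresponds E L z (Pt x y) \<longleftrightarrow> z \<notin> L \<and> \<wp> z = of_rat x + of_int (b2 E) / 12 \<and>
     wp' z = 2 * of_rat y + of_int (a1 E) * of_rat x + of_int (a3 E)"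
proof (cases "z \<in> L")
  case False
  have "deriv \<wp> z = wp' z" using local_derivs(2)[OF False] by (rule DERIV_imp_deriv)
  then show ?thesis using False by (auto simp: corresponds_def)
qed (simp add: corresponds_def)

lemma corresponds_Inf: "corresponds E L z Inf \<longleftrightarrow> z \<in> L"
  by (simp add: corresponds_def)

text \<open>In the coordinates X = x + b2/12 and Y = 2y + a1 x + a3 the curve reads Y^2 = 4X^3 -
  (c4/12) X - c6/216. A single affine point therefore determines the constant of integration of
  \<open>wp_ode\<close>.\<close>

lemma ode_from_point:
  assumes g2: "g2 L = of_int (c4 E) / 12" and c: "on_curve E (Pt x y)" and z0: "corresponds E L z0 (Pt x y)"
    and z: "z \<notin> L"
  shows "wp' z ^ 2 = 4 * \<wp> z ^ 3 - g2 L * \<wp> z - of_int (c6 E) / 216"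
proof -
  obtain C where C: "\<And>z. z \<notin> L \<Longrightarrow> wp' z ^ 2 = 4 * \<wp> z ^ 3 - g2 L * \<wp> z - C"
    using wp_ode by blast
  define X Y A1 A2 A3 A4 A6 where A: "X = (of_rat x :: complex)" "Y = (of_rat y :: complex)"
    "A1 = (of_int (a1 E) :: complex)" "A2 = (of_int (a2 E) :: complex)"
    "A3 = (of_int (a3 E) :: complex)" "A4 = (of_int (a4 E) :: complex)" "A6 = (of_int (a6 E) :: complex)"
  have "y^2 + of_int (a1 E) * x * y + of_int (a3 E) * y = x^3 + of_int (a2 E) * x^2 + of_int (a4 E) * x + of_int (a6 E)"
    using c by (simp add: on_curve_def)
  then have "(of_rat (y^2 + of_int (a1 E) * x * y + of_int (a3 E) * y) :: complex)
     = of_rat (x^3 + of_int (a2 E) * x^2 + of_int (a4 E) * x + of_int (a6 E))"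
    by (rule arg_cong)
  then have cv: "Y^2 + A1 * X * Y + A3 * Y = X^3 + A2 * X^2 + A4 * X + A6"
    by (simp add: of_rat_add of_rat_mult of_rat_power A)
  have B: "of_int (b2 E) = A1^2 + 4 * A2" "of_int (c4 E) = (A1^2 + 4 * A2)^2 - 24 * (2 * A4 + A1 * A3)"
    "of_int (c6 E) = - ((A1^2 + 4 * A2)^3) + 36 * (A1^2 + 4 * A2) * (2 * A4 + A1 * A3) - 216 * (A3^2 + 4 * A6)"
    by (simp_all add: c4_def c6_def b2_def b4_def b6_def A)
  have zz: "z0 \<notin> L" and p: "\<wp> z0 = X + (A1^2 + 4 * A2) / 12" and p': "wp' z0 = 2 * Y + A1 * X + A3"
    using z0 by (simp_all add: corresponds_Pt B A)
  have "C = 4 * \<wp> z0 ^ 3 - g2 L * \<wp> z0 - wp' z0 ^ 2" using C[OF zz] by simp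
  also have "wp' z0 ^ 2 = 4 * (Y^2 + A1 * X * Y + A3 * Y) + (A1 * X + A3)^2"
    unfolding p' by (simp add: algebra_simps power2_eq_square)
  also have "\<dots> = 4 * (X^3 + A2 * X^2 + A4 * X + A6) + (A1 * X + A3)^2"
    unfolding cv ..
  also have "4 * \<wp> z0 ^ 3 - g2 L * \<wp> z0 - (4 * (X^3 + A2 * X^2 + A4 * X + A6) + (A1 * X + A3)^2) = of_int (c6 E) / 216"
    unfolding p g2 B by (simp add: field_simps power2_eq_square power3_eq_cube)
  finally show ?thesis using C[OF z] by simp
qed

end

context uniformized_curve
begin

lemma corresponds_on_curve:
  assumes "corresponds E L z P"
  shows "on_curve E P"
proof (cases P)
  case (Pt x y)
  define X Y A1 A2 A3 A4 A6 where A: "X = (of_rat x :: complex)" "Y = (of_rat y :: complex)"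
    "A1 = (of_int (a1 E) :: complex)" "A2 = (of_int (a2 E) :: complex)"
    "A3 = (of_int (a3 E) :: complex)" "A4 = (of_int (a4 E) :: complex)" "A6 = (of_int (a6 E) :: complex)"
  have B: "of_int (b2 E) = A1^2 + 4 * A2" "of_int (c4 E) = (A1^2 + 4 * A2)^2 - 24 * (2 * A4 + A1 * A3)"
    "of_int (c6 E) = - ((A1^2 + 4 * A2)^3) + 36 * (A1^2 + 4 * A2) * (2 * A4 + A1 * A3) - 216 * (A3^2 + 4 * A6)"
    by (simp_all add: c4_def c6_def b2_def b4_def b6_def A)
  have zz: "z \<notin> L" and p: "\<wp> z = X + (A1^2 + 4 * A2) / 12" and p': "wp' z = 2 * Y + A1 * X + A3"
    using assms by (simp_all add: Pt corresponds_Pt B A)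
  have "4 * (Y^2 + A1 * X * Y + A3 * Y) + (A1 * X + A3)^2 = wp' z ^ 2"
    unfolding p' by (simp add: algebra_simps power2_eq_square)
  also have "\<dots> = 4 * \<wp> z ^ 3 - g2 L * \<wp> z - of_int (c6 E) / 216" by (rule ode[OF zz])
  also have "\<dots> = 4 * (X^3 + A2 * X^2 + A4 * X + A6) + (A1 * X + A3)^2"
    unfolding p g2_eq B by (simp add: field_simps power2_eq_square power3_eq_cube)
  finally have cv: "Y^2 + A1 * X * Y + A3 * Y = X^3 + A2 * X^2 + A4 * X + A6"
    by (simp only: add_right_cancel mult_cancel_left) simp
  have "(of_rat (y^2 + of_int (a1 E) * x * y + of_int (a3 E) * y) :: complex)
     = of_rat (x^3 + of_int (a2 E) * x^2 + of_int (a4 E) * x + of_int (a6 E))"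
    using cv by (simp add: of_rat_add of_rat_mult of_rat_power A)
  then have "y^2 + of_int (a1 E) * x * y + of_int (a3 E) * y = x^3 + of_int (a2 E) * x^2 + of_int (a4 E) * x + of_int (a6 E)"
    by (simp only: of_rat_eq_iff)
  then show ?thesis by (simp add: on_curve_def Pt)
qed (simp add: on_curve_def)

lemma corresponds_unique:
  assumes "corresponds E L z P" "corresponds E L z Q"
  shows "P = Q"
proof (cases P; cases Q)
  fix x y x' y' assume PQ: "P = Pt x y" "Q = Pt x' y'"
  then have "(of_rat x :: complex) = of_rat x'"
    using assms by (simp add: corresponds_Pt)
  then have x: "x = x'" by simp
  then have "(of_rat y :: complex) = of_rat y'"
    using assms PQ by (simp add: corresponds_Pt)
  with x PQ show ?thesis by simp
qed (use assms in \<open>auto simp: corresponds_Pt corresponds_Inf\<close>)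

lemma corresponds_eneg:
  assumes "corresponds E L z P"
  shows "corresponds E L (- z) (eneg E P)"
proof (cases P)
  case (Pt x y)
  then show ?thesis
    using assms by (simp add: eneg_def corresponds_Pt wp_even wp'_odd of_rat_diff of_rat_minus of_rat_mult)
qed (use assms in \<open>simp add: eneg_def corresponds_Inf\<close>)

lemma corresponds_shift:
  assumes "corresponds E L z P" "\<omega> \<in> L"
  shows "corresponds E L (z + \<omega>) P"
proof (cases P)
  case Inf
  then show ?thesis using assms L_add by (simp add: corresponds_Inf)
next
  case (Pt x y)
  then have "z \<notin> L" using assms by (simp add: corresponds_Pt)
  then show ?thesis
    using assms(1) unfolding Pt corresponds_Pt wp_periodic[OF assms(2) \<open>z \<notin> L\<close>] wp'_periodic[OF assms(2)]
      L_add_iff[OF assms(2)] by blast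
qed

text \<open>The branches of \<open>eadd\<close> are matched with conditions on the lattice: equal
  abscissae mean that \<open>z + w\<close> or \<open>z - w\<close> is a period, and the branch
  \<open>Inf\<close> means that \<open>z + w\<close> is one. The other two branches are the addition
  and duplication theorems after the change of coordinates.\<close>

lemma corresponds_eadd:
  assumes zP: "corresponds E L z P" and wQ: "corresponds E L w Q"
  shows "corresponds E L (z + w) (eadd E P Q)"
proof (cases P)
  case Inf
  then have "z \<in> L" using zP by (simp add: corresponds_Inf)
  then show ?thesis
    using corresponds_shift[OF wQ, of z] Inf by (simp add: eadd_def add.commute)
next
  case P: (Pt x1 y1)
  show ?thesis
  proof (cases Q)
    case Inf
    then have "w \<in> L" using wQ by (simp add: corresponds_Inf)
    then show ?thesis
      using corresponds_shift[OF zP, of w] Inf P by (simp add: eadd_def)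
  next
    case Q: (Pt x2 y2)
    define A1 A2 A3 A4 where A: "A1 = (of_int (a1 E) :: complex)" "A2 = (of_int (a2 E) :: complex)"
      "A3 = (of_int (a3 E) :: complex)" "A4 = (of_int (a4 E) :: complex)"
    have B2: "of_int (b2 E) = A1^2 + 4 * A2" and C4: "of_int (c4 E) = (A1^2 + 4 * A2)^2 - 24 * (2 * A4 + A1 * A3)"
      by (simp_all add: c4_def b2_def b4_def A)
    have z: "z \<notin> L" and pz: "\<wp> z = of_rat x1 + (A1^2 + 4 * A2) / 12" and pz': "wp' z = 2 * of_rat y1 + A1 * of_rat x1 + A3"
      using zP by (simp_all add: P corresponds_Pt B2 A)
    have w: "w \<notin> L" and pw: "\<wp> w = of_rat x2 + (A1^2 + 4 * A2) / 12" and pw': "wp' w = 2 * of_rat y2 + A1 * of_rat x2 + A3"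
      using wQ by (simp_all add: Q corresponds_Pt B2 A)
    have peq: "x1 = x2 \<longleftrightarrow> z + w \<in> L \<or> z - w \<in> L"
      using wp_eq_iff[OF z w] by (simp add: pz pw)
    have same: "wp' z = wp' w" if "z - w \<in> L"
      using wp'_periodic[OF that, of w] by simp
    have opp: "wp' z = - wp' w" if "z + w \<in> L"
      using wp'_periodic[OF that, of "- w"] wp'_odd[OF w] by simp
    \<comment> \<open>A point of order two: there \<open>z - w\<close> being a period does not keep
      \<open>z + w\<close> from being one, and the zero of \<open>wp'\<close> detects this through
      \<open>sigma_double\<close>.\<close>
    have dbl: "z + w \<in> L" if "z - w \<in> L" "wp' z = 0"
    proof -
      have "\<sigma> (2 * z) = 0" using sigma_double[OF z] that by simp
      then have "2 * z \<in> L" by (simp only: sigma_eq_0_iff)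
      then have "2 * z - (z - w) \<in> L" using that by (intro L_diff[of "2 * z"])
      then show ?thesis by (simp add: algebra_simps)
    qed
    have sum: "wp' z + wp' w = 2 * of_rat (y1 + y2 + of_int (a1 E) * x2 + of_int (a3 E))" if "x1 = x2"
      unfolding pz' pw' using that by (simp add: of_rat_add of_rat_mult A)
    have inf: "x1 = x2 \<and> y1 + y2 + of_int (a1 E) * x2 + of_int (a3 E) = 0 \<longleftrightarrow> z + w \<in> L"
    proof
      assume h: "x1 = x2 \<and> y1 + y2 + of_int (a1 E) * x2 + of_int (a3 E) = 0"
      then have s0: "wp' z + wp' w = 0" using sum by simp
      show "z + w \<in> L"
      proof (rule ccontr)
        assume n: "z + w \<notin> L"
        then have d: "z - w \<in> L" using peq h by blast
        then have "2 * wp' z = 0" using same s0 by simp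
        then show False using dbl[OF d] n by simp
      qed
    next
      assume h: "z + w \<in> L"
      then have "x1 = x2" using peq by blast
      moreover have "wp' z + wp' w = 0" using opp[OF h] by simp
      ultimately show "x1 = x2 \<and> y1 + y2 + of_int (a1 E) * x2 + of_int (a3 E) = 0"
        using sum by simp
    qed
    show ?thesis
    proof (cases "z + w \<in> L")
      case True
      then have "eadd E P Q = Inf"
        using inf by (simp add: P Q eadd_def)
      then show ?thesis using True by (simp add: corresponds_Inf)
    next
      case False
      then obtain x3 y3 where R: "eadd E P Q = Pt x3 y3"
        using inf by (auto simp: P Q eadd_def Let_def)
      obtain lam nu where line: "y1 = lam * x1 + nu" "y2 = lam * x2 + nu"
        and x3: "x3 = lam ^ 2 + of_int (a1 E) * lam - of_int (a2 E) - x1 - x2"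
        and y3: "y3 = - (lam * x3 + nu) - of_int (a1 E) * x3 - of_int (a3 E)"
        and chord: "x1 \<noteq> x2 \<Longrightarrow> lam = (y2 - y1) / (x2 - x1)"
        and tangent: "x1 = x2 \<Longrightarrow> lam * (2 * y1 + of_int (a1 E) * x1 + of_int (a3 E))
          = 3 * x1^2 + 2 * of_int (a2 E) * x1 + of_int (a4 E) - of_int (a1 E) * y1"
        using eadd_line[of E x1 y1 x2 y2 x3 y3] corresponds_on_curve[OF zP] corresponds_on_curve[OF wQ] R
        unfolding P Q by metis
      define X1 Y1 X2 Y2 X3 Y3 Lm Nu where cx: "X1 = (of_rat x1 :: complex)" "Y1 = (of_rat y1 :: complex)"
        "X2 = (of_rat x2 :: complex)" "Y2 = (of_rat y2 :: complex)" "X3 = (of_rat x3 :: complex)" "Y3 = (of_rat y3 :: complex)"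
        "Lm = (of_rat lam :: complex)" "Nu = (of_rat nu :: complex)"
      have cY1: "Y1 = Lm * X1 + Nu" using line by (simp add: cx of_rat_add of_rat_mult)
      have cX3: "X3 = Lm^2 + A1 * Lm - A2 - X1 - X2"
        using x3 by (simp add: cx A of_rat_add of_rat_mult of_rat_diff of_rat_power)
      have cY3: "Y3 = - (Lm * X3 + Nu) - A1 * X3 - A3"
        using y3 by (simp add: cx A of_rat_add of_rat_mult of_rat_diff of_rat_minus del: minus_add_distrib)
      \<comment> \<open>Half the slope in the coordinates \<open>\<wp>\<close>, \<open>wp'\<close>.
        Chord and tangent give the same two formulas, so the computation of the third point is done
        once for both.\<close>
      obtain m where m: "m = Lm + A1 / 2" "\<wp> (z + w) = m^2 - \<wp> z - \<wp> w"
        "wp' (z + w) = 2 * m * (\<wp> z - \<wp> (z + w)) - wp' z"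
      proof (cases "x1 = x2")
        case True
        then have d: "z - w \<in> L" using peq False by blast
        have "2 * z = (z + w) + (z - w)" by simp
        then have e: "\<wp> (2 * z) = \<wp> (z + w)" "wp' (2 * z) = wp' (z + w)" "2 * z \<notin> L"
          using wp_periodic[OF d False] wp'_periodic[OF d, of "z + w"] L_add_iff[OF d, of "z + w"] False by metis+
        note dd = wp_double[OF ode z e(3)]
        have pp: "\<wp> w = \<wp> z" unfolding pz pw True ..
        have "wp'' z / (2 * wp' z) = Lm + A1 / 2"
        proof -
          have "(of_rat (lam * (2 * y1 + of_int (a1 E) * x1 + of_int (a3 E))) :: complex)
            = of_rat (3 * x1^2 + 2 * of_int (a2 E) * x1 + of_int (a4 E) - of_int (a1 E) * y1)"
            using tangent[OF True] by (rule arg_cong)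
          then have t: "Lm * (2 * Y1 + A1 * X1 + A3) = 3 * X1^2 + 2 * A2 * X1 + A4 - A1 * Y1"
            by (simp add: cx A of_rat_add of_rat_mult of_rat_diff of_rat_power)
          have "wp'' z = 6 * (X1 + (A1^2 + 4 * A2) / 12)^2 - ((A1^2 + 4 * A2)^2 - 24 * (2 * A4 + A1 * A3)) / 12 / 2"
            unfolding wp''_eq[OF z] g2_eq C4 pz cx ..
          also have "\<dots> = 2 * (3 * X1^2 + 2 * A2 * X1 + A4 - A1 * Y1) + A1 * (2 * Y1 + A1 * X1 + A3)"
            by (simp add: field_simps power2_eq_square)
          also have "\<dots> = (Lm + A1 / 2) * (2 * (2 * Y1 + A1 * X1 + A3))"
            unfolding t[symmetric] by (simp add: algebra_simps)
          finally have "wp'' z = (Lm + A1 / 2) * (2 * wp' z)" unfolding pz' cx .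
          then show ?thesis using dd(1) by simp
        qed
        then show ?thesis
          using that[of "wp'' z / (2 * wp' z)"] dd(2,3) unfolding e pp by (simp add: algebra_simps)
      next
        case ne: False
        then have n: "z - w \<notin> L" using peq by blast
        have sl: "slope z w = Lm + A1 / 2"
        proof -
          have xx: "X1 - X2 \<noteq> 0" using ne by (simp add: cx)
          have "Lm = (Y2 - Y1) / (X2 - X1)"
            using chord[OF ne] by (simp add: cx of_rat_divide of_rat_diff)
          also have "\<dots> = (Y1 - Y2) / (X1 - X2)" by (metis minus_diff_eq minus_divide_divide)
          finally have l: "Y1 - Y2 = Lm * (X1 - X2)" using xx by simp
          have "wp' z - wp' w = 2 * (Y1 - Y2) + A1 * (X1 - X2)"
            unfolding pz' pw' by (simp add: cx algebra_simps)
          also have "\<dots> = (Lm + A1 / 2) * (2 * (X1 - X2))"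
            unfolding l by (simp add: algebra_simps)
          finally have "wp' z - wp' w = (Lm + A1 / 2) * (2 * (X1 - X2))" .
          moreover have "\<wp> z - \<wp> w = X1 - X2" unfolding pz pw cx by simp
          ultimately show ?thesis unfolding slope_def using xx by simp
        qed
        show ?thesis
          using that[OF sl] wp_add[OF ode z w False n] wp'_add[OF ode z w False n] by simp
      qed
      have e1: "\<wp> (z + w) = X3 + (A1^2 + 4 * A2) / 12"
        unfolding m(2) unfolding m(1) pz pw cX3 cx(1)[symmetric] cx(3)[symmetric]
        by (simp add: field_simps power2_eq_square)
      have "wp' (z + w) = 2 * Y3 + A1 * X3 + A3"
        unfolding m(3) unfolding m(1) e1 pz pz' cY3 cx(1)[symmetric] cx(2)[symmetric] cY1
        by (simp add: field_simps)
      with e1 False show ?thesis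
        unfolding R corresponds_Pt by (simp add: B2 cx A)
    qed
  qed
qed

lemma corresponds_zmul:
  assumes "corresponds E L z P"
  shows "corresponds E L (of_int k * z) (zmul E k P)"
proof -
  have n: "corresponds E L (of_nat m * z) (nmul E m P)" for m
  proof (induction m)
    case (Suc m)
    then show ?case
      using corresponds_eadd[OF Suc assms] by (simp add: algebra_simps)
  qed (simp add: corresponds_Inf)
  show ?thesis
  proof (cases "k \<ge> 0")
    case True
    then show ?thesis using n[of "nat k"] by (simp add: zmul_def)
  next
    case False
    then show ?thesis using corresponds_eneg[OF n[of "nat (- k)"]] by (simp add: zmul_def)
  qed
qed

lemma corresponds_lincomb:
  assumes "\<forall>i<n. corresponds E L (z i) (P i)"
  shows "corresponds E L (\<Sum>i<n. of_int (v i) * z i) (lincomb E n v P)"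
  using assms
proof (induction n)
  case (Suc n)
  then show ?case by (simp add: corresponds_eadd corresponds_zmul)
qed (simp add: corresponds_Inf)

text \<open>That the intermediate sums lie on the curve, as \<open>nonsing_red_eadd\<close> demands,
  is taken from their correspondence with complex parameters and not from the algebra of
  \<open>eadd\<close>.\<close>

lemma nonsing_red_lincomb:
  assumes l: "prime (l::int)" and "\<forall>i<n. corresponds E L (z i) (P i)" "\<forall>i<n. nonsing_red E l (P i)"
  shows "nonsing_red E l (lincomb E n v P)"
  using assms(2,3)
proof (induction n)
  case (Suc n)
  have zc: "corresponds E L (of_int k * z n) (zmul E k (P n))" for k
    using Suc.prems by (intro corresponds_zmul) auto
  have nm: "nonsing_red E l (nmul E m (P n))" for m
  proof (induction m)
    case (Suc k)
    have "on_curve E (nmul E k (P n))"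
      using corresponds_on_curve[OF zc[of "int k"]] by (simp add: zmul_def)
    then show ?case
      using Suc Suc.prems \<open>\<forall>i<Suc n. nonsing_red E l (P i)\<close> corresponds_on_curve[of "z n" "P n"]
        \<open>\<forall>i<Suc n. corresponds E L (z i) (P i)\<close>
      by (simp add: nonsing_red_eadd[OF l])
  qed (simp add: nonsing_red_def)
  have "nonsing_red E l (zmul E (v n) (P n))"
    by (simp add: zmul_def nm nonsing_red_eneg[OF l])
  moreover have "on_curve E (lincomb E n v P)"
    using Suc.prems by (intro corresponds_on_curve[OF corresponds_lincomb[of n z]]) auto
  moreover have "on_curve E (zmul E (v n) (P n))"
    by (rule corresponds_on_curve[OF zc])
  ultimately show ?case
    using Suc by (simp add: nonsing_red_eadd[OF l])
qed (simp add: nonsing_red_def)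

end

section \<open>Nets and the parallelogram law\<close>

lemma Zn_add: "p \<in> Zn n \<Longrightarrow> q \<in> Zn n \<Longrightarrow> p + q \<in> Zn n"
  by (simp add: Zn_def)

lemma Zn_diff: "p \<in> Zn n \<Longrightarrow> q \<in> Zn n \<Longrightarrow> p - q \<in> Zn n"
  by (simp add: Zn_def)

lemma Zn_uminus: "p \<in> Zn n \<Longrightarrow> - p \<in> Zn n"
  by (simp add: Zn_def)

lemma Zn_0: "0 \<in> Zn n"
  by (simp add: Zn_def)

lemmas Zn_intros = Zn_add Zn_diff Zn_uminus Zn_0

definition ind :: "nat set \<Rightarrow> nat \<Rightarrow> int" where
  "ind A = (\<lambda>i. if i \<in> A then 1 else 0)"

lemma ind_Zn: "A \<subseteq> {..<n} \<Longrightarrow> ind A \<in> Zn n"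
  by (auto simp: ind_def Zn_def)

lemma fun_neq: "f i \<noteq> g i \<Longrightarrow> f \<noteq> g"
  by auto

lemma Reals_mult_cancel:
  fixes a b :: complex
  assumes "a * b \<in> \<real>" "b \<in> \<real>" "b \<noteq> 0"
  shows "a \<in> \<real>"
proof -
  have "a = (a * b) / b" using assms by simp
  also have "\<dots> \<in> \<real>" using assms by (intro Reals_divide)
  finally show ?thesis .
qed

text \<open>The parallelogram law alone does not force the values at vectors with three odd entries to
  be real (it admits a sign \<open>(-1) ^ (v i * v j * v k)\<close> in the squares); this is where the full net relation is needed.\<close>

lemma net_values_real:
  fixes \<Psi> :: "(nat \<Rightarrow> int) \<Rightarrow> complex"
  assumes net: "\<And>p q r s. p \<in> Zn n \<Longrightarrow> q \<in> Zn n \<Longrightarrow> r \<in> Zn n \<Longrightarrow> s \<in> Zn n \<Longrightarrow>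
        \<Psi> (p + q + s) * \<Psi> (p - q) * \<Psi> (r + s) * \<Psi> r
      + \<Psi> (q + r + s) * \<Psi> (q - r) * \<Psi> (p + s) * \<Psi> p
      + \<Psi> (r + p + s) * \<Psi> (r - p) * \<Psi> (q + s) * \<Psi> q = 0"
    and zero: "\<And>v. v \<in> Zn n \<Longrightarrow> \<Psi> v = 0 \<longleftrightarrow> v = 0"
    and par: "\<And>p q. p \<in> Zn n \<Longrightarrow> q \<in> Zn n \<Longrightarrow> p \<noteq> 0 \<Longrightarrow> q \<noteq> 0 \<Longrightarrow>
        \<exists>x\<in>\<real>. \<Psi> (p + q) * \<Psi> (p - q) = \<Psi> p ^ 2 * \<Psi> q ^ 2 * x"
    and dbl: "\<And>p. p \<in> Zn n \<Longrightarrow> p \<noteq> 0 \<Longrightarrow> \<Psi> p \<in> \<real> \<Longrightarrow> \<Psi> (p + p) \<in> \<real>"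
    and odd: "\<And>p. \<Psi> (- p) = - \<Psi> p"
    and one: "\<And>i. i < n \<Longrightarrow> \<Psi> (ind {i}) \<in> \<real>"
    and two: "\<And>i j. i < n \<Longrightarrow> j < n \<Longrightarrow> i \<noteq> j \<Longrightarrow> \<Psi> (ind {i, j}) \<in> \<real>"
    and v: "v \<in> Zn n"
  shows "\<Psi> v \<in> \<real>"
proof -
  have par': "\<Psi> (p + q) * \<Psi> (p - q) \<in> \<real>"
    if "p \<in> Zn n" "q \<in> Zn n" "p \<noteq> 0" "q \<noteq> 0" "\<Psi> p \<in> \<real>" "\<Psi> q \<in> \<real>" for p q
  proof -
    note h = that
    obtain x where "x \<in> \<real>" "\<Psi> (p + q) * \<Psi> (p - q) = \<Psi> p ^ 2 * \<Psi> q ^ 2 * x"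
      using par[OF h(1-4)] by blast
    then show ?thesis using h(5,6) by (simp only: Reals_mult Reals_power)
  qed
  have diff: "\<Psi> (p - q) \<in> \<real>"
    if "p \<in> Zn n" "q \<in> Zn n" "p \<noteq> 0" "q \<noteq> 0" "\<Psi> p \<in> \<real>" "\<Psi> q \<in> \<real>" "\<Psi> (p + q) \<in> \<real>" "p + q \<noteq> 0" for p q
  proof (rule Reals_mult_cancel)
    show "\<Psi> (p - q) * \<Psi> (p + q) \<in> \<real>" using par'[OF that(1-6)] by (simp add: mult.commute)
    show "\<Psi> (p + q) \<noteq> 0" using that zero[of "p + q"] by (auto intro: Zn_add)
  qed fact
  have indic: "\<Psi> (ind A) \<in> \<real>" if "A \<subseteq> {..<n}" for A
    using that
  proof (induction "card A" arbitrary: A rule: less_induct)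
    case less
    have fin: "finite A" using less.prems finite_subset by blast
    consider "card A = 0" | "card A = 1" | "card A = 2" | "card A \<ge> 3" by linarith
    then show ?case
    proof cases
      case 1
      then have "ind A = 0" using fin by (simp add: ind_def fun_eq_iff)
      then show ?thesis using zero[of 0] by (simp add: Zn_0)
    next
      case 2
      then obtain i where "A = {i}" by (auto simp: card_1_singleton_iff)
      then show ?thesis using one less.prems by auto
    next
      case 3
      then obtain i j where "A = {i, j}" "i \<noteq> j" by (auto simp: card_2_iff)
      then show ?thesis using two less.prems by auto
    next
      case 4
      obtain i where i: "i \<in> A" using 4 fin by (metis card.empty ex_in_conv not_numeral_le_zero)
      have c1: "card (A - {i}) \<ge> 2" using 4 fin i by simp
      obtain j where j: "j \<in> A - {i}" using c1 fin by (metis card.empty ex_in_conv not_numeral_le_zero)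
      define C where "C = A - {i, j}"
      have "card C \<ge> 1" using 4 fin i j by (simp add: C_def card_Diff_subset)
      then obtain k where k: "k \<in> C" using fin by (metis card.empty ex_in_conv not_one_le_zero)
      \<comment> \<open>Two unit vectors and the remainder: every partial sum of the three other
        than the full one has smaller support and is covered by the induction hypothesis or the base
        cases.\<close>
      define a b c where abc: "a = ind {i}" "b = ind {j}" "c = ind C"
      have AC: "A = insert i (insert j C)" "i \<notin> C" "j \<notin> C" "i \<noteq> j"
        using i j by (auto simp: C_def)
      have k': "k \<noteq> i" "k \<noteq> j" using k AC by auto
      have Z: "a \<in> Zn n" "b \<in> Zn n" "c \<in> Zn n"
        unfolding abc using less.prems i j by (auto intro!: ind_Zn simp: C_def)
      have s: "a + b = ind {i, j}" "a + c = ind (insert i C)" "b + c = ind (insert j C)" "a + b + c = ind A"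
        using AC by (auto simp: abc ind_def fun_eq_iff)
      have r: "\<Psi> a \<in> \<real>" "\<Psi> b \<in> \<real>" "\<Psi> (a + b) \<in> \<real>"
      proof -
        show "\<Psi> a \<in> \<real>" "\<Psi> b \<in> \<real>" unfolding abc using one less.prems i j by auto
        show "\<Psi> (a + b) \<in> \<real>" unfolding s using two less.prems i j by auto
      qed
      have cc: "card C < card A" "card (insert i C) < card A" "card (insert j C) < card A"
      proof -
        have "finite C" using fin by (simp add: C_def)
        then have "card A = card C + 2" using AC by simp
        then show "card C < card A" "card (insert i C) < card A" "card (insert j C) < card A"
          using AC \<open>finite C\<close> by auto
      qed
      have r': "\<Psi> c \<in> \<real>" "\<Psi> (a + c) \<in> \<real>" "\<Psi> (b + c) \<in> \<real>"
      proof -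
        show "\<Psi> c \<in> \<real>" unfolding abc using less.hyps[OF cc(1)] less.prems AC by auto
        show "\<Psi> (a + c) \<in> \<real>" unfolding s using less.hyps[OF cc(2)] less.prems AC by auto
        show "\<Psi> (b + c) \<in> \<real>" unfolding s using less.hyps[OF cc(3)] less.prems AC by auto
      qed
      have vals: "a i = 1" "b i = 0" "c i = 0" "a j = 0" "b j = 1" "c j = 0" "a k = 0" "b k = 0" "c k = 1"
        using AC k k' by (auto simp: abc ind_def)
      have nz: "a \<noteq> 0" "b \<noteq> 0" "c \<noteq> 0" "a + b \<noteq> 0" "a + c \<noteq> 0" "b + c \<noteq> 0" "a + b - c \<noteq> 0" "a + c - b \<noteq> 0" "b - c \<noteq> 0" "a + a \<noteq> 0"
        by (rule fun_neq[of _ i], simp add: vals; fail | rule fun_neq[of _ j], simp add: vals; fail | rule fun_neq[of _ k], simp add: vals)+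
      define X where "X = \<Psi> (a + b + c)"
      have XA: "X * \<Psi> (a + b - c) \<in> \<real>"
        unfolding X_def using Z nz r r' by (intro par') (auto intro!: Zn_intros)
      have XB: "X * \<Psi> (a + c - b) \<in> \<real>"
      proof -
        have "\<Psi> (a + c + b) * \<Psi> (a + c - b) \<in> \<real>"
          using Z nz r r' by (intro par') (auto intro!: Zn_intros)
        then show ?thesis by (simp add: X_def add_ac)
      qed
      have XY: "X * \<Psi> (b + c - a) \<in> \<real>"
      proof -
        have "\<Psi> (b + c + a) * \<Psi> (b + c - a) \<in> \<real>"
          using Z nz r r' by (intro par') (auto intro!: Zn_intros)
        then show ?thesis by (simp add: X_def add_ac)
      qed
      have bc: "\<Psi> (b - c) \<in> \<real>" using Z nz r r' by (intro diff)
      have ab: "\<Psi> (a - b) \<in> \<real>" using Z nz r r' by (intro diff)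
      have ca: "\<Psi> (c - a) \<in> \<real>" using Z nz r r' by (intro diff) (simp_all add: add.commute)
      have AB: "\<Psi> (a + b - c) * \<Psi> (a + c - b) \<in> \<real>"
      proof -
        have "\<Psi> (a + (b - c)) * \<Psi> (a - (b - c)) \<in> \<real>"
          using Z nz r bc by (intro par') (auto intro!: Zn_intros)
        then show ?thesis by (simp add: algebra_simps)
      qed
      have AB0: "\<Psi> (a + b - c) * \<Psi> (a + c - b) \<noteq> 0"
        using nz zero Z by (simp add: Zn_intros)
      \<comment> \<open>The parallelogram relations give reality of \<open>X\<close> times each of
        two nonzero values and of the product of these values, hence of \<open>X ^ 2\<close> but not
        yet of \<open>X\<close>.\<close>
      have X2: "X ^ 2 \<in> \<real>"
      proof (rule Reals_mult_cancel[OF _ AB AB0])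
        have "X\<^sup>2 * (\<Psi> (a + b - c) * \<Psi> (a + c - b)) = (X * \<Psi> (a + b - c)) * (X * \<Psi> (a + c - b))"
          by (simp add: power2_eq_square mult_ac)
        also have "\<dots> \<in> \<real>" using XA XB by (rule Reals_mult)
        finally show "X\<^sup>2 * (\<Psi> (a + b - c) * \<Psi> (a + c - b)) \<in> \<real>" .
      qed
      define r3 where "r3 = \<Psi> c * \<Psi> (a + a) * \<Psi> (b + c) * \<Psi> b"
      have n0: "\<Psi> c \<noteq> 0" "\<Psi> (a + a) \<noteq> 0" "\<Psi> (b + c) \<noteq> 0" "\<Psi> b \<noteq> 0"
        using zero[OF Z(3)] zero[OF Zn_add[OF Z(1) Z(1)]] zero[OF Zn_add[OF Z(2,3)]] zero[OF Z(2)] nz by blast+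
      have r3: "r3 \<in> \<real>" "r3 \<noteq> 0"
        unfolding r3_def by (intro Reals_mult r r' dbl[OF Z(1) nz(1)]) (simp only: mult_eq_0_iff n0 simp_thms)
      \<comment> \<open>The net relation for p = a, q = b, r = -a, s = c is chosen so that one term
        is free of unknown values and nonzero. Multiplied by \<open>X\<close>, the other two involve
        only \<open>X ^ 2\<close> and \<open>X * \<Psi> (b + c - a)\<close>, both real.\<close>
      have "\<Psi> (a + b + c) * \<Psi> (a - b) * \<Psi> (- a + c) * \<Psi> (- a)
        + \<Psi> (b + - a + c) * \<Psi> (b - - a) * \<Psi> (a + c) * \<Psi> a
        + \<Psi> (- a + a + c) * \<Psi> (- a - a) * \<Psi> (b + c) * \<Psi> b = 0"
        using Z by (intro net Zn_intros)
      moreover have "- a + c = c - a" "b + - a + c = b + c - a" "b - - a = a + b" "- a + a + c = c" "- a - a = - (a + a)"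
        by (simp_all add: algebra_simps)
      ultimately have rel: "X * \<Psi> (a - b) * \<Psi> (c - a) * (- \<Psi> a) + \<Psi> (b + c - a) * \<Psi> (a + b) * \<Psi> (a + c) * \<Psi> a
        + \<Psi> c * (- \<Psi> (a + a)) * \<Psi> (b + c) * \<Psi> b = 0"
        by (simp only: odd X_def)
      have "X * r3 = X ^ 2 * (\<Psi> (a - b) * \<Psi> (c - a) * (- \<Psi> a)) + (X * \<Psi> (b + c - a)) * (\<Psi> (a + b) * \<Psi> (a + c) * \<Psi> a)"
      proof -
        have "X ^ 2 * (\<Psi> (a - b) * \<Psi> (c - a) * (- \<Psi> a)) + (X * \<Psi> (b + c - a)) * (\<Psi> (a + b) * \<Psi> (a + c) * \<Psi> a) - X * r3
          = X * (X * \<Psi> (a - b) * \<Psi> (c - a) * (- \<Psi> a) + \<Psi> (b + c - a) * \<Psi> (a + b) * \<Psi> (a + c) * \<Psi> a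
        + \<Psi> c * (- \<Psi> (a + a)) * \<Psi> (b + c) * \<Psi> b)"
          by (simp add: r3_def algebra_simps power2_eq_square)
        then show ?thesis unfolding rel by simp
      qed
      also have "\<dots> \<in> \<real>"
        by (intro Reals_add Reals_mult[OF X2] Reals_mult[OF XY] Reals_mult[OF Reals_mult] Reals_minus ab ca r r')
      finally have "X \<in> \<real>" using r3 by (rule Reals_mult_cancel)
      then show ?thesis by (simp add: X_def s(4))
    qed
  qed
  \<comment> \<open>The weight |2x - 1| is least exactly at the entries 0 and 1, so descent by unit
    vectors ends at the vectors \<open>ind A\<close>.\<close>
  show ?thesis
    using v
  proof (induction "\<Sum>i<n. nat \<bar>2 * v i - 1\<bar>" arbitrary: v rule: less_induct)
    case less
    note v = less.prems
    have smaller: "(\<Sum>i<n. nat \<bar>2 * u i - 1\<bar>) < (\<Sum>i<n. nat \<bar>2 * v i - 1\<bar>)"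
      if "i < n" "\<bar>2 * u i - 1\<bar> < \<bar>2 * v i - 1\<bar>" "\<And>j. j \<noteq> i \<Longrightarrow> u j = v j" for u i
    proof (rule sum_strict_mono_ex1)
      show "\<forall>j\<in>{..<n}. nat \<bar>2 * u j - 1\<bar> \<le> nat \<bar>2 * v j - 1\<bar>"
        using that by (metis less_imp_le nat_mono order_refl)
      have "nat \<bar>2 * u i - 1\<bar> < nat \<bar>2 * v i - 1\<bar>" using that(2) by linarith
      then show "\<exists>j\<in>{..<n}. nat \<bar>2 * u j - 1\<bar> < nat \<bar>2 * v j - 1\<bar>" using that(1) by blast
    qed simp
    show ?case
    proof (cases "\<exists>i<n. v i \<noteq> 0 \<and> v i \<noteq> 1")
      case False
      define A where "A = {i. i < n \<and> v i = 1}"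
      have vA: "v = ind A"
        using v False unfolding ind_def A_def Zn_def mem_Collect_eq by (metis linorder_not_le)
      show ?thesis unfolding vA by (rule indic) (auto simp: A_def)
    next
      case True
      then obtain i where i: "i < n" "v i \<noteq> 0" "v i \<noteq> 1" by blast
      define e where "e = ind {i}"
      have e: "e \<in> Zn n" "\<Psi> e \<in> \<real>" "e \<noteq> 0" "e i = 1" "\<And>j. j \<noteq> i \<Longrightarrow> e j = 0"
      proof -
        show "e \<in> Zn n" unfolding e_def using i by (intro ind_Zn) auto
        show "\<Psi> e \<in> \<real>" unfolding e_def by (rule one[OF i(1)])
        show "e \<noteq> 0" by (rule fun_neq[of _ i]) (simp add: e_def ind_def)
      qed (auto simp: e_def ind_def)
      have step: "\<Psi> x \<in> \<real>" if "x \<in> Zn n" "\<bar>2 * x i - 1\<bar> < \<bar>2 * v i - 1\<bar>" "\<And>j. j \<noteq> i \<Longrightarrow> x j = v j" for x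
        using less.hyps[OF smaller[OF i(1) that(2,3)] that(1)] by blast
      show ?thesis
      proof (cases "v i \<ge> 2")
        case True
        define u where "u = v - e"
        have u: "u \<in> Zn n" "\<Psi> u \<in> \<real>" "\<Psi> (u - e) \<in> \<real>" "u \<noteq> 0" "v = u + e" "u - e \<in> Zn n"
        proof -
          show Z: "u \<in> Zn n" "u - e \<in> Zn n" unfolding u_def by (intro Zn_intros v e)+
          have uv: "u i = v i - 1" "\<And>j. j \<noteq> i \<Longrightarrow> u j = v j" using e by (auto simp: u_def)
          show "\<Psi> u \<in> \<real>" using e True by (intro step Z) (auto simp: uv)
          show "\<Psi> (u - e) \<in> \<real>" using e True by (intro step Z) (auto simp: uv)
          show "u \<noteq> 0" using e True by (intro fun_neq[of _ i]) (simp add: uv)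
          show "v = u + e" by (simp add: u_def)
        qed
        show ?thesis
        proof (cases "u - e = 0")
          case True
          then have "u = e" by simp
          then show ?thesis using dbl[OF e(1,3,2)] u(5) by simp
        next
          case False
          then have "\<Psi> (u - e) \<noteq> 0" using zero[OF u(6)] by simp
          with par'[OF u(1) e(1) u(4) e(3) u(2) e(2)] u(3,5) show ?thesis
            using Reals_mult_cancel by blast
        qed
      next
        case False
        then have neg: "v i \<le> - 1" using i by linarith
        define u where "u = v + e"
        have u: "u \<in> Zn n" "\<Psi> u \<in> \<real>" "\<Psi> (u + e) \<in> \<real>" "v = u - e" "u + e \<in> Zn n"
        proof -
          show Z: "u \<in> Zn n" "u + e \<in> Zn n" unfolding u_def by (intro Zn_intros v e)+
          have uv: "u i = v i + 1" "\<And>j. j \<noteq> i \<Longrightarrow> u j = v j" using e by (auto simp: u_def)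
          show "\<Psi> u \<in> \<real>" using e neg by (intro step Z) (auto simp: uv)
          show "\<Psi> (u + e) \<in> \<real>" using e neg by (intro step Z) (auto simp: uv)
          show "v = u - e" by (simp add: u_def)
        qed
        consider "u = 0" | "u + e = 0" | "u \<noteq> 0" "u + e \<noteq> 0" by blast
        then show ?thesis
        proof cases
          case 1
          then have "v = - e" using u(4) by simp
          then show ?thesis using odd[of e] e by simp
        next
          case 2
          then have "v = - (e + e)" using u(4) by (simp add: eq_neg_iff_add_eq_0 add.commute)
          then show ?thesis using odd[of "e + e"] dbl[OF e(1,3,2)] by simp
        next
          case 3
          then have "\<Psi> (u + e) \<noteq> 0" using zero[OF u(5)] by simp
          moreover have "\<Psi> (u - e) * \<Psi> (u + e) \<in> \<real>"
            using par'[OF u(1) e(1) 3(1) e(3) u(2) e(2)] by (simp add: mult.commute)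
          ultimately show ?thesis
            using Reals_mult_cancel u(3,4) by blast
        qed
      qed
    qed
  qed
qed

text \<open>The right side is symmetric in \<open>p\<close>, \<open>q\<close>, \<open>r\<close>;
  hence the exponents attached to the three terms of the net relation coincide. The law makes
  \<open>\<phi>\<close> a quadratic function once the excluded pairs are filled in.\<close>

lemma parallelogram_net_sum:
  fixes \<phi> :: "(nat \<Rightarrow> int) \<Rightarrow> real"
  assumes zero: "\<phi> 0 = 0" and even: "\<And>p. p \<in> Zn n \<Longrightarrow> \<phi> (- p) = \<phi> p"
    and par: "\<And>p q. p \<in> Zn n \<Longrightarrow> q \<in> Zn n \<Longrightarrow> p \<noteq> 0 \<Longrightarrow> q \<noteq> 0 \<Longrightarrow> p + q \<noteq> 0 \<Longrightarrow> p - q \<noteq> 0 \<Longrightarrow>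
        \<phi> (p + q) + \<phi> (p - q) = 2 * \<phi> p + 2 * \<phi> q"
    and Z: "p \<in> Zn n" "q \<in> Zn n" "r \<in> Zn n" "s \<in> Zn n"
  shows "\<phi> (p + q + s) + \<phi> (p - q) + \<phi> (r + s) + \<phi> r =
    \<phi> (p + s) + \<phi> (q + s) + \<phi> (r + s) + \<phi> p + \<phi> q + \<phi> r - \<phi> s"
proof -
  have dbl: "\<phi> (p + p) = 4 * \<phi> p" if p: "p \<in> Zn n" "p \<noteq> 0" for p
  proof -
    obtain i where i: "p i \<noteq> 0" using p(2) by (auto simp: fun_eq_iff)
    \<comment> \<open>The law for the pairs (2p, p), (3p, p), (4p, p) and (3p, 2p) avoids all
      excluded cases. It yields two expressions for the value at 5p, and their equality determines
      the value at 2p.\<close>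
    define p2 p3 p4 p5 where pp: "p2 = p + p" "p3 = p2 + p" "p4 = p3 + p" "p5 = p4 + p"
    have v: "p2 i = 2 * p i" "p3 i = 3 * p i" "p4 i = 4 * p i" "p5 i = 5 * p i"
      by (simp_all add: pp)
    have nz: "p2 \<noteq> 0" "p3 \<noteq> 0" "p4 \<noteq> 0" "p5 \<noteq> 0"
      by (rule fun_neq[of _ i], use v i in simp)+
    have z: "p2 \<in> Zn n" "p3 \<in> Zn n" "p4 \<in> Zn n"
      unfolding pp by (intro Zn_intros p(1))+
    have e: "p2 - p = p" "p3 - p = p2" "p4 - p = p3" "p3 + p2 = p5" "p3 - p2 = p"
      by (simp_all add: pp)
    have "\<phi> p3 + \<phi> p = 2 * \<phi> p2 + 2 * \<phi> p" using par[OF z(1) p(1)] nz p e pp by simp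
    moreover have "\<phi> p4 + \<phi> p2 = 2 * \<phi> p3 + 2 * \<phi> p" using par[OF z(2) p(1)] nz p e pp by simp
    moreover have "\<phi> p5 + \<phi> p3 = 2 * \<phi> p4 + 2 * \<phi> p" using par[OF z(3) p(1)] nz p e pp by simp
    moreover have "\<phi> p5 + \<phi> p = 2 * \<phi> p3 + 2 * \<phi> p2" using par[OF z(2) z(1)] nz p e by simp
    ultimately have "\<phi> p2 = 4 * \<phi> p" by linarith
    then show ?thesis by (simp add: pp)
  qed
  have PL: "\<phi> (p + q) + \<phi> (p - q) = 2 * \<phi> p + 2 * \<phi> q" if p: "p \<in> Zn n" "q \<in> Zn n" for p q
  proof -
    consider "p = 0" | "q = 0" | "p \<noteq> 0" "p = q" | "p \<noteq> 0" "p = - q"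
      | "p \<noteq> 0" "q \<noteq> 0" "p + q \<noteq> 0" "p - q \<noteq> 0"
      by (metis eq_neg_iff_add_eq_0 right_minus_eq)
    then show ?thesis
    proof cases
      case 1 then show ?thesis using zero even[OF p(2)] by simp
    next
      case 2 then show ?thesis using zero by simp
    next
      case 3 then show ?thesis using zero dbl[OF p(1)] by simp
    next
      case 4
      have "p - q = p + p" using 4 by simp
      then show ?thesis using 4 zero dbl[OF p(1)] even[OF p(2)] by simp
    next
      case 5 then show ?thesis using par[OF p] by blast
    qed
  qed
  have three: "\<phi> (x + y + w) = \<phi> (x + y) + \<phi> (x + w) + \<phi> (y + w) - \<phi> x - \<phi> y - \<phi> w"
    if "x \<in> Zn n" "y \<in> Zn n" "w \<in> Zn n" for x y w
  proof -
    have "\<phi> (x + y + w) + \<phi> (x + y - w) = 2 * \<phi> (x + y) + 2 * \<phi> w"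
      using that by (intro PL Zn_intros)
    moreover have "\<phi> (x + (y - w)) + \<phi> (x - (y - w)) = 2 * \<phi> x + 2 * \<phi> (y - w)"
      using that by (intro PL Zn_intros)
    moreover have "\<phi> (x + w + y) + \<phi> (x + w - y) = 2 * \<phi> (x + w) + 2 * \<phi> y"
      using that by (intro PL Zn_intros)
    moreover have "\<phi> (y + w) + \<phi> (y - w) = 2 * \<phi> y + 2 * \<phi> w"
      using that by (intro PL)
    moreover have "x + (y - w) = x + y - w" "x - (y - w) = x + w - y" "x + w + y = x + y + w"
      by (simp_all add: algebra_simps)
    ultimately show ?thesis by simp
  qed
  show ?thesis
    using three[OF Z(1,2,4)] PL[OF Z(1,2)] by linarith
qed

section \<open>Net polynomials and the denominator net\<close>

lemma of_real_of_rat_complex: "complex_of_real (of_rat q) = of_rat q"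
  by (cases q) (simp add: of_rat_rat)

lemma of_rat_abs_real: "real_of_rat \<bar>q\<bar> = \<bar>real_of_rat q\<bar>"
  by (cases "q < 0") (simp_all add: abs_if of_rat_minus)

definition quad :: "nat \<Rightarrow> (nat \<Rightarrow> nat \<Rightarrow> complex) \<Rightarrow> (nat \<Rightarrow> int) \<Rightarrow> complex" where
  "quad n t v = (\<Sum>i<n. \<Sum>j<n. t i j * of_int (v i * v j))"

lemma quad_net:
  "quad n t (p + q + s) + quad n t (p - q) + quad n t (r + s) + quad n t r
   = quad n t (q + r + s) + quad n t (q - r) + quad n t (p + s) + quad n t p"
  unfolding quad_def sum.distrib[symmetric]
  by (intro sum.cong refl) (simp add: algebra_simps)

lemma quad_parallelogram:
  "quad n t (p + q) + quad n t (p - q) = 2 * quad n t p + 2 * quad n t q"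
  unfolding quad_def sum.distrib[symmetric] sum_distrib_left
  by (intro sum.cong refl) (simp add: algebra_simps)

lemma quad_double: "quad n t (p + p) = 4 * quad n t p"
  unfolding quad_def sum_distrib_left by (intro sum.cong refl) (simp add: algebra_simps)

lemma quad_uminus: "quad n t (- p) = quad n t p"
  by (simp add: quad_def)

context period_lattice
begin

text \<open>The constants raised to integer powers are nonzero, so each is the exponential of a
  logarithm, and integrality of the exponents makes the choice of branch immaterial. The leading
  minus sign is the -1 in the exponent of the sign factor.\<close>

lemma Psi_exp_form:
  fixes z :: "nat \<Rightarrow> complex"
  assumes nz: "\<And>i. i < n \<Longrightarrow> z i \<notin> L" "\<And>i j. i < j \<Longrightarrow> j < n \<Longrightarrow> z i + z j \<notin> L"
  shows "\<exists>t. \<forall>v. Psi L n z v = - (exp (quad n t v) * \<sigma> (\<Sum>i<n. of_int (v i) * z i))"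
proof -
  define c where "c = complex_of_real pi * \<i>"
  define ls where "ls = (\<lambda>i. Ln (\<sigma> (z i)))"
  define lp where "lp = (\<lambda>i j. Ln (\<sigma> (z i + z j)))"
  have c: "exp c = -1" by (simp add: c_def)
  have ls: "exp (ls i) = \<sigma> (z i)" if "i < n" for i
    using nz(1)[OF that] by (simp add: ls_def sigma_eq_0_iff)
  have lp: "exp (lp i j) = \<sigma> (z i + z j)" if "i < j" "j < n" for i j
    using nz(2)[OF that] by (simp add: lp_def sigma_eq_0_iff)
  \<comment> \<open>The diagonal holds the logarithm of -1 and the part \<open>2 * v i ^ 2\<close>,
    the full square the part \<open>v i * v j\<close> summed over all j, and the upper triangle the
    sign and the factors at \<open>z i + z j\<close>.\<close>
  define t where "t = (\<lambda>i j. (if i = j then c - 2 * ls i else 0) + ls i + (if i < j then - c - lp i j else 0))"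
  have "Psi L n z v = - (exp (quad n t v) * \<sigma> (\<Sum>i<n. of_int (v i) * z i))" for v
  proof -
    define q where "q = (\<Sum>i<n. v i ^ 2) - (\<Sum>i<n. \<Sum>j<n. if i < j then v i * v j else 0)"
    define a where "a = (\<Sum>i<n. of_int (2 * v i ^ 2 - (\<Sum>j<n. v i * v j)) * ls i)"
    define b where "b = (\<Sum>i<n. \<Sum>j<n. if i < j then of_int (v i * v j) * lp i j else 0)"
    have "(-1) powi (q - 1) = exp (of_int (q - 1) * c)"
      unfolding c[symmetric] by (rule exp_power_int)
    also have "\<dots> = exp (of_int q * c) / exp c"
      by (simp add: left_diff_distrib exp_diff)
    finally have s: "(-1) powi (q - 1) = - exp (of_int q * c)"
      by (simp add: c)
    have D1: "(\<Prod>i<n. \<sigma> (z i) powi (2 * v i ^ 2 - (\<Sum>j<n. v i * v j))) = exp a"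
      unfolding a_def exp_sum[OF finite_lessThan]
      by (intro prod.cong refl) (simp only: exp_power_int[symmetric] ls lessThan_iff)
    have D2: "(\<Prod>i<n. \<Prod>j<n. if i < j then \<sigma> (z i + z j) powi (v i * v j) else 1) = exp b"
      unfolding b_def exp_sum[OF finite_lessThan]
      by (intro prod.cong refl) (auto simp del: of_int_mult simp: exp_power_int[symmetric] lp)
    have "quad n t v = of_int q * c - a - b"
    proof -
      have "quad n t v = (\<Sum>i<n. \<Sum>j<n. (if i = j then (c - 2 * ls i) * of_int (v i * v j) else 0))
         + (\<Sum>i<n. \<Sum>j<n. ls i * of_int (v i * v j))
         + (\<Sum>i<n. \<Sum>j<n. (if i < j then (- c - lp i j) * of_int (v i * v j) else 0))"
        unfolding quad_def t_def sum.distrib[symmetric]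
        by (intro sum.cong refl) (auto simp: algebra_simps)
      also have "(\<Sum>i<n. \<Sum>j<n. (if i = j then (c - 2 * ls i) * of_int (v i * v j) else 0))
         = (\<Sum>i<n. (c - 2 * ls i) * of_int (v i * v i))"
        by (intro sum.cong refl) (simp add: sum.delta)
      also have "(\<Sum>i<n. \<Sum>j<n. (if i < j then (- c - lp i j) * of_int (v i * v j) else 0))
         = - (\<Sum>i<n. \<Sum>j<n. (if i < j then c * of_int (v i * v j) else 0)) - b"
        unfolding b_def sum_negf[symmetric] sum_subtractf[symmetric]
        by (intro sum.cong refl) (auto simp: algebra_simps)
      also have "(\<Sum>i<n. \<Sum>j<n. (if i < j then c * of_int (v i * v j) else 0))
         = c * of_int (\<Sum>i<n. \<Sum>j<n. if i < j then v i * v j else 0)"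
        unfolding of_int_sum sum_distrib_left by (intro sum.cong refl) auto
      also have "(\<Sum>i<n. (c - 2 * ls i) * of_int (v i * v i)) + (\<Sum>i<n. \<Sum>j<n. ls i * of_int (v i * v j))
          = c * of_int (\<Sum>i<n. v i ^ 2) - a"
        unfolding a_def of_int_sum sum_distrib_left sum_subtractf[symmetric] sum.distrib[symmetric]
        by (intro sum.cong refl) (simp add: algebra_simps power2_eq_square sum_distrib_left sum_distrib_right)
      finally show ?thesis
        by (simp add: q_def algebra_simps)
    qed
    then have "exp (quad n t v) = exp (of_int q * c) / (exp a * exp b)"
      by (simp add: exp_diff)
    then show ?thesis
      unfolding Psi_def q_def[symmetric] s D1 D2 by simp
  qed
  then show ?thesis by blast
qed

end

locale elliptic_points = uniformized_curve +
  fixes n :: nat and P :: "nat \<Rightarrow> ept" and z :: "nat \<Rightarrow> complex"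
  assumes corr: "\<forall>i<n. corresponds E L (z i) (P i)"
    and indep: "lin_indep E n P"
    and good: "\<And>l i. prime (l::int) \<Longrightarrow> i < n \<Longrightarrow> nonsing_red E l (P i)"
begin

definition zsum :: "(nat \<Rightarrow> int) \<Rightarrow> complex" where
  "zsum v = (\<Sum>i<n. of_int (v i) * z i)"

abbreviation pt :: "(nat \<Rightarrow> int) \<Rightarrow> ept" where "pt v \<equiv> lincomb E n v P"

abbreviation \<Psi> :: "(nat \<Rightarrow> int) \<Rightarrow> complex" where "\<Psi> v \<equiv> Psi L n z v"

lemma zsum_add: "zsum (p + q) = zsum p + zsum q"
  by (simp add: zsum_def sum.distrib algebra_simps)

lemma zsum_uminus: "zsum (- p) = - zsum p"
  by (simp add: zsum_def sum_negf)

lemma zsum_diff: "zsum (p - q) = zsum p - zsum q"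
  using zsum_add[of p "- q"] by (simp add: zsum_uminus)

lemma pt_corr: "corresponds E L (zsum v) (pt v)"
  unfolding zsum_def by (rule corresponds_lincomb[OF corr])

text \<open>Linear independence translated to the lattice: it makes the values of
  \<open>\<Psi>\<close> nonzero and keeps the arguments of \<open>\<wp>\<close> off its
  poles.\<close>

lemma zsum_in_L: "v \<in> Zn n \<Longrightarrow> zsum v \<in> L \<longleftrightarrow> v = 0"
proof
  assume v: "v \<in> Zn n" and "zsum v \<in> L"
  then have "pt v = Inf"
    using corresponds_unique[OF pt_corr, of v Inf] by (simp add: corresponds_Inf)
  then have "\<forall>i<n. v i = 0" using indep v by (auto simp: lin_indep_def)
  then have "v i = 0" for i
    using v by (cases "i < n") (auto simp: Zn_def)
  then show "v = 0" by (simp add: fun_eq_iff)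
qed (simp add: zsum_def)

lemma pt_add: "pt (p + q) = eadd E (pt p) (pt q)"
  using corresponds_unique[OF pt_corr[of "p + q"]] corresponds_eadd[OF pt_corr pt_corr, of p q]
  by (simp add: zsum_add)

lemma pt_diff: "pt (p - q) = eadd E (pt p) (eneg E (pt q))"
  using corresponds_unique[OF pt_corr[of "p - q"]] corresponds_eadd[OF pt_corr corresponds_eneg[OF pt_corr], of p q]
  by (simp add: zsum_diff)

lemma pt_uminus: "pt (- p) = eneg E (pt p)"
  using corresponds_unique[OF pt_corr[of "- p"]] corresponds_eneg[OF pt_corr, of p]
  by (simp add: zsum_uminus)

lemma pt_affine:
  assumes "v \<in> Zn n" "v \<noteq> 0"
  obtains x y where "pt v = Pt x y"
  using assms zsum_in_L[OF assms(1)] pt_corr[of v] by (cases "pt v") (auto simp: corresponds_Inf)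

lemma sum_ind: "A \<subseteq> {..<n} \<Longrightarrow> (\<Sum>i<n. ind A i) = int (card A)"
  by (simp add: ind_def sum.If_cases Int_absorb1)

lemma zsum_ind:
  assumes "A \<subseteq> {..<n}"
  shows "zsum (ind A) = (\<Sum>i\<in>A. z i)"
proof -
  have "zsum (ind A) = (\<Sum>i<n. if i \<in> A then z i else 0)"
    unfolding zsum_def by (intro sum.cong refl) (auto simp: ind_def)
  also have "\<dots> = (\<Sum>i\<in>{..<n} \<inter> A. z i)" by (simp add: sum.If_cases)
  finally show ?thesis using assms by (simp add: Int_absorb1)
qed

lemma sq_ind: "ind A i ^ 2 = ind A i" "(\<Sum>j<n. ind A i * ind A j) = ind A i * (\<Sum>j<n. ind A j)"
  by (simp_all add: ind_def sum_distrib_left)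

lemma z_not_L: 
  assumes "i < n" 
  shows "z i \<notin> L"
proof -
  have "zsum (ind {i}) \<notin> L"
    using assms zsum_in_L[OF ind_Zn[of "{i}"]] by (auto simp: ind_def fun_eq_iff)
  then show ?thesis using assms by (simp add: zsum_ind)
qed

lemma z_add_not_L: 
  assumes "i < j" "j < n" 
  shows "z i + z j \<notin> L"
proof -
  have "zsum (ind {i, j}) \<notin> L"
    using assms zsum_in_L[OF ind_Zn[of "{i, j}"]] by (auto simp: ind_def fun_eq_iff)
  then show ?thesis using assms by (simp add: zsum_ind)
qed

text \<open>The denominators of the net polynomials are designed for this normalisation. Together
  with \<open>Psi_pair\<close> it gives the starting values from which reality spreads.\<close>

lemma Psi_unit:
  assumes i: "i < n"
  shows "\<Psi> (ind {i}) = 1"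
proof -
  define v where "v = ind {i}"
  have "(\<Sum>i<n. v i ^ 2) = 1"
    unfolding v_def sq_ind using i by (simp add: sum_ind)
  moreover have "(\<Sum>i<n. \<Sum>j<n. if i < j then v i * v j else 0) = 0"
    by (intro sum.neutral ballI) (auto simp: v_def ind_def)
  moreover have "(\<Sum>i<n. of_int (v i) * z i) = z i"
    using zsum_ind[of "{i}"] i by (simp add: zsum_def v_def)
  moreover have "(\<Prod>k<n. \<sigma> (z k) powi (2 * v k ^ 2 - (\<Sum>j<n. v k * v j))) = \<sigma> (z i)"
  proof -
    have "(\<Prod>k<n. \<sigma> (z k) powi (2 * v k ^ 2 - (\<Sum>j<n. v k * v j))) = (\<Prod>k<n. if k = i then \<sigma> (z i) else 1)"
      using i by (intro prod.cong refl) (simp add: v_def sq_ind sum_ind, simp add: ind_def)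
    then show ?thesis using i by simp
  qed
  moreover have "(\<Prod>k<n. \<Prod>j<n. if k < j then \<sigma> (z k + z j) powi (v k * v j) else 1) = 1"
    by (intro prod.neutral ballI) (auto simp: v_def ind_def)
  ultimately show ?thesis
    unfolding v_def[symmetric] Psi_def using z_not_L[OF i] by (simp add: sigma_eq_0_iff)
qed

lemma Psi_pair:
  assumes i: "i < j" "j < n"
  shows "\<Psi> (ind {i, j}) = 1"
proof -
  define v where "v = ind {i, j}"
  have ij: "{i, j} \<subseteq> {..<n}" "card {i, j} = 2" using i by auto
  have "(\<Sum>i<n. v i ^ 2) = 2"
    unfolding v_def sq_ind using ij by (simp add: sum_ind)
  moreover have "(\<Sum>k<n. \<Sum>m<n. if k < m then v k * v m else 0) = 1"
  proof -
    have "(\<Sum>k<n. \<Sum>m<n. if k < m then v k * v m else 0) = (\<Sum>k<n. \<Sum>m<n. if m = j then (if k = i then 1 else 0) else 0)"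
      using i by (intro sum.cong refl) (auto simp: v_def ind_def)
    also have "\<dots> = 1" using i by simp
    finally show ?thesis .
  qed
  moreover have "(\<Sum>i<n. of_int (v i) * z i) = z i + z j"
    using zsum_ind[OF ij(1)] i by (simp add: zsum_def v_def)
  moreover have "(\<Prod>k<n. \<sigma> (z k) powi (2 * v k ^ 2 - (\<Sum>j<n. v k * v j))) = 1"
    using sum_ind[OF ij(1)] ij(2) by (intro prod.neutral ballI) (simp add: v_def sq_ind)
  moreover have "(\<Prod>k<n. \<Prod>m<n. if k < m then \<sigma> (z k + z m) powi (v k * v m) else 1) = \<sigma> (z i + z j)"
  proof -
    have "(\<Prod>k<n. \<Prod>m<n. if k < m then \<sigma> (z k + z m) powi (v k * v m) else 1)
      = (\<Prod>k<n. \<Prod>m<n. if m = j then (if k = i then \<sigma> (z i + z j) else 1) else 1)"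
      using i by (intro prod.cong refl) (auto simp: v_def ind_def)
    also have "\<dots> = \<sigma> (z i + z j)" using i by simp
    finally show ?thesis .
  qed
  ultimately show ?thesis
    unfolding v_def[symmetric] Psi_def using z_add_not_L[OF i] by (simp add: sigma_eq_0_iff)
qed

lemma Psi_quad: "\<exists>t. \<forall>v. \<Psi> v = - (exp (quad n t v) * \<sigma> (zsum v))"
  unfolding zsum_def by (rule Psi_exp_form[OF z_not_L z_add_not_L])

lemma Psi_eq_0_iff: "v \<in> Zn n \<Longrightarrow> \<Psi> v = 0 \<longleftrightarrow> v = 0"
proof -
  assume v: "v \<in> Zn n"
  obtain t where "\<And>v. \<Psi> v = - (exp (quad n t v) * \<sigma> (zsum v))" using Psi_quad by blast
  then show ?thesis using zsum_in_L[OF v] by (simp add: sigma_eq_0_iff)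
qed

lemma Psi_odd: "\<Psi> (- v) = - \<Psi> v"
proof -
  obtain t where "\<And>v. \<Psi> v = - (exp (quad n t v) * \<sigma> (zsum v))" using Psi_quad by blast
  then show ?thesis by (simp add: zsum_uminus sigma_odd quad_uminus)
qed

lemma Psi_net:
  "\<Psi> (p + q + s) * \<Psi> (p - q) * \<Psi> (r + s) * \<Psi> r
   + \<Psi> (q + r + s) * \<Psi> (q - r) * \<Psi> (p + s) * \<Psi> p
   + \<Psi> (r + p + s) * \<Psi> (r - p) * \<Psi> (q + s) * \<Psi> q = 0"
proof -
  obtain t where t: "\<And>v. \<Psi> v = - (exp (quad n t v) * \<sigma> (zsum v))" using Psi_quad by blast
  define K where "K = quad n t (p + q + s) + quad n t (p - q) + quad n t (r + s) + quad n t r"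
  have summand: "\<Psi> u * \<Psi> u' * \<Psi> w * \<Psi> w' = exp K * (\<sigma> (zsum u) * \<sigma> (zsum u') * \<sigma> (zsum w) * \<sigma> (zsum w'))"
    if "quad n t u + quad n t u' + quad n t w + quad n t w' = K" for u u' w w'
    unfolding t that[symmetric] exp_add by (simp only: minus_mult_minus mult_ac)
  have 1: "quad n t (p + q + s) + quad n t (p - q) + quad n t (r + s) + quad n t r = K"
    by (simp only: K_def)
  have 2: "quad n t (q + r + s) + quad n t (q - r) + quad n t (p + s) + quad n t p = K"
    unfolding K_def by (rule quad_net[symmetric])
  have 3: "quad n t (r + p + s) + quad n t (r - p) + quad n t (q + s) + quad n t q = K"
    unfolding 2[symmetric] by (rule quad_net[symmetric])
  \<comment> \<open>Shifting by half the parameter of \<open>s\<close> makes the net relation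
    symmetric: its twelve arguments become the sums and differences in
    \<open>sigma_three_term\<close>.\<close>
  define a b c d where abcd: "a = zsum p + zsum s / 2" "b = zsum q + zsum s / 2" "c = zsum r + zsum s / 2" "d = zsum s / 2"
  have e: "zsum (p + q + s) = a + b" "zsum (p - q) = a - b" "zsum (r + s) = c + d" "zsum r = c - d"
    "zsum (q + r + s) = b + c" "zsum (q - r) = b - c" "zsum (p + s) = a + d" "zsum p = a - d"
    "zsum (r + p + s) = c + a" "zsum (r - p) = c - a" "zsum (q + s) = b + d" "zsum q = b - d"
    by (simp_all add: zsum_add zsum_diff abcd)
  show ?thesis
    unfolding summand[OF 1] summand[OF 2] summand[OF 3] unfolding e distrib_left[symmetric]
    using sigma_three_term[of a b c d] by (simp only: mult_zero_right)
qed

lemma Psi_par: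
  assumes "zsum p \<notin> L" "zsum q \<notin> L"
  shows "\<Psi> (p + q) * \<Psi> (p - q) = \<Psi> p ^ 2 * \<Psi> q ^ 2 * (\<wp> (zsum q) - \<wp> (zsum p))"
proof -
  obtain t where t: "\<And>v. \<Psi> v = - (exp (quad n t v) * \<sigma> (zsum v))" using Psi_quad by blast
  have "\<Psi> (p + q) * \<Psi> (p - q) = exp (quad n t (p + q) + quad n t (p - q)) * (\<sigma> (zsum p + zsum q) * \<sigma> (zsum p - zsum q))"
    unfolding t exp_add zsum_add zsum_diff by simp
  also have "\<dots> = exp (2 * quad n t p + 2 * quad n t q) * - (\<sigma> (zsum p) ^ 2 * \<sigma> (zsum q) ^ 2 * (\<wp> (zsum p) - \<wp> (zsum q)))"
    unfolding quad_parallelogram sigma_wp[OF assms] ..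
  also have "exp (2 * quad n t p + 2 * quad n t q) = exp (quad n t p) ^ 2 * exp (quad n t q) ^ 2"
    by (simp add: exp_add exp_double)
  finally show ?thesis unfolding t by (simp add: power_mult_distrib algebra_simps)
qed

lemma Psi_dbl:
  assumes "zsum p \<notin> L"
  shows "\<Psi> (p + p) = \<Psi> p ^ 4 * wp' (zsum p)"
proof -
  obtain t where t: "\<And>v. \<Psi> v = - (exp (quad n t v) * \<sigma> (zsum v))" using Psi_quad by blast
  have "exp (4 * quad n t p) = exp (quad n t p) ^ 4"
    using exp_of_nat_mult[of 4 "quad n t p"] by simp
  moreover have "\<sigma> (zsum (p + p)) = - (wp' (zsum p) * \<sigma> (zsum p) ^ 4)"
    using sigma_double[OF assms] unfolding zsum_add mult_2 .
  ultimately show ?thesis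
    unfolding t quad_double by (simp add: power_mult_distrib)
qed

text \<open>In the differences of \<open>\<wp>\<close> the shift by b2/12 cancels, so they are
  rational at rational points, and so is \<open>wp'\<close>. The recurrences for
  \<open>\<Psi>\<close> thus have real coefficients.\<close>

lemma Psi_real:
  assumes v: "v \<in> Zn n"
  shows "\<Psi> v \<in> \<real>"
proof (rule net_values_real[where n = n])
  show "\<exists>x\<in>\<real>. \<Psi> (p + q) * \<Psi> (p - q) = \<Psi> p ^ 2 * \<Psi> q ^ 2 * x"
    if pq: "p \<in> Zn n" "q \<in> Zn n" "p \<noteq> 0" "q \<noteq> 0" for p q
  proof -
    obtain x y where x: "pt p = Pt x y" using pt_affine[OF pq(1,3)] .
    obtain x' y' where x': "pt q = Pt x' y'" using pt_affine[OF pq(2,4)] .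
    have "\<wp> (zsum q) - \<wp> (zsum p) = of_real (of_rat (x' - x))"
      using pt_corr[of p] pt_corr[of q] by (simp add: x x' corresponds_Pt of_rat_diff of_real_of_rat_complex)
    moreover have "zsum p \<notin> L" "zsum q \<notin> L" using zsum_in_L pq by auto
    ultimately show ?thesis
      using Psi_par[of p q] by (intro bexI[of _ "of_real (of_rat (x' - x))"]) auto
  qed
  show "\<Psi> (p + p) \<in> \<real>" if p: "p \<in> Zn n" "p \<noteq> 0" "\<Psi> p \<in> \<real>" for p
  proof -
    obtain x y where x: "pt p = Pt x y" using pt_affine[OF p(1,2)] .
    have "wp' (zsum p) = of_real (of_rat (2 * y + of_int (a1 E) * x + of_int (a3 E)))"
      using pt_corr[of p] by (simp add: x corresponds_Pt of_rat_add of_rat_mult of_real_of_rat_complex)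
    then have "wp' (zsum p) \<in> \<real>" by (simp only: Reals_of_real)
    moreover have nL: "zsum p \<notin> L" using zsum_in_L p by auto
    ultimately show ?thesis
      unfolding Psi_dbl[OF nL] using p(3) by (intro Reals_mult Reals_power)
  qed
  show "\<Psi> (ind {i, j}) \<in> \<real>" if "i < n" "j < n" "i \<noteq> j" for i j
    using that Psi_pair[of i j] Psi_pair[of j i] by (cases "i < j") (auto simp: insert_commute)
qed (rule Psi_net Psi_odd v | simp add: Psi_eq_0_iff Psi_unit)+

definition den :: "(nat \<Rightarrow> int) \<Rightarrow> real" where "den v = of_int (edenom (pt v))"

lemma den_pos:
  assumes "v \<in> Zn n" "v \<noteq> 0"
  shows "den v > 0"
proof -
  obtain x y where x: "pt v = Pt x y" using pt_affine[OF assms] .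
  then have "on_curve E (Pt x y)" using corresponds_on_curve[OF pt_corr[of v]] by simp
  then show ?thesis using edenom_pos by (simp add: den_def x)
qed

lemma den_par:
  assumes pq: "p \<in> Zn n" "q \<in> Zn n" "p \<noteq> 0" "q \<noteq> 0" "p + q \<noteq> 0" "p - q \<noteq> 0"
  shows "den (p + q) * den (p - q) = den p ^ 2 * den q ^ 2 * norm (\<wp> (zsum q) - \<wp> (zsum p))"
proof -
  obtain x1 y1 where x1: "pt p = Pt x1 y1" using pt_affine[OF pq(1,3)] .
  obtain x2 y2 where x2: "pt q = Pt x2 y2" using pt_affine[OF pq(2,4)] .
  have Z: "p + q \<in> Zn n" "p - q \<in> Zn n" using pq by (auto intro: Zn_intros)
  obtain xp yp where xp: "pt (p + q) = Pt xp yp" using pt_affine[OF Z(1) pq(5)] .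
  obtain xm ym where xm: "pt (p - q) = Pt xm ym" using pt_affine[OF Z(2) pq(6)] .
  have cv: "on_curve E (pt v)" for v by (rule corresponds_on_curve[OF pt_corr])
  have dif: "\<wp> (zsum q) - \<wp> (zsum p) = of_real (of_rat (x2 - x1))"
    using pt_corr[of p] pt_corr[of q] by (simp add: x1 x2 corresponds_Pt of_rat_diff of_real_of_rat_complex)
  have nL: "zsum p \<notin> L" "zsum q \<notin> L" "zsum p + zsum q \<notin> L" "zsum p - zsum q \<notin> L"
    using zsum_in_L pq Z by (auto simp flip: zsum_add zsum_diff)
  have ne: "x1 \<noteq> x2"
    using dif wp_eq_iff[OF nL(1,2)] nL by auto
  have ns: "nonsing_red E l (Pt x1 y1)" if "prime l" for l
    unfolding x1[symmetric] using that corr good by (intro nonsing_red_lincomb[of l n z]) auto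
  have "of_int (edenom (Pt xp yp) * edenom (Pt xm ym)) =
    (of_int (edenom (Pt x1 y1) ^ 2 * edenom (Pt x2 y2) ^ 2) * \<bar>x1 - x2\<bar> :: rat)"
  proof (rule edenom_parallelogram)
    show "on_curve E (Pt x1 y1)" "on_curve E (Pt x2 y2)" "on_curve E (Pt xp yp)" "on_curve E (Pt xm ym)"
      using cv[of p] cv[of q] cv[of "p + q"] cv[of "p - q"] by (simp_all only: x1 x2 xp xm)
    show "eadd E (Pt x1 y1) (Pt x2 y2) = Pt xp yp"
      using pt_add[of p q] by (simp only: x1 x2 xp)
    show "eadd E (Pt x1 y1) (eneg E (Pt x2 y2)) = Pt xm ym"
      using pt_diff[of p q] by (simp only: x1 x2 xm)
  qed (use ns ne in auto)
  then have "(of_rat (of_int (edenom (Pt xp yp) * edenom (Pt xm ym))) :: real) =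
    of_rat (of_int (edenom (Pt x1 y1) ^ 2 * edenom (Pt x2 y2) ^ 2) * \<bar>x1 - x2\<bar>)"
    by (rule arg_cong)
  then have "den (p + q) * den (p - q) = den p ^ 2 * den q ^ 2 * \<bar>of_rat (x1 - x2)\<bar>"
    unfolding den_def x1 x2 xp xm by (simp only: of_rat_mult of_rat_of_int_eq of_int_mult of_int_power of_rat_power of_rat_abs_real)
  moreover have "norm (\<wp> (zsum q) - \<wp> (zsum p)) = \<bar>of_rat (x1 - x2)\<bar>"
    unfolding dif norm_of_real by (simp add: of_rat_diff abs_minus_commute)
  ultimately show ?thesis by simp
qed

text \<open>At 0 the quotient is undefined since both nets vanish; the value 0 is the only one
  compatible with the parallelogram law.\<close>

definition log_ratio :: "(nat \<Rightarrow> int) \<Rightarrow> real" where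
  "log_ratio v = (if v = 0 then 0 else ln (den v / norm (\<Psi> v)))"

lemma log_ratio_par:
  assumes pq: "p \<in> Zn n" "q \<in> Zn n" "p \<noteq> 0" "q \<noteq> 0" "p + q \<noteq> 0" "p - q \<noteq> 0"
  shows "log_ratio (p + q) + log_ratio (p - q) = 2 * log_ratio p + 2 * log_ratio q"
proof -
  define x where "x = norm (\<wp> (zsum q) - \<wp> (zsum p))"
  have Z: "p + q \<in> Zn n" "p - q \<in> Zn n" using pq by (auto intro: Zn_intros)
  have nL: "zsum p \<notin> L" "zsum q \<notin> L" using zsum_in_L pq by auto
  have d: "den (p + q) * den (p - q) = den p ^ 2 * den q ^ 2 * x"
    unfolding x_def by (rule den_par[OF pq])
  have "norm (\<Psi> (p + q) * \<Psi> (p - q)) = norm (\<Psi> p ^ 2 * \<Psi> q ^ 2 * (\<wp> (zsum q) - \<wp> (zsum p)))"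
    unfolding Psi_par[OF nL] ..
  then have f: "norm (\<Psi> (p + q)) * norm (\<Psi> (p - q)) = norm (\<Psi> p) ^ 2 * norm (\<Psi> q) ^ 2 * x"
    by (simp add: norm_mult norm_power x_def)
  have pos: "den p > 0" "den q > 0" "den (p + q) > 0" "den (p - q) > 0"
    "norm (\<Psi> p) > 0" "norm (\<Psi> q) > 0" "norm (\<Psi> (p + q)) > 0" "norm (\<Psi> (p - q)) > 0"
    using pq Z den_pos Psi_eq_0_iff by auto
  have x0: "x \<noteq> 0" using f pos by auto
  have "log_ratio (p + q) + log_ratio (p - q) = ln ((den (p + q) / norm (\<Psi> (p + q))) * (den (p - q) / norm (\<Psi> (p - q))))"
    using pos pq by (subst ln_mult) (auto simp: log_ratio_def)
  also have "(den (p + q) / norm (\<Psi> (p + q))) * (den (p - q) / norm (\<Psi> (p - q)))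
     = (den p ^ 2 * den q ^ 2 * x) / (norm (\<Psi> p) ^ 2 * norm (\<Psi> q) ^ 2 * x)"
    unfolding d[symmetric] f[symmetric] by simp
  also have "\<dots> = (den p / norm (\<Psi> p)) ^ 2 * (den q / norm (\<Psi> q)) ^ 2"
    using x0 by (simp add: power_divide)
  also have "ln \<dots> = 2 * log_ratio p + 2 * log_ratio q"
    using pos pq by (subst ln_mult) (auto simp: log_ratio_def ln_realpow)
  finally show ?thesis .
qed

lemma log_ratio_even:
  assumes "p \<in> Zn n"
  shows "log_ratio (- p) = log_ratio p"
proof -
  have "edenom (eneg E Q) = edenom Q" if c: "on_curve E Q" for Q
  proof (cases Q)
    case (Pt x y)
    obtain A B D where f: "denom_form x y A B D" using denom_form_exists c Pt by blast
    \<comment> \<open>Negation alters the numerator of y by its sign and a multiple of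
      \<open>D\<close>, so the fraction over D^3 stays reduced.\<close>
    define B' where "B' = - B - a1 E * A * D - a3 E * D ^ 3"
    have "coprime D ((- B) + D * (- a1 E * A - a3 E * D ^ 2))"
      using f by (intro coprime_add_multiple) (simp add: denom_form_def coprime_commute)
    moreover have "(- B) + D * (- a1 E * A - a3 E * D ^ 2) = B'"
      by (simp add: B'_def algebra_simps power2_eq_square power3_eq_cube)
    ultimately have "coprime B' D" by (simp add: coprime_commute)
    moreover have "- y - of_int (a1 E) * x - of_int (a3 E) = of_int B' / of_int D ^ 3"
      using f by (simp add: denom_form_def B'_def field_simps power2_eq_square power3_eq_cube)
    ultimately have "denom_form x (- y - of_int (a1 E) * x - of_int (a3 E)) A B' D"
      using f by (simp add: denom_form_def)
    then show ?thesis using f by (simp add: Pt eneg_def denom_form_edenom)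
  qed (simp add: eneg_def)
  then have "den (- p) = den p"
    unfolding den_def pt_uminus using corresponds_on_curve[OF pt_corr] by simp
  then show ?thesis by (simp add: log_ratio_def Psi_odd)
qed

text \<open>Here reality of \<open>\<Psi>\<close> is decisive: sign times absolute value gives back
  \<open>\<Psi>\<close> itself, and the remaining factor is the positive ratio of denominator and
  absolute value.\<close>

lemma denom_net_eq:
  assumes v: "v \<in> Zn n"
  shows "complex_of_real (of_rat (denom_net E L n P z v)) = \<Psi> v * exp (of_real (log_ratio v))"
proof (cases "v = 0")
  case True
  then have "v = (\<lambda>_. 0)" by (simp add: zero_fun_def)
  then show ?thesis using Psi_eq_0_iff[OF v] True by (simp add: denom_net_def)
next
  case False
  then have nz: "v \<noteq> (\<lambda>_. 0)" by (simp add: zero_fun_def)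
  define u where "u = Re (\<Psi> v)"
  have re: "\<Psi> v = of_real u" using Psi_real[OF v] by (simp add: u_def of_real_Re)
  have u0: "u \<noteq> 0" using Psi_eq_0_iff[OF v] False by (simp add: re)
  have nu: "norm (\<Psi> v) = \<bar>u\<bar>" by (simp add: re)
  have e: "exp (log_ratio v) = den v / \<bar>u\<bar>"
    using den_pos[OF v False] u0 False by (simp add: log_ratio_def nu)
  have "of_rat (denom_net E L n P z v) = (-1) ^ Parity u * den v"
    using nz by (simp add: denom_net_def den_def u_def of_rat_mult of_rat_power of_rat_minus)
  also have "\<dots> = u * exp (log_ratio v)"
    using u0 unfolding e by (cases "u > 0") (auto simp: Parity_def)
  finally show ?thesis
    unfolding re by (simp add: exp_of_real)
qed

theorem denom_net_elliptic: "elliptic_net n (denom_net E L n P z)"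
proof -
  define W where "W = denom_net E L n P z"
  have "W (p + q + s) * W (p - q) * W (r + s) * W r
      + W (q + r + s) * W (q - r) * W (p + s) * W p
      + W (r + p + s) * W (r - p) * W (q + s) * W q = 0"
    if Z: "p \<in> Zn n" "q \<in> Zn n" "r \<in> Zn n" "s \<in> Zn n" for p q r s
  proof -
    \<comment> \<open>The symmetric exponent common to the three terms, so its exponential factors
      out of the relation for \<open>\<Psi>\<close>. The relation is verified in the complex numbers
      and pulled back along the embedding of the rationals.\<close>
    define K where "K = log_ratio (p + s) + log_ratio (q + s) + log_ratio (r + s) + log_ratio p + log_ratio q + log_ratio r - log_ratio s"
    note S = parallelogram_net_sum[where n = n and \<phi> = log_ratio, OF _ log_ratio_even log_ratio_par]
    have p0: "log_ratio 0 = 0" by (simp add: log_ratio_def)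
    have 1: "log_ratio (p + q + s) + log_ratio (p - q) + log_ratio (r + s) + log_ratio r = K"
      using S[OF p0 _ _ _ _ _ _ _ Z(1,2,3,4)] by (simp add: K_def)
    have 2: "log_ratio (q + r + s) + log_ratio (q - r) + log_ratio (p + s) + log_ratio p = K"
      using S[OF p0 _ _ _ _ _ _ _ Z(2,3,1,4)] by (simp add: K_def)
    have 3: "log_ratio (r + p + s) + log_ratio (r - p) + log_ratio (q + s) + log_ratio q = K"
      using S[OF p0 _ _ _ _ _ _ _ Z(3,1,2,4)] by (simp add: K_def)
    have summand: "complex_of_real (of_rat (W u * W u' * W w * W w')) = exp (of_real K) * (\<Psi> u * \<Psi> u' * \<Psi> w * \<Psi> w')"
      if "log_ratio u + log_ratio u' + log_ratio w + log_ratio w' = K" "u \<in> Zn n" "u' \<in> Zn n" "w \<in> Zn n" "w' \<in> Zn n" for u u' w w'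
      unfolding that(1)[symmetric] W_def of_rat_mult of_real_mult of_real_add exp_add denom_net_eq[OF that(2)]
        denom_net_eq[OF that(3)] denom_net_eq[OF that(4)] denom_net_eq[OF that(5)]
      by (simp only: mult_ac)
    have "complex_of_real (of_rat (W (p + q + s) * W (p - q) * W (r + s) * W r
      + W (q + r + s) * W (q - r) * W (p + s) * W p
      + W (r + p + s) * W (r - p) * W (q + s) * W q)) = 0"
      unfolding of_rat_add of_real_add
      by (subst summand[OF 1] summand[OF 2] summand[OF 3]; (intro Zn_intros Z)?)+
         (simp only: distrib_left[symmetric] Psi_net mult_zero_right)
    then show ?thesis by simp
  qed
  moreover have "W (\<lambda>_. 0) = 0" by (simp add: W_def denom_net_def)
  ultimately show ?thesis
    unfolding elliptic_net_def W_def[symmetric] plus_fun_def fun_diff_def by blast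
qed

end

lemma lincomb_ind_Inf:
  assumes "P 0 = Inf"
  shows "lincomb E k (ind {0}) P = Inf"
  using assms by (induction k) (auto simp: zmul_def ind_def eadd_def)

theorem theorem1p16:
  fixes E :: wcurve and n :: nat and P :: "nat \<Rightarrow> ept"
    and w1 w2 :: complex and z :: "nat \<Rightarrow> complex"
  assumes nonsing: "disc E \<noteq> 0"
    and on_E: "\<forall>i<n. on_curve E (P i)"
    and indep: "lin_indep E n P"
    and good_red: "\<forall>i<n. \<forall>l::int. prime l \<longrightarrow> nonsing_red E l (P i)"
    and basis: "is_lattice_basis w1 w2"
    and g2_eq: "g2 (lattice w1 w2) = of_int (c4 E) / 12"
    and g3_eq: "g3 (lattice w1 w2) = of_int (c6 E) / 216"
    and corr: "\<forall>i<n. corresponds E (lattice w1 w2) (z i) (P i)"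
  shows "elliptic_net n (denom_net E (lattice w1 w2) n P z)"
proof (cases "n = 0")
  \<comment> \<open>Without points there is nowhere to evaluate the differential equation, but the
    only vector is then 0.\<close>
  case True
  then have "Zn n = {\<lambda>_. 0}" by (auto simp: Zn_def)
  then show ?thesis by (simp add: elliptic_net_def denom_net_def)
next
  case False
  interpret period_lattice w1 w2 by standard (rule basis)
  \<comment> \<open>A point at infinity would itself be a linear relation. So \<open>P 0\<close> is
    affine and can serve as the point at which the constant of the differential equation is
    determined.\<close>
  have "P 0 \<noteq> Inf"
  proof
    assume "P 0 = Inf"
    then have "lincomb E n (ind {0}) P = Inf" by (rule lincomb_ind_Inf)
    moreover have "ind {0} \<in> Zn n" using False by (intro ind_Zn) auto
    ultimately have "ind {0} 0 = 0" using indep False by (auto simp: lin_indep_def)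
    then show False by (simp add: ind_def)
  qed
  then obtain x y where P0: "P 0 = Pt x y" by (cases "P 0") auto
  have "on_curve E (Pt x y)" "corresponds E L (z 0) (Pt x y)"
    using on_E corr False by (auto simp flip: P0)
  note ode = ode_from_point[OF g2_eq this]
  interpret uniformized_curve w1 w2 E by standard (use g2_eq ode in auto)
  interpret elliptic_points w1 w2 E n P z by standard (use corr indep good_red in auto)
  show ?thesis by (rule denom_net_elliptic)
qed

end
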